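(* Let $u$ be a solution of (P) for $p=1$ with kernel $K$ and data $(f,g)$, and $(u_n)$ a sequence of solutions of (P) for $p=1$ with kernels $K_n$ and data $(f_n,g_n)$. Assume $K,K_n$ are nonnegative, measurable and symmetric, $K,K_n\in L^{\infty,2}(\Omega^2)$, $g,g_n\in L^2(\Omega)$ and $f,f_n\in L^1([0,T];L^2(\Omega))$. Then: (i) $u$ and $u_n$ are the unique solutions of the corresponding evolution problems. (ii) $\|u_n-u\|_{C([0,T];L^2(\Omega))}\le\|g_n-g\|_{L^2(\Omega)}+\|f_n-f\|_{L^1([0,T];L^2(\Omega))}+T\|K_n-K\|_{L^2(\Omega^2)}$. (iii) Moreover, if $K_n\to K$ pointwise a.e. on $\Omega^2$, $g_n\to g$ pointwise a.e. on $\Omega$, $f_n\to f$ pointwise a.e. on $\Omega\times[0,T]$, and $(|K_n|^2)$ is uniformly integrable over $\Omega^2$, $(|g_n|^2)$ is uniformly integrable on $\Omega$ and $(|f_n|^2)$ is uniformly integrable on $\Omega\times[0,T]$, then $\lim_{n\to\infty}\|u_n-u\|_{C([0,T];L^2(\Omega))}=0$.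
   Context: $d\ge1$, $\Omega=[0,1]^d$, $T>0$. $\|F\|_{L^{\infty,2}(\Omega^2)}=\sup_{x}\|F(x,\cdot)\|_{L^2(\Omega)}$. Let $\partial|\cdot|(s)=\{1\}$ if $s>0$, $[-1,1]$ if $s=0$, $\{-1\}$ if $s<0$. The $1$-Laplacian: $\eta\in\Delta_1^Ku$ iff $\eta(x)=-\int_\Omega K(x,y)w(x,y)\,dy$ a.e. for some $w$ with $\|w\|_{L^\infty(\Omega^2)}\le1$, $w(x,y)=-w(y,x)$, $w(x,y)\in\partial|\cdot|(u(y)-u(x))$. A solution of (P) for $p=1$ with kernel $K$ and data $(f,g)$ on $[0,T]$ is $u\in C([0,T];L^1(\Omega))\cap W^{1,1}(]0,T[;L^1(\Omega))$ with $u(\cdot,0)=g$ a.e. and $\partial_tu=-\eta+f$ a.e. in $\Omega\times]0,T[$, where $\eta(\cdot,t)\in\Delta_1^Ku(\cdot,t)$. $\|u\|_{C([0,T];L^2)}=\sup_t\|u(\cdot,t)\|_{L^2}$; $\|f\|_{L^1([0,T];L^2)}=\int_0^T\|f(\cdot,t)\|_{L^2}dt$. *)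

theory Defs
  imports "HOL-Analysis.Analysis"
begin

definition Omega :: "(real^'n) set" where
  "Omega = cbox 0 1"

definition subdiff_abs :: "real \<Rightarrow> real set" where
  "subdiff_abs s = (if s > 0 then {1} else if s = 0 then {-1..1} else {-1})"

definition one_laplacian ::
  "(real^'n \<Rightarrow> real^'n \<Rightarrow> real) \<Rightarrow> (real^'n \<Rightarrow> real) \<Rightarrow> (real^'n \<Rightarrow> real) \<Rightarrow> bool" where
  "one_laplacian K u \<eta> \<longleftrightarrow>
     (\<exists>w :: real^'n \<Rightarrow> real^'n \<Rightarrow> real.
        (\<lambda>z. w (fst z) (snd z)) \<in> borel_measurable (lebesgue_on (Omega \<times> Omega)) \<and>
        (AE z in lebesgue_on (Omega \<times> Omega). \<bar>w (fst z) (snd z)\<bar> \<le> 1) \<and>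
        (AE z in lebesgue_on (Omega \<times> Omega). w (fst z) (snd z) = - w (snd z) (fst z)) \<and>
        (AE z in lebesgue_on (Omega \<times> Omega).
            w (fst z) (snd z) \<in> subdiff_abs (u (snd z) - u (fst z))) \<and>
        (AE x in lebesgue_on Omega.
            \<eta> x = - (\<integral>y. K x y * w x y \<partial>lebesgue_on Omega)))"

definition test_fun :: "real \<Rightarrow> (real \<Rightarrow> real) \<Rightarrow> bool" where
  "test_fun T \<phi> \<longleftrightarrow>
     (\<exists>D :: nat \<Rightarrow> real \<Rightarrow> real. D 0 = \<phi> \<and>
        (\<forall>k t. (D k has_real_derivative D (Suc k) t) (at t))) \<and>
     (\<exists>a b. 0 < a \<and> a \<le> b \<and> b < T \<and> (\<forall>t. t \<notin> {a..b} \<longrightarrow> \<phi> t = 0))"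

definition solution_P1 ::
  "(real^'n \<Rightarrow> real^'n \<Rightarrow> real) \<Rightarrow> (real^'n \<Rightarrow> real \<Rightarrow> real) \<Rightarrow> (real^'n \<Rightarrow> real)
    \<Rightarrow> real \<Rightarrow> (real^'n \<Rightarrow> real \<Rightarrow> real) \<Rightarrow> bool" where
  "solution_P1 K f g T u \<longleftrightarrow>
     \<comment> \<open>u in C([0,T]; L^1(\<Omega>)) (with a jointly measurable representative)\<close>
     (\<lambda>z. u (fst z) (snd z)) \<in> borel_measurable (lebesgue_on (Omega \<times> {0..T})) \<and>
     (\<forall>t\<in>{0..T}. integrable (lebesgue_on Omega) (\<lambda>x. u x t)) \<and>
     (\<forall>t\<in>{0..T}. ((\<lambda>s. \<integral>x. \<bar>u x s - u x t\<bar> \<partial>lebesgue_on Omega) \<longlongrightarrow> 0)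
                    (at t within {0..T})) \<and>
     \<comment> \<open>u in W^{1,1}(]0,T[; L^1(\<Omega>)) with weak time derivative v, and the equation\<close>
     (\<exists>v :: real^'n \<Rightarrow> real \<Rightarrow> real.
        integrable (lebesgue_on (Omega \<times> {0<..<T})) (\<lambda>z. u (fst z) (snd z)) \<and>
        integrable (lebesgue_on (Omega \<times> {0<..<T})) (\<lambda>z. v (fst z) (snd z)) \<and>
        (\<forall>\<phi>. test_fun T \<phi> \<longrightarrow>
           (AE x in lebesgue_on Omega.
              (\<integral>t. u x t * deriv \<phi> t \<partial>lebesgue_on {0<..<T})
                = - (\<integral>t. v x t * \<phi> t \<partial>lebesgue_on {0<..<T}))) \<and>
        (\<exists>\<eta> :: real^'n \<Rightarrow> real \<Rightarrow> real.
           (AE t in lebesgue_on {0<..<T}. one_laplacian K (\<lambda>x. u x t) (\<lambda>x. \<eta> x t)) \<and>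
           (AE z in lebesgue_on (Omega \<times> {0<..<T}).
              v (fst z) (snd z) = - \<eta> (fst z) (snd z) + f (fst z) (snd z)))) \<and>
     \<comment> \<open>initial condition\<close>
     (AE x in lebesgue_on Omega. u x 0 = g x)"

definition in_Linf2 :: "(real^'n \<Rightarrow> real^'n \<Rightarrow> real) \<Rightarrow> bool" where
  "in_Linf2 K \<longleftrightarrow>
     (\<lambda>z. K (fst z) (snd z)) \<in> borel_measurable (lebesgue_on (Omega \<times> Omega)) \<and>
     (\<exists>C. AE x in lebesgue_on Omega.
            integrable (lebesgue_on Omega) (\<lambda>y. (K x y)\<^sup>2) \<and>
            (\<integral>y. (K x y)\<^sup>2 \<partial>lebesgue_on Omega) \<le> C)"

definition in_L2 :: "'a measure \<Rightarrow> ('a \<Rightarrow> real) \<Rightarrow> bool" where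
  "in_L2 M h \<longleftrightarrow> h \<in> borel_measurable M \<and> integrable M (\<lambda>x. (h x)\<^sup>2)"

definition norm_L2 :: "'a measure \<Rightarrow> ('a \<Rightarrow> real) \<Rightarrow> ennreal" where
  "norm_L2 M h = (if in_L2 M h then ennreal (sqrt (\<integral>x. (h x)\<^sup>2 \<partial>M)) else \<infinity>)"

definition in_L1L2 :: "real \<Rightarrow> (real^'n \<Rightarrow> real \<Rightarrow> real) \<Rightarrow> bool" where
  "in_L1L2 T f \<longleftrightarrow>
     (\<lambda>z. f (fst z) (snd z)) \<in> borel_measurable (lebesgue_on (Omega \<times> {0..T})) \<and>
     (AE t in lebesgue_on {0..T}. in_L2 (lebesgue_on Omega) (\<lambda>x. f x t)) \<and>
     integrable (lebesgue_on {0..T}) (\<lambda>t. sqrt (\<integral>x. (f x t)\<^sup>2 \<partial>lebesgue_on Omega))"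

definition norm_L1L2 :: "real \<Rightarrow> (real^'n \<Rightarrow> real \<Rightarrow> real) \<Rightarrow> ennreal" where
  "norm_L1L2 T f = (\<integral>\<^sup>+t. norm_L2 (lebesgue_on Omega) (\<lambda>x. f x t) \<partial>lebesgue_on {0..T})"

definition norm_CL2 :: "real \<Rightarrow> (real^'n \<Rightarrow> real \<Rightarrow> real) \<Rightarrow> ennreal" where
  "norm_CL2 T u = (SUP t\<in>{0..T}. norm_L2 (lebesgue_on Omega) (\<lambda>x. u x t))"

definition unif_integrable :: "'a measure \<Rightarrow> (nat \<Rightarrow> 'a \<Rightarrow> real) \<Rightarrow> bool" where
  "unif_integrable M h \<longleftrightarrow>
     (\<forall>n. h n \<in> borel_measurable M) \<and>
     ((\<lambda>c::real. SUP n. \<integral>\<^sup>+x\<in>{x \<in> space M. c < \<bar>h n x\<bar>}. ennreal \<bar>h n x\<bar> \<partial>M)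
        \<longlongrightarrow> 0) at_top"

end

theory Submission
  imports Defs "HOL-Computational_Algebra.Polynomial"
begin

text \<open>For two solutions the difference \<open>d = u1 - u2\<close> is an absolutely continuous curve in \<open>L\<^sup>1\<close>, and
  \<open>d(x, t)\<^sup>2 = d(x, 0)\<^sup>2 + 2 \<integral> d \<partial>\<^sub>t d\<close> can be integrated over \<open>x\<close>. In the resulting energy identity the
  antisymmetry of the multipliers \<open>w1\<close>, \<open>w2\<close> and the monotonicity of the subdifferential give the
  1-Laplacian terms carrying \<open>K1\<close> a favourable sign; what remains is bounded by
  \<open>\<parallel>d\<parallel> (\<parallel>K1 - K2\<parallel> + \<parallel>f1 - f2\<parallel>)\<close>. A Gronwall argument for \<open>\<parallel>d\<parallel>\<^sup>2\<close> yields the stability estimate, hence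
  uniqueness, and Vitali's theorem applied to the right-hand side yields convergence.\<close>

section \<open>Borel representatives for Lebesgue measure on a set\<close>

text \<open>A solution is a priori only a curve in L^1, so the energy identity needs an L^2 bound
  first. The equation supplies it: |w| <= 1 bounds the 1-Laplacian in L^2 by the norm of the kernel,
  so the time derivative of d has L^2 norm at most some integrable N(s), and Minkowski's inequality
  puts the integral of its absolute value over time in L^2 with respect to x. Together with |d(x,
  0)| this dominates d at all times and justifies Fubini in the energy identity. The multipliers
  come with no measurability in time. They are picked at each time separately, and only the scalar
  inequality that they yield at almost every s is integrated. The weak formulation has its own null
  set of x for each test function, which is why it is integrated over sets in space before time is
  treated. The Gronwall step cannot divide by the norm of d, which may vanish; the comparison
  function starts at the initial norm plus an arbitrary positive number. Omega having measure 1
  gives the kernel term its constant 1, and the kernels being independent of time gives the factor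
  T.\<close>

text \<open>This measure has \<open>lebesgue_on S\<close> as its completion up to the carrier, which is kept to be the whole
  type so that product measures and Borel measurability need no restriction.\<close>

definition lborel_ind :: "'a::euclidean_space set \<Rightarrow> 'a measure" where
  "lborel_ind S = density lborel (indicator S)"

lemma space_lborel_ind [simp]: "space (lborel_ind S) = UNIV"
  by (simp add: lborel_ind_def)

lemma sets_lborel_ind [simp, measurable_cong]: "sets (lborel_ind S) = sets borel"
  by (simp add: lborel_ind_def)

lemma AE_lborel_ind_iff:
  assumes "S \<in> sets borel"
  shows "(AE x in lborel_ind S. P x) \<longleftrightarrow> (AE x in lborel. x \<in> S \<longrightarrow> P x)"
proof -
  have [measurable]: "indicator S \<in> borel_measurable (borel :: 'a measure)"
    using assms by simp
  show ?thesis
    unfolding lborel_ind_def by (subst AE_density) (auto simp: indicator_def)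
qed

lemma AE_lebesgue_on_iff:
  assumes "S \<in> sets borel"
  shows "(AE x in lebesgue_on S. P x) \<longleftrightarrow> (AE x in lborel_ind S. P x)"
  using assms by (simp add: AE_lborel_ind_iff AE_restrict_space_iff AE_completion_iff)

text \<open>Extended by 0 off \<open>S\<close>, the function is measurable for the completion of
  \<open>lborel\<close>, and such a function agrees almost everywhere with a Borel one. The
  solutions, kernels, multipliers and data enter the later arguments through such
  representatives.\<close>

lemma borel_measurable_lebesgue_on_ex_borel:
  fixes f :: "'a::euclidean_space \<Rightarrow> real"
  assumes "S \<in> sets borel" "f \<in> borel_measurable (lebesgue_on S)"
  obtains f' where "f' \<in> borel_measurable borel" "AE x in lborel_ind S. f x = f' x"
proof -
  have "(\<lambda>x. if x \<in> S then f x else 0) \<in> borel_measurable lebesgue"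
    using assms borel_measurable_if_I by (metis sets_completionI_sets sets_lborel)
  then obtain f' where "f' \<in> borel_measurable lborel"
    "AE x in lborel. (if x \<in> S then f x else 0) = f' x"
    using completion_ex_borel_measurable_real by blast
  with assms show ?thesis
    by (intro that[of f']) (auto simp: AE_lborel_ind_iff)
qed

context
  fixes f f' :: "'a::euclidean_space \<Rightarrow> real" and S
  assumes S: "S \<in> sets borel" and f': "f' \<in> borel_measurable borel"
    and eq: "AE x in lborel_ind S. f x = f' x"
begin

lemma borel_measurable_lebesgue_on_AE_eq: "f \<in> borel_measurable (lebesgue_on S)"
proof (rule borel_measurable_if_D, rule borel_measurable_AE)
  have [measurable]: "f' \<in> borel_measurable borel" "S \<in> sets borel" using S f' by auto
  show "(\<lambda>x. if x \<in> S then f' x else 0) \<in> borel_measurable lebesgue"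
    by (intro measurable_completion) simp
  show "AE x in lebesgue. (if x \<in> S then f' x else 0) = (if x \<in> S then f x else 0)"
    using eq by (simp add: S AE_lborel_ind_iff AE_completion_iff) (auto elim!: AE_mp)
qed

text \<open>The integrand is an arbitrary function \<open>h\<close> of point and value, so that the
  norm, the positive and negative parts and the square are all instances.\<close>

lemma nn_integral_lebesgue_on_AE_eq:
  "(\<integral>\<^sup>+x. h x (f x) \<partial>lebesgue_on S) = (\<integral>\<^sup>+x. h x (f' x) \<partial>lborel_ind S)"
  if "(\<lambda>x. h x (f' x)) \<in> borel_measurable borel"
proof -
  have "(\<integral>\<^sup>+x. h x (f x) \<partial>lebesgue_on S) = (\<integral>\<^sup>+x. h x (f' x) \<partial>lebesgue_on S)"
    using eq by (intro nn_integral_cong_AE) (simp add: S AE_lebesgue_on_iff, auto elim!: AE_mp)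
  also have "\<dots> = (\<integral>\<^sup>+x. h x (f' x) \<partial>lborel_ind S)"
    using that S unfolding lborel_ind_def
    by (simp add: nn_integral_restrict_space nn_integral_completion nn_integral_density mult.commute)
  finally show ?thesis .
qed

lemma integrable_lebesgue_on_AE_eq:
  "integrable (lebesgue_on S) f \<longleftrightarrow> integrable (lborel_ind S) f'"
proof -
  have [measurable]: "f' \<in> borel_measurable borel" "S \<in> sets borel" using S f' by auto
  have "(\<integral>\<^sup>+x. ennreal (norm (f x)) \<partial>lebesgue_on S) = (\<integral>\<^sup>+x. ennreal (norm (f' x)) \<partial>lborel_ind S)"
    by (intro nn_integral_lebesgue_on_AE_eq) measurable
  then show ?thesis
    using borel_measurable_lebesgue_on_AE_eq
    by (simp add: integrable_iff_bounded)
qed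

lemma integral_lebesgue_on_AE_eq:
  "integral\<^sup>L (lebesgue_on S) f = integral\<^sup>L (lborel_ind S) f'"
proof (cases "integrable (lebesgue_on S) f")
  case True
  have [measurable]: "f' \<in> borel_measurable borel" "S \<in> sets borel" using S f' by auto
  have "(\<integral>\<^sup>+x. ennreal (f x) \<partial>lebesgue_on S) = (\<integral>\<^sup>+x. ennreal (f' x) \<partial>lborel_ind S)"
       "(\<integral>\<^sup>+x. ennreal (- f x) \<partial>lebesgue_on S) = (\<integral>\<^sup>+x. ennreal (- f' x) \<partial>lborel_ind S)"
    by (rule nn_integral_lebesgue_on_AE_eq, measurable)+
  with True integrable_lebesgue_on_AE_eq show ?thesis
    by (simp add: real_lebesgue_integral_def)
next
  \<comment> \<open>Neither function is integrable in this case, and both integrals take the default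
    value 0.\<close>
  case False
  with integrable_lebesgue_on_AE_eq show ?thesis
    by (simp add: not_integrable_integral_eq)
qed

end

lemma sigma_finite_lborel_ind: "sigma_finite_measure (lborel_ind S)" if "S \<in> sets borel"
  unfolding lborel_ind_def using that
  by (subst sigma_finite_measure.sigma_finite_iff_density_finite) (auto simp: sigma_finite_lborel indicator_def)

lemma finite_measure_lborel_ind:
  assumes "S \<in> sets borel" "emeasure lborel S < \<infinity>"
  shows "finite_measure (lborel_ind S)"
  using assms by (intro finite_measureI) (simp add: lborel_ind_def emeasure_density)

lemma emeasure_lborel_ind_UNIV:
  "S \<in> sets borel \<Longrightarrow> emeasure (lborel_ind S) UNIV = emeasure lborel S"
  by (simp add: lborel_ind_def emeasure_density)

text \<open>Turns almost-everywhere statements and integrals over a product set into ones for a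
  genuine product measure, to which the Fubini theorems apply.\<close>

lemma lborel_ind_Times:
  assumes [measurable]: "A \<in> sets borel" "B \<in> sets borel"
  shows "lborel_ind A \<Otimes>\<^sub>M lborel_ind B = lborel_ind (A \<times> B)"
proof -
  have "lborel_ind A \<Otimes>\<^sub>M lborel_ind B = density (lborel \<Otimes>\<^sub>M lborel) (\<lambda>(x,y). indicator A x * indicator B y)"
    using sigma_finite_lborel_ind[of B] sigma_finite_lborel unfolding lborel_ind_def
    by (subst pair_measure_density) auto
  also have "\<dots> = lborel_ind (A \<times> B)"
    by (simp add: lborel_prod lborel_ind_def indicator_def case_prod_beta' mem_Times_iff cong: if_cong)
       (rule arg_cong[where f="density lborel"], auto)
  finally show ?thesis .
qed

section \<open>A smooth step function\<close>

text \<open>Smoothness in \<open>test_fun\<close> is the existence of a whole sequence of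
  derivatives, which is awkward to build for a product. Differentiability of finite order is stable
  under products by induction on the order, and the sequence is recovered afterwards.\<close>

primrec ndiff :: "nat \<Rightarrow> (real \<Rightarrow> real) \<Rightarrow> bool" where
  "ndiff 0 f \<longleftrightarrow> True"
| "ndiff (Suc n) f \<longleftrightarrow> (\<exists>f'. (\<forall>t. (f has_real_derivative f' t) (at t)) \<and> ndiff n f')"

lemma ndiff_Suc_deriv:
  "ndiff (Suc n) f \<longleftrightarrow> (\<forall>t. (f has_real_derivative deriv f t) (at t)) \<and> ndiff n (deriv f)"
proof
  assume "ndiff (Suc n) f"
  then obtain f' where f': "\<And>t. (f has_real_derivative f' t) (at t)" "ndiff n f'" by auto
  then have "deriv f = f'" by (auto intro: DERIV_imp_deriv)
  with f' show "(\<forall>t. (f has_real_derivative deriv f t) (at t)) \<and> ndiff n (deriv f)" by simp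
qed auto

lemma ndiff_SucD: "ndiff (Suc n) f \<Longrightarrow> ndiff n f"
  by (induction n arbitrary: f) fastforce+

lemma ndiff_add: "ndiff n f \<Longrightarrow> ndiff n g \<Longrightarrow> ndiff n (\<lambda>t. f t + g t)"
proof (induction n arbitrary: f g)
  case (Suc n)
  then obtain f' g' where "\<And>t. (f has_real_derivative f' t) (at t)" "ndiff n f'"
    "\<And>t. (g has_real_derivative g' t) (at t)" "ndiff n g'" by auto
  then show ?case
    using Suc.IH by (auto intro!: exI[of _ "\<lambda>t. f' t + g' t"] derivative_eq_intros)
qed simp

lemma ndiff_mult: "ndiff n f \<Longrightarrow> ndiff n g \<Longrightarrow> ndiff n (\<lambda>t. f t * g t)"
proof (induction n arbitrary: f g)
  case (Suc n)
  then obtain f' g' where D: "\<And>t. (f has_real_derivative f' t) (at t)" "ndiff n f'"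
    "\<And>t. (g has_real_derivative g' t) (at t)" "ndiff n g'" by auto
  have "((\<lambda>t. f t * g t) has_real_derivative f' t * g t + f t * g' t) (at t)" for t
    using D by (auto intro!: derivative_eq_intros)
  \<comment> \<open>The product rule mixes orders: \<open>f\<close> and \<open>g\<close> are one
    order better than \<open>f'\<close> and \<open>g'\<close>, and are lowered to order
    \<open>n\<close> by \<open>ndiff_SucD\<close>.\<close>
  moreover have "ndiff n (\<lambda>t. f' t * g t + f t * g' t)"
    using Suc D by (intro ndiff_add Suc.IH) (auto simp del: ndiff.simps intro: ndiff_SucD)
  ultimately show ?case
    by (auto intro!: exI[of _ "\<lambda>t. f' t * g t + f t * g' t"])
qed simp

lemma derivative_sequence_ndiff:
  assumes "D 0 = f" "\<And>k t. (D k has_real_derivative D (Suc k) t) (at t)"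
  shows "ndiff n f"
proof -
  have "ndiff n (D k)" for k
    using assms(2) by (induction n arbitrary: k) auto
  then show ?thesis using assms(1) by metis
qed

text \<open>The derivatives that witness different orders \<open>n\<close> must fit into one
  sequence. Iterating \<open>deriv\<close> makes the choice canonical.\<close>

lemma ndiff_imp_derivative_sequence:
  assumes "\<And>n. ndiff n f"
  obtains D where "D 0 = f" "\<And>k t. (D k has_real_derivative D (Suc k) t) (at t)"
proof
  have *: "ndiff n ((deriv ^^ k) f)" for n k
  proof (induction k arbitrary: n)
    case (Suc k)
    from Suc[of "Suc n"] show ?case by (simp add: ndiff_Suc_deriv del: ndiff.simps)
  qed (simp add: assms)
  show "((deriv ^^ k) f has_real_derivative (deriv ^^ Suc k) f t) (at t)" for k t
    using *[of "Suc 0" k] by (simp add: ndiff_Suc_deriv del: ndiff.simps)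
qed simp

text \<open>The derivatives of \<open>exp (- 1 / t)\<close> are \<open>poly (flat_poly k) (1 / t) * exp (- 1 / t)\<close>.\<close>

primrec flat_poly :: "nat \<Rightarrow> real poly" where
  "flat_poly 0 = 1"
| "flat_poly (Suc k) = [:0, 0, 1:] * (flat_poly k - pderiv (flat_poly k))"

definition flat_deriv :: "nat \<Rightarrow> real \<Rightarrow> real" where
  "flat_deriv k t = (if t > 0 then poly (flat_poly k) (1 / t) * exp (- 1 / t) else 0)"

lemma poly_times_exp_tendsto_0: "((\<lambda>s. poly p s * exp (- s)) \<longlongrightarrow> (0::real)) at_top"
proof -
  have "((\<lambda>s. \<Sum>i\<le>degree p. coeff p i * (s ^ i / exp s)) \<longlongrightarrow> (\<Sum>i\<le>degree p. coeff p i * 0)) at_top"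
    by (intro tendsto_intros tendsto_power_div_exp_0)
  then show ?thesis
    by (simp add: poly_altdef sum_distrib_right sum_divide_distrib exp_minus field_simps)
qed

lemma flat_deriv_has_derivative:
  "(flat_deriv k has_real_derivative flat_deriv (Suc k) t) (at t)"
proof -
  consider "t > 0" | "t < 0" | "t = 0" by linarith
  then show ?thesis
  proof cases
    case 1
    \<comment> \<open>With s = 1 / t, ds/dt = -s^2, so the derivative of P(s) exp(-s) with respect
      to t is s^2 (P(s) - P'(s)) exp(-s). This is the recursion of \<open>flat_poly\<close>.\<close>
    have "((\<lambda>t. poly (flat_poly k) (1 / t) * exp (- 1 / t)) has_real_derivative flat_deriv (Suc k) t) (at t)"
      using 1 by (auto intro!: derivative_eq_intros poly_DERIV[THEN DERIV_chain2]
          simp: flat_deriv_def field_simps power2_eq_square)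
    moreover have "\<forall>\<^sub>F x in nhds t. flat_deriv k x = poly (flat_poly k) (1 / x) * exp (- 1 / x)"
      using 1 by (intro eventually_mono[OF eventually_nhds_in_open[of "{0<..}" t]]) (auto simp: flat_deriv_def)
    ultimately show ?thesis
      by (subst DERIV_cong_ev[OF refl _ refl])
  next
    case 2
    have "((\<lambda>t. 0) has_real_derivative flat_deriv (Suc k) t) (at t)"
      using 2 by (auto simp: flat_deriv_def)
    moreover have "\<forall>\<^sub>F x in nhds t. flat_deriv k x = 0"
      using 2 by (intro eventually_mono[OF eventually_nhds_in_open[of "{..<0}" t]]) (auto simp: flat_deriv_def)
    ultimately show ?thesis
      by (subst DERIV_cong_ev[OF refl _ refl])
  next
    case 3
    \<comment> \<open>The difference quotient at 0 has an extra factor 1 / t, that is, one more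
      power of s = 1 / t; \<open>pCons 0\<close> multiplies the polynomial by s.\<close>
    have "((\<lambda>t. poly (pCons 0 (flat_poly k)) (inverse t) * exp (- inverse t)) \<longlongrightarrow> 0) (at_right 0)"
      by (rule filterlim_compose[OF poly_times_exp_tendsto_0 filterlim_inverse_at_top_right])
    then have "((\<lambda>t. flat_deriv k t / t) \<longlongrightarrow> 0) (at_right 0)"
      by (rule Lim_transform_eventually)
         (auto simp: flat_deriv_def eventually_at_filter field_simps)
    moreover have "((\<lambda>t. flat_deriv k t / t) \<longlongrightarrow> 0) (at_left 0)"
      by (rule tendsto_eventually) (auto simp: flat_deriv_def eventually_at_filter)
    ultimately have "((\<lambda>t. flat_deriv k t / t) \<longlongrightarrow> 0) (at 0)"
      using filterlim_split_at by blast
    then show ?thesis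
      using 3 by (simp add: has_field_derivative_iff flat_deriv_def)
  qed
qed

text \<open>The product h(t) h(1 - t) of flat functions is a smooth bump that is positive exactly on
  the open unit interval; its primitive \<open>G\<close>, divided by \<open>G 1\<close>, is the
  step. Besides the sequence \<open>D\<close> for \<open>test_fun\<close>, the first derivative is
  exported as \<open>\<beta>\<close>, a nonnegative kernel of mass 1 for mollification.\<close>

lemma smooth_step_exists:
  obtains S \<beta> :: "real \<Rightarrow> real" and D
  where "D 0 = S" "\<And>k t. (D k has_real_derivative D (Suc k) t) (at t)"
    "\<And>t. (S has_real_derivative \<beta> t) (at t)" "continuous_on UNIV \<beta>" "\<And>t. \<beta> t \<ge> 0"
    "\<And>t. t \<notin> {0..1} \<Longrightarrow> \<beta> t = 0" "\<And>t. t \<le> 0 \<Longrightarrow> S t = 0" "\<And>t. t \<ge> 1 \<Longrightarrow> S t = 1"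
proof -
  define h where "h = flat_deriv 0"
  define b where "b t = h t * h (1 - t)" for t
  have h: "h t = (if t > 0 then exp (- 1 / t) else 0)" for t
    by (simp add: h_def flat_deriv_def)
  have "ndiff n h" for n
    using flat_deriv_has_derivative h_def by (intro derivative_sequence_ndiff) auto
  moreover have "ndiff n (\<lambda>t. h (1 - t))" for n
  proof (rule derivative_sequence_ndiff[where D="\<lambda>k t. (-1) ^ k * flat_deriv k (1 - t)"])
    show "((\<lambda>t. (-1) ^ k * flat_deriv k (1 - t)) has_real_derivative
       (-1) ^ Suc k * flat_deriv (Suc k) (1 - t)) (at t)" for k t
      by (auto intro!: derivative_eq_intros flat_deriv_has_derivative[THEN DERIV_chain2] simp: algebra_simps)
  qed (simp add: h_def)
  ultimately have "ndiff n b" for n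
    unfolding b_def by (rule ndiff_mult)
  then obtain B where B: "B 0 = b" "\<And>k t. (B k has_real_derivative B (Suc k) t) (at t)"
    using ndiff_imp_derivative_sequence by metis
  have b_cont: "continuous_on UNIV b"
    using B by (metis DERIV_isCont continuous_at_imp_continuous_on)
  define G where "G t = (LBINT s=ereal 0..ereal t. b s)" for t
  have G': "(G has_real_derivative b t) (at t)" for t
  proof -
    \<comment> \<open>The fundamental theorem is applied on a compact interval chosen to contain
      both 0 and, in its interior, \<open>t\<close>; the derivative within it is then a full
      derivative.\<close>
    define M where "M = \<bar>t\<bar> + 1"
    have "(G has_vector_derivative b t) (at t within {-M..M})"
      unfolding G_def by (rule interval_integral_FTC2) (auto simp: M_def intro: continuous_on_subset[OF b_cont])
    moreover have "at t within {-M..M} = at t"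
      by (rule at_within_interior) (auto simp: M_def)
    ultimately show ?thesis
      by (simp add: has_real_derivative_iff_has_vector_derivative)
  qed
  have G_cont: "continuous_on A G" for A
    using G' by (meson DERIV_isCont continuous_at_imp_continuous_on)
  have b0: "b t = 0" if "t \<le> 0 \<or> t \<ge> 1" for t
    using that by (auto simp: b_def h)
  have G0: "G t = 0" if "t \<le> 0" for t
  proof (cases "t = 0")
    case False
    have "(G has_real_derivative 0) (at x)" if "x < 0" for x
      using G'[of x] b0[of x] that by simp
    with False that have "G 0 = G t"
      by (intro DERIV_isconst_end[of t 0 G] G_cont) auto
    then show ?thesis by (simp add: G_def)
  qed (simp add: G_def)
  have G1: "G t = G 1" if "t \<ge> 1" for t
  proof (cases "t = 1")
    case False
    have "(G has_real_derivative 0) (at x)" if "x > 1" for x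
      using G'[of x] b0[of x] that by simp
    with False that show ?thesis
      by (intro DERIV_isconst_end[of 1 t G] G_cont) auto
  qed simp
  have "G 0 < G 1"
  proof (rule DERIV_pos_imp_increasing_open[OF _ _ G_cont])
    show "\<exists>y. (G has_real_derivative y) (at x) \<and> 0 < y" if "0 < x" "x < 1" for x
      using that by (intro exI[of _ "b x"] conjI G') (simp add: b_def h)
  qed simp
  then have pos: "G 1 > 0" using G0 by simp
  show thesis
  proof (rule that[of "\<lambda>k t. (case k of 0 \<Rightarrow> G t | Suc k \<Rightarrow> B k t) / G 1" "\<lambda>t. G t / G 1" "\<lambda>t. b t / G 1"])
    show "((\<lambda>t. (case k of 0 \<Rightarrow> G t | Suc k \<Rightarrow> B k t) / G 1) has_real_derivative
        (case Suc k of 0 \<Rightarrow> G t | Suc k \<Rightarrow> B k t) / G 1) (at t)" for k t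
      by (cases k) (auto intro!: DERIV_cdivide G' B(2) simp: B(1))
    show "((\<lambda>t. G t / G 1) has_real_derivative b t / G 1) (at t)" for t
      by (intro DERIV_cdivide G')
    show "continuous_on UNIV (\<lambda>t. b t / G 1)"
      using pos by (intro continuous_intros b_cont) auto
    show "0 \<le> b t / G 1" for t
      using pos by (auto simp: b_def h)
    show "b t / G 1 = 0" if "t \<notin> {0..1}" for t
      using that b0[of t] by auto
    show "G t / G 1 = 1" if "1 \<le> t" for t
      using that pos G1[of t] by simp
  qed (simp_all add: G0)
qed

section \<open>Weak time derivatives\<close>

lemma integral_lborel_ind:
  fixes f :: "'a::euclidean_space \<Rightarrow> real"
  assumes [measurable]: "S \<in> sets borel" "f \<in> borel_measurable borel"
  shows "integral\<^sup>L (lborel_ind S) f = (\<integral>x. indicator S x * f x \<partial>lborel)"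
  using integral_density[of f lborel "indicator S"]
  by (simp add: lborel_ind_def ennreal_indicator)

lemma AE_lborel_ind_in: "S \<in> sets borel \<Longrightarrow> AE x in lborel_ind S. x \<in> S"
  by (simp add: AE_lborel_ind_iff)

lemma AE_lborel_ind_neq: "S \<in> sets borel \<Longrightarrow> AE x in lborel_ind S. x \<noteq> c"
  using AE_lborel_singleton[of c] by (auto simp: AE_lborel_ind_iff elim!: AE_mp)

lemma integrable_indicator_mult [intro]:
  fixes f :: "'a \<Rightarrow> real"
  shows "A \<in> sets M \<Longrightarrow> integrable M f \<Longrightarrow> integrable M (\<lambda>x. indicator A x * f x)"
  using integrable_mult_indicator[of A M f] by simp

text \<open>Dominated convergence: as the endpoint moves to \<open>t\<close>, the indicators
  converge at every point except possibly \<open>t\<close>, which is a null set.\<close>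

lemma continuous_on_integral_atMost:
  fixes V :: "real \<Rightarrow> real"
  assumes S: "S \<in> sets borel" and V: "integrable (lborel_ind S) V"
  shows "continuous_on A (\<lambda>t. \<integral>s. indicator {..t} s * V s \<partial>lborel_ind S)"
proof (rule continuous_at_imp_continuous_on, rule ballI)
  fix t
  have [measurable]: "V \<in> borel_measurable borel" using V by (auto dest: borel_measurable_integrable)
  show "isCont (\<lambda>t. \<integral>s. indicator {..t} s * V s \<partial>lborel_ind S) t"
    unfolding continuous_at_sequentially
  proof (intro allI impI)
    fix X :: "nat \<Rightarrow> real" assume X: "X \<longlonglongrightarrow> t"
    show "((\<lambda>t. \<integral>s. indicator {..t} s * V s \<partial>lborel_ind S) \<circ> X) \<longlonglongrightarrow>
        (\<integral>s. indicator {..t} s * V s \<partial>lborel_ind S)"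
      unfolding o_def
    proof (rule integral_dominated_convergence[where w="\<lambda>s. \<bar>V s\<bar>"])
      show "AE s in lborel_ind S. (\<lambda>n. indicator {..X n} s * V s) \<longlonglongrightarrow> indicator {..t} s * V s"
        using AE_lborel_ind_neq[OF S, of t]
      proof eventually_elim
        case (elim s)
        have "\<forall>\<^sub>F n in sequentially. (indicator {..X n} s :: real) = indicator {..t} s"
        proof (cases "s < t")
          case True
          show ?thesis
            using order_tendstoD(1)[OF X True] by eventually_elim (use True in auto)
        next
          case False
          then have "t < s" using elim by simp
          show ?thesis
            using order_tendstoD(2)[OF X \<open>t < s\<close>] by eventually_elim (use \<open>t < s\<close> in auto)
        qed
        then show ?case
          by (intro tendsto_eventually) (auto elim!: eventually_mono)
      qed
    qed (use V in \<open>auto simp: indicator_def\<close>)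
  qed
qed

text \<open>The test functions are mollified indicators of \<open>{a<..b}\<close>, whose derivatives approximate the
  difference of the Dirac masses at \<open>a\<close> and \<open>b\<close>.\<close>

lemma weak_derivative_increment:
  fixes U V :: "real \<Rightarrow> real"
  assumes cont: "continuous_on {0..T} U" and U [measurable]: "U \<in> borel_measurable borel"
    and V: "integrable (lborel_ind {0..T}) V"
    and weak: "\<And>\<phi>. test_fun T \<phi> \<Longrightarrow>
      (\<integral>t. U t * deriv \<phi> t \<partial>lborel_ind {0..T}) = - (\<integral>t. V t * \<phi> t \<partial>lborel_ind {0..T})"
    and ab: "0 < a" "a \<le> b" "b < T"
  shows "U b - U a = (\<integral>s. indicator {a<..b} s * V s \<partial>lborel_ind {0..T})"
proof -
  obtain S \<beta> D where D: "D 0 = S" "\<And>k t. (D k has_real_derivative D (Suc k) t) (at t)"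
    and S': "\<And>t. (S has_real_derivative \<beta> t) (at t)" and \<beta>_cont: "continuous_on UNIV \<beta>"
    and \<beta>: "\<And>t. \<beta> t \<ge> 0" "\<And>t. t \<notin> {0..1} \<Longrightarrow> \<beta> t = 0"
    and S0: "\<And>t. t \<le> 0 \<Longrightarrow> S t = 0" and S1: "\<And>t. t \<ge> 1 \<Longrightarrow> S t = 1"
    using smooth_step_exists by metis
  have [measurable]: "\<beta> \<in> borel_measurable borel"
    using \<beta>_cont by (simp add: borel_measurable_continuous_onI)
  have [measurable]: "S \<in> borel_measurable borel"
    using S' by (intro borel_measurable_continuous_onI continuous_at_imp_continuous_on)
      (auto intro: DERIV_isCont)
  have [measurable]: "V \<in> borel_measurable borel" using V by (auto dest: borel_measurable_integrable)
  have "has_bochner_integral lborel (\<lambda>x. \<beta> x * indicator {0..1} x) (S 1 - S 0)"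
    using \<beta>_cont by (intro has_bochner_integral_FTC_Icc_real S') (auto simp: continuous_on_eq_continuous_at)
  moreover have "(\<lambda>x. \<beta> x * indicator {0..1} x) = \<beta>"
    using \<beta>(2) by (auto simp: indicator_def fun_eq_iff)
  ultimately have int_\<beta>: "integrable lborel \<beta>" "integral\<^sup>L lborel \<beta> = 1"
    by (auto simp: has_bochner_integral_iff S0 S1)
  have mono_S: "S x \<le> S y" if "x \<le> y" for x y
  proof (rule DERIV_nonneg_imp_nondecreasing[OF that])
    show "\<exists>y. (S has_real_derivative y) (at x) \<and> 0 \<le> y" for x
      using S'[of x] \<beta>(1)[of x] by blast
  qed
  have S_bounds: "0 \<le> S x" "S x \<le> 1" for x
    using mono_S[of "min x 0" x] mono_S[of x "max x 1"] S0[of "min x 0"] S1[of "max x 1"] by auto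
  \<comment> \<open>Extending \<open>U\<close> by its end values keeps it continuous and makes it
    bounded on the whole line, so the substitutions below need no care about the domain.\<close>
  define U' where "U' t = U (max 0 (min T t))" for t
  have U'_cont: "continuous_on UNIV U'"
    unfolding U'_def using ab
    by (intro continuous_on_compose2[OF cont] continuous_intros) auto
  then have [measurable]: "U' \<in> borel_measurable borel"
    by (simp add: borel_measurable_continuous_onI)
  obtain M where "\<And>t. t \<in> {0..T} \<Longrightarrow> \<bar>U t\<bar> \<le> M"
    using compact_continuous_image[OF cont] compact_imp_bounded
    by (metis bounded_iff compact_Icc image_eqI real_norm_def)
  then have M: "\<bar>U' t\<bar> \<le> M" for t
    using ab by (simp add: U'_def)
  \<comment> \<open>The ramps of the test functions have width \<open>1 / C n\<close>. The summand
    \<open>1 / (T - b)\<close> makes the falling ramp, which starts at \<open>b\<close>, end before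
    \<open>T\<close>; the summand \<open>n\<close> makes the widths shrink to 0.\<close>
  define C where "C n = real n + 1 / (T - b) + 1" for n
  have C: "C n > 0" "1 / C n < T - b" for n
  proof -
    show "C n > 0" using ab by (auto simp: C_def intro!: add_nonneg_pos)
    have "1 / (T - b) < C n" by (simp add: C_def)
    then show "1 / C n < T - b" using ab \<open>C n > 0\<close> by (simp add: field_simps)
  qed
  have C_lim: "filterlim C at_top sequentially"
    using ab by (intro filterlim_at_top_mono[OF filterlim_real_sequentially]) (auto simp: C_def)
  define \<phi> where "\<phi> n t = S (C n * (t - a)) - S (C n * (t - b))" for n t
  have \<phi>': "(\<phi> n has_real_derivative C n * \<beta> (C n * (t - a)) - C n * \<beta> (C n * (t - b))) (at t)" for n t
    unfolding \<phi>_def by (auto intro!: derivative_eq_intros S'[THEN DERIV_chain2])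
  have deriv_\<phi>: "deriv (\<phi> n) t = C n * \<beta> (C n * (t - a)) - C n * \<beta> (C n * (t - b))" for n t
    using \<phi>' by (rule DERIV_imp_deriv)
  have test: "test_fun T (\<phi> n)" for n
    unfolding test_fun_def
  proof (intro conjI)
    show "\<exists>D. D 0 = \<phi> n \<and> (\<forall>k t. (D k has_real_derivative D (Suc k) t) (at t))"
      by (rule exI[of _ "\<lambda>k t. C n ^ k * D k (C n * (t - a)) - C n ^ k * D k (C n * (t - b))"])
         (auto simp: D(1) \<phi>_def fun_eq_iff algebra_simps intro!: derivative_eq_intros D(2)[THEN DERIV_chain2])
    show "\<exists>a b. 0 < a \<and> a \<le> b \<and> b < T \<and> (\<forall>t. t \<notin> {a..b} \<longrightarrow> \<phi> n t = 0)"
    proof (rule exI[of _ a], rule exI[of _ "b + 1 / C n"], intro conjI allI impI)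
      show "a \<le> b + 1 / C n" "b + 1 / C n < T" using C[of n] ab by (auto intro: add_increasing2)
      fix t assume "t \<notin> {a..b + 1 / C n}"
      then consider "t < a" | "t > b + 1 / C n" by fastforce
      then show "\<phi> n t = 0"
      proof cases
        case 1
        then have "C n * (t - a) \<le> 0" "C n * (t - b) \<le> 0"
          using C(1)[of n] ab by (auto intro!: mult_nonneg_nonpos)
        then show ?thesis by (simp add: \<phi>_def S0)
      next
        case 2
        then have "1 \<le> C n * (t - b)" using C(1)[of n] by (simp add: field_simps)
        moreover have "C n * (t - b) \<le> C n * (t - a)"
          using C(1)[of n] ab by (intro mult_left_mono) auto
        ultimately show ?thesis by (simp add: \<phi>_def S1)
      qed
    qed (use ab in auto)
  qed
  \<comment> \<open>The substitution t = c + s / C n turns the rescaled bump into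
    \<open>\<beta>\<close>, which has mass 1, and moves the dependence on \<open>n\<close> into the
    argument of \<open>U'\<close>.\<close>
  have part: "integrable lborel (\<lambda>t. U' t * (C n * \<beta> (C n * (t - c))))"
    "(\<integral>t. U' t * (C n * \<beta> (C n * (t - c))) \<partial>lborel) = (\<integral>s. U' (c + s / C n) * \<beta> s \<partial>lborel)"
    for n c
  proof -
    have "integrable lborel (\<lambda>s. U' (c + s / C n) * \<beta> s)"
    proof (rule Bochner_Integration.integrable_bound[of _ "\<lambda>s. M * \<beta> s"])
      show "AE s in lborel. norm (U' (c + s / C n) * \<beta> s) \<le> norm (M * \<beta> s)"
        using M \<beta>(1) by (auto simp: abs_mult intro!: AE_I2 mult_right_mono order_trans[OF M])
    qed (use int_\<beta> in auto)
    then have "integrable lborel (\<lambda>s. U' (c + (1 / C n) * s) * (C n * \<beta> (C n * (c + (1 / C n) * s - c))))"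
      using C(1)[of n] by (simp add: ac_simps)
    then show "integrable lborel (\<lambda>t. U' t * (C n * \<beta> (C n * (t - c))))"
      by (subst (asm) lborel_integrable_real_affine_iff) (use C(1)[of n] in auto)
    show "(\<integral>t. U' t * (C n * \<beta> (C n * (t - c))) \<partial>lborel) = (\<integral>s. U' (c + s / C n) * \<beta> s \<partial>lborel)"
      by (subst lborel_integral_real_affine[of "1 / C n" _ c])
         (use C(1)[of n] in \<open>auto simp: field_simps\<close>)
  qed
  have part_lim: "(\<lambda>n. \<integral>s. U' (c + s / C n) * \<beta> s \<partial>lborel) \<longlonglongrightarrow> U' c" for c
  proof -
    have "(\<lambda>n. \<integral>s. U' (c + s / C n) * \<beta> s \<partial>lborel) \<longlonglongrightarrow> (\<integral>s. U' c * \<beta> s \<partial>lborel)"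
    proof (rule integral_dominated_convergence[where w="\<lambda>s. M * \<beta> s"])
      show "AE s in lborel. (\<lambda>n. U' (c + s / C n) * \<beta> s) \<longlonglongrightarrow> U' c * \<beta> s"
      proof (rule AE_I2)
        fix s
        have "(\<lambda>n. c + s / C n) \<longlonglongrightarrow> c + 0"
          by (intro tendsto_add tendsto_const tendsto_divide_0[OF tendsto_const]
            filterlim_at_top_imp_at_infinity C_lim)
        then have "(\<lambda>n. U' (c + s / C n)) \<longlonglongrightarrow> U' c"
          using U'_cont isCont_tendsto_compose[of c U' "\<lambda>n. c + s / C n" sequentially]
          by (simp add: continuous_on_eq_continuous_at)
        then show "(\<lambda>n. U' (c + s / C n) * \<beta> s) \<longlonglongrightarrow> U' c * \<beta> s"
          by (intro tendsto_intros)
      qed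
      show "AE s in lborel. norm (U' (c + s / C n) * \<beta> s) \<le> M * \<beta> s" for n
        using M \<beta>(1) by (auto simp: abs_mult intro!: AE_I2 mult_right_mono)
    qed (use int_\<beta> in auto)
    then show ?thesis using int_\<beta> by simp
  qed
  have "(\<integral>t. U t * deriv (\<phi> n) t \<partial>lborel_ind {0..T}) =
      (\<integral>s. U' (a + s / C n) * \<beta> s \<partial>lborel) - (\<integral>s. U' (b + s / C n) * \<beta> s \<partial>lborel)" for n
  proof -
    have "(\<integral>t. U t * deriv (\<phi> n) t \<partial>lborel_ind {0..T}) = (\<integral>t. indicator {0..T} t * (U t * deriv (\<phi> n) t) \<partial>lborel)"
      unfolding deriv_\<phi> by (rule integral_lborel_ind) auto
    also have "\<dots> = (\<integral>t. U' t * (C n * \<beta> (C n * (t - a))) - U' t * (C n * \<beta> (C n * (t - b))) \<partial>lborel)"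
    \<comment> \<open>Off \<open>{0..T}\<close> the indicator kills the left side. The right side
      vanishes as well, since the bumps live on \<open>{a..a + 1 / C n}\<close> and
      \<open>{b..b + 1 / C n}\<close>, both inside \<open>{0..T}\<close>.\<close>
    proof (rule Bochner_Integration.integral_cong[OF refl])
      fix t
      show "indicator {0..T} t * (U t * deriv (\<phi> n) t)
        = U' t * (C n * \<beta> (C n * (t - a))) - U' t * (C n * \<beta> (C n * (t - b)))"
      proof (cases "t \<in> {0..T}")
        case True
        then show ?thesis by (simp add: U'_def deriv_\<phi> algebra_simps)
      next
        case False
        then consider "t < 0" | "t > T" by fastforce
        then have "C n * (t - a) \<notin> {0..1} \<and> C n * (t - b) \<notin> {0..1}"
        proof (cases)
          case 1
          then have "C n * (t - a) < 0" "C n * (t - b) < 0"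
            using C(1)[of n] ab by (auto intro!: mult_pos_neg)
          then show ?thesis by auto
        next
          case 2
          then have "t - b > 1 / C n" "t - a > 1 / C n" using C(2)[of n] ab by auto
          then have "C n * (t - a) > 1" "C n * (t - b) > 1"
            using C(1)[of n] by (auto simp: field_simps)
          then show ?thesis by auto
        qed
        then show ?thesis using False \<beta>(2) by simp
      qed
    qed
    also have "\<dots> = (\<integral>s. U' (a + s / C n) * \<beta> s \<partial>lborel) - (\<integral>s. U' (b + s / C n) * \<beta> s \<partial>lborel)"
      by (simp add: part)
    finally show ?thesis .
  qed
  then have "(\<lambda>n. \<integral>t. U t * deriv (\<phi> n) t \<partial>lborel_ind {0..T}) \<longlonglongrightarrow> U' a - U' b"
    by (simp add: tendsto_diff[OF part_lim part_lim])
  then have lhs: "(\<lambda>n. - (\<integral>t. V t * \<phi> n t \<partial>lborel_ind {0..T})) \<longlonglongrightarrow> U a - U b"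
    using ab by (simp add: weak[OF test] U'_def)
  have "(\<lambda>n. (\<integral>t. V t * \<phi> n t \<partial>lborel_ind {0..T})) \<longlonglongrightarrow> (\<integral>s. indicator {a<..b} s * V s \<partial>lborel_ind {0..T})"
  proof (rule integral_dominated_convergence[where w="\<lambda>s. 2 * \<bar>V s\<bar>"])
    \<comment> \<open>At t = c the argument of \<open>S\<close> is 0 for every \<open>n\<close> and
      \<open>S 0 = 0\<close>; hence the limit is the indicator of an open half-line and the
      resulting interval is \<open>{a<..b}\<close>.\<close>
    have step: "(\<lambda>n. S (C n * (t - c))) \<longlonglongrightarrow> indicator {c<..} t" for t c
    proof (cases "t \<le> c")
      case True
      then have "S (C n * (t - c)) = 0" for n
        using C(1)[of n] by (intro S0 mult_nonneg_nonpos) auto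
      then show ?thesis using True by simp
    next
      case False
      have "\<forall>\<^sub>F n in sequentially. C n \<ge> 1 / (t - c)"
        using C_lim by (simp add: filterlim_at_top)
      then have "\<forall>\<^sub>F n in sequentially. S (C n * (t - c)) = indicator {c<..} t"
        by eventually_elim (use False in \<open>auto intro!: S1 simp: field_simps\<close>)
      then show ?thesis by (rule tendsto_eventually)
    qed
    have "(\<lambda>n. \<phi> n t) \<longlonglongrightarrow> indicator {a<..} t - indicator {b<..} t" for t
      unfolding \<phi>_def by (intro tendsto_diff step)
    moreover have "indicator {a<..} t - indicator {b<..} t = (indicator {a<..b} t :: real)" for t
      using ab by (auto simp: indicator_def)
    ultimately show "AE t in lborel_ind {0..T}. (\<lambda>n. V t * \<phi> n t) \<longlonglongrightarrow> indicator {a<..b} t * V t"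
      by (intro AE_I2) (auto simp: mult.commute intro!: tendsto_intros)
    have "\<bar>\<phi> n t\<bar> \<le> 2" for n t
      unfolding \<phi>_def using S_bounds[of "C n * (t - a)"] S_bounds[of "C n * (t - b)"] by linarith
    then show "AE t in lborel_ind {0..T}. norm (V t * \<phi> n t) \<le> 2 * \<bar>V t\<bar>" for n
      by (auto simp: abs_mult mult.commute intro!: AE_I2 mult_left_mono)
    show "(\<lambda>t. V t * \<phi> n t) \<in> borel_measurable (lborel_ind {0..T})" for n
      unfolding \<phi>_def by measurable
  qed (use V in auto)
  from LIMSEQ_unique[OF tendsto_minus[OF this] lhs] show ?thesis
    by simp
qed

text \<open>By the increment formula \<open>U\<close> minus the primitive of \<open>V\<close> is
  constant on the open interval. Both are continuous up to the endpoints, so the constant persists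
  there, and the primitive is 0 at time 0.\<close>

lemma weak_derivative_integral:
  fixes U V :: "real \<Rightarrow> real"
  assumes cont: "continuous_on {0..T} U" and U [measurable]: "U \<in> borel_measurable borel"
    and V: "integrable (lborel_ind {0..T}) V"
    and weak: "\<And>\<phi>. test_fun T \<phi> \<Longrightarrow>
      (\<integral>t. U t * deriv \<phi> t \<partial>lborel_ind {0..T}) = - (\<integral>t. V t * \<phi> t \<partial>lborel_ind {0..T})"
    and T: "0 < T" and t: "t \<in> {0..T}"
  shows "U t - U 0 = (\<integral>s. indicator {..t} s * V s \<partial>lborel_ind {0..T})"
proof -
  define F where "F t = (\<integral>s. indicator {..t} s * V s \<partial>lborel_ind {0..T})" for t
  have F_diff: "F b - F a = (\<integral>s. indicator {a<..b} s * V s \<partial>lborel_ind {0..T})" if "a \<le> b" for a b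
  proof -
    have "F b - F a = (\<integral>s. indicator {..b} s * V s - indicator {..a} s * V s \<partial>lborel_ind {0..T})"
      unfolding F_def using V by (subst Bochner_Integration.integral_diff) auto
    also have "\<dots> = (\<integral>s. indicator {a<..b} s * V s \<partial>lborel_ind {0..T})"
      using that by (intro Bochner_Integration.integral_cong) (auto simp: indicator_def)
    finally show ?thesis .
  qed
  have const: "U b - F b = U a - F a" if "0 < a" "a \<le> b" "b < T" for a b
    using weak_derivative_increment[OF cont U V weak that] F_diff[of a b] that by simp
  have const': "U s - F s = U (T/2) - F (T/2)" if "s \<in> {0<..<T}" for s
    using const[of s "T/2"] const[of "T/2" s] that T by (cases "s \<le> T/2") auto
  have "continuous_on {0..T} (\<lambda>s. U s - F s)"
    unfolding F_def using V by (intro continuous_on_diff cont continuous_on_integral_atMost) auto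
  moreover have "closure {0<..<T} = {0..T}" using T by simp
  ultimately have "U s - F s = U (T/2) - F (T/2)" if "s \<in> {0..T}" for s
    using continuous_constant_on_closure[of "{0<..<T}" "\<lambda>s. U s - F s" "U (T/2) - F (T/2)" s]
      that const' by presburger
  from this[OF t] this[of 0] have "U t - U 0 = F t - F 0" using T by simp
  moreover have "F 0 = (\<integral>s. 0 \<partial>lborel_ind {0..T})"
    unfolding F_def
  proof (rule integral_cong_AE)
    have "AE s in lborel_ind {0..T}. s \<noteq> 0" "AE s in lborel_ind {0..T}. s \<in> {0..T}"
      by (rule AE_lborel_ind_neq AE_lborel_ind_in, simp)+
    then show "AE s in lborel_ind {0..T}. indicator {..0} s * V s = 0"
      by eventually_elim (auto split: split_indicator)
  qed (use V in \<open>auto dest: borel_measurable_integrable\<close>)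
  ultimately show ?thesis by (simp add: F_def)
qed

section \<open>The unit cube, slices of null sets, and the integral formula for solutions\<close>

lemma Omega_borel [simp, measurable]: "Omega \<in> sets borel"
  by (simp add: Omega_def)

lemma inner_1_Basis_vec: "b \<in> Basis \<Longrightarrow> (1 :: real^'n) \<bullet> b = 1"
  by (auto simp: Basis_vec_def inner_axis)

lemma emeasure_lborel_Omega [simp]: "emeasure lborel (Omega :: (real^'n) set) = 1"
  unfolding Omega_def by (simp add: emeasure_lborel_cbox_eq inner_1_Basis_vec)

text \<open>Reconciles the open interval of the weak derivative with the closed one of continuity
  and of the data.\<close>

lemma lborel_ind_open_closed: "lborel_ind {0<..<T} = lborel_ind {0..T::real}"
  unfolding lborel_ind_def
proof (rule density_cong)
  show "AE x in lborel. indicator {0<..<T} x = (indicator {0..T} x :: ennreal)"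
    using AE_lborel_singleton[of 0] AE_lborel_singleton[of T]
    by eventually_elim (auto split: split_indicator)
qed auto

lemma (in pair_sigma_finite) AE_pair_snd:
  assumes "AE z in M1 \<Otimes>\<^sub>M M2. P z"
  shows "AE y in M2. AE x in M1. P (x, y)"
proof -
  interpret Q: pair_sigma_finite M2 M1 ..
  have "AE z in distr (M2 \<Otimes>\<^sub>M M1) (M1 \<Otimes>\<^sub>M M2) (\<lambda>(x, y). (y, x)). P z"
    using assms unfolding distr_pair_swap[symmetric] .
  then have "AE z in M2 \<Otimes>\<^sub>M M1. P (case z of (x, y) \<Rightarrow> (y, x))"
    by (rule AE_distrD[OF measurable_pair_swap'])
  then show ?thesis
    by (auto dest!: Q.AE_pair)
qed

lemma pair_sigma_finite_lborel_ind:
  "A \<in> sets borel \<Longrightarrow> B \<in> sets borel \<Longrightarrow> pair_sigma_finite (lborel_ind A) (lborel_ind B)"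
  by (simp add: pair_sigma_finite_def sigma_finite_lborel_ind)

lemma test_fun_measurable_bounded:
  assumes "test_fun T \<phi>"
  shows "\<phi> \<in> borel_measurable borel" "deriv \<phi> \<in> borel_measurable borel"
    and "\<exists>C. \<forall>t\<in>{0..T}. \<bar>\<phi> t\<bar> \<le> C \<and> \<bar>deriv \<phi> t\<bar> \<le> C"
proof -
  obtain D where D: "D 0 = \<phi>" "\<And>k t. (D k has_real_derivative D (Suc k) t) (at t)"
    using assms unfolding test_fun_def by blast
  have 1: "deriv \<phi> = D 1"
    using D by (auto intro!: DERIV_imp_deriv simp flip: D(1))
  have cont: "continuous_on A (D k)" for k A
    using D(2) by (meson DERIV_isCont continuous_at_imp_continuous_on)
  have bdd: "\<exists>C. \<forall>t\<in>{0..T}. \<bar>D k t\<bar> \<le> C" for k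
    using compact_imp_bounded[OF compact_continuous_image[OF cont[of "{0..T}" k] compact_Icc]]
    by (auto simp: bounded_iff)
  show "\<phi> \<in> borel_measurable borel" "deriv \<phi> \<in> borel_measurable borel"
    using cont[of UNIV 0] cont[of UNIV 1] 1 D(1) by (auto intro: borel_measurable_continuous_onI)
  obtain C0 C1 where "\<forall>t\<in>{0..T}. \<bar>D 0 t\<bar> \<le> C0" "\<forall>t\<in>{0..T}. \<bar>D 1 t\<bar> \<le> C1"
    using bdd by metis
  then show "\<exists>C. \<forall>t\<in>{0..T}. \<bar>\<phi> t\<bar> \<le> C \<and> \<bar>deriv \<phi> t\<bar> \<le> C"
    unfolding 1 D(1) by (intro exI[of _ "max C0 C1"]) fastforce
qed

text \<open>Integrating the weak formulation over a Borel set \<open>A\<close> in space gives a scalar continuous function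
  of time with weak derivative in \<open>L\<^sup>1\<close>; as \<open>A\<close> is arbitrary the integral formula holds almost everywhere.\<close>

lemma solution_P1_repr:
  fixes u :: "real^'n \<Rightarrow> real \<Rightarrow> real"
  assumes T: "T > 0" and sol: "solution_P1 K f g T u"
  obtains v where "v \<in> borel_measurable (borel \<Otimes>\<^sub>M borel)"
    "integrable (lborel_ind Omega \<Otimes>\<^sub>M lborel_ind {0..T}) v"
    "\<And>t. t \<in> {0..T} \<Longrightarrow> AE x in lborel_ind Omega.
       u x t = g x + (\<integral>s. indicator {..t} s * v (x, s) \<partial>lborel_ind {0..T})"
    "AE t in lborel_ind {0..T}. \<exists>\<eta>. one_laplacian K (\<lambda>x. u x t) \<eta> \<and>
       (AE x in lborel_ind Omega. v (x, t) = - \<eta> x + f x t)"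
proof -
  let ?X = "lborel_ind (Omega :: (real^'n) set)" and ?Y = "lborel_ind {0..T}"
  interpret XY: pair_sigma_finite ?X ?Y by (rule pair_sigma_finite_lborel_ind) auto
  have Times: "lborel_ind ((Omega :: (real^'n) set) \<times> {0<..<T}) = ?X \<Otimes>\<^sub>M ?Y"
    by (simp add: lborel_ind_Times lborel_ind_open_closed flip: lborel_ind_Times)
  have S: "(Omega :: (real^'n) set) \<times> {0<..<T} \<in> sets borel"
    by (simp add: borel_Times)
  obtain v0 \<eta> where
    u_slice: "\<And>t. t \<in> {0..T} \<Longrightarrow> integrable (lebesgue_on Omega) (\<lambda>x. u x t)" and
    u_cont: "\<And>t. t \<in> {0..T} \<Longrightarrow> ((\<lambda>s. \<integral>x. \<bar>u x s - u x t\<bar> \<partial>lebesgue_on Omega) \<longlongrightarrow> 0) (at t within {0..T})" and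
    u_int: "integrable (lebesgue_on (Omega \<times> {0<..<T})) (\<lambda>z. u (fst z) (snd z))" and
    v0_int: "integrable (lebesgue_on (Omega \<times> {0<..<T})) (\<lambda>z. v0 (fst z) (snd z))" and
    weak: "\<And>\<phi>. test_fun T \<phi> \<Longrightarrow> (AE x in lebesgue_on Omega.
              (\<integral>t. u x t * deriv \<phi> t \<partial>lebesgue_on {0<..<T})
                = - (\<integral>t. v0 x t * \<phi> t \<partial>lebesgue_on {0<..<T}))" and
    lap: "AE t in lebesgue_on {0<..<T}. one_laplacian K (\<lambda>x. u x t) (\<lambda>x. \<eta> x t)" and
    eqn: "AE z in lebesgue_on (Omega \<times> {0<..<T}).
              v0 (fst z) (snd z) = - \<eta> (fst z) (snd z) + f (fst z) (snd z)" and
    init: "AE x in lebesgue_on Omega. u x 0 = g x"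
    using sol unfolding solution_P1_def by blast
  obtain u' where u'b: "u' \<in> borel_measurable borel"
    and uu': "AE z in ?X \<Otimes>\<^sub>M ?Y. u (fst z) (snd z) = u' z"
    using borel_measurable_lebesgue_on_ex_borel[OF S borel_measurable_integrable[OF u_int]]
    unfolding Times by blast
  obtain v where vb: "v \<in> borel_measurable borel"
    and v0v: "AE z in ?X \<Otimes>\<^sub>M ?Y. v0 (fst z) (snd z) = v z"
    using borel_measurable_lebesgue_on_ex_borel[OF S borel_measurable_integrable[OF v0_int]]
    unfolding Times by blast
  have u'_int: "integrable (?X \<Otimes>\<^sub>M ?Y) u'"
    using integrable_lebesgue_on_AE_eq[OF S u'b, unfolded Times, OF uu'] u_int by simp
  have v_int: "integrable (?X \<Otimes>\<^sub>M ?Y) v"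
    using integrable_lebesgue_on_AE_eq[OF S vb, unfolded Times, OF v0v] v0_int by simp
  have u'[measurable]: "u' \<in> borel_measurable (borel \<Otimes>\<^sub>M borel)"
    and v[measurable]: "v \<in> borel_measurable (borel \<Otimes>\<^sub>M borel)"
    using u'b vb by (simp_all add: borel_prod)
  have lap': "AE t in ?Y. one_laplacian K (\<lambda>x. u x t) (\<lambda>x. \<eta> x t)"
    using lap unfolding AE_lebesgue_on_iff[OF borel_open[OF open_greaterThanLessThan]] lborel_ind_open_closed .
  have eqn': "AE z in ?X \<Otimes>\<^sub>M ?Y. v z = - \<eta> (fst z) (snd z) + f (fst z) (snd z)"
    using eqn[unfolded AE_lebesgue_on_iff[OF S] Times] v0v by eventually_elim simp
  have init': "AE x in ?X. u x 0 = g x"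
    using init by (simp add: AE_lebesgue_on_iff)
  have 4: "AE t in ?Y. \<exists>\<eta>. one_laplacian K (\<lambda>x. u x t) \<eta> \<and> (AE x in ?X. v (x, t) = - \<eta> x + f x t)"
    using lap' XY.AE_pair_snd[OF eqn'] by eventually_elim auto
  have 3: "AE x in ?X. u x t = g x + (\<integral>s. indicator {..t} s * v (x, s) \<partial>?Y)" if t: "t \<in> {0..T}" for t
  proof -
    \<comment> \<open>Extends functions of time constantly beyond \<open>{0..T}\<close>, so that the
      continuous \<open>U\<close> below is Borel on the whole line.\<close>
    define clamp where "clamp t = max 0 (min T t)" for t
    have clamp: "clamp t \<in> {0..T}" "t \<in> {0..T} \<Longrightarrow> clamp t = t" for t
      using T by (auto simp: clamp_def)
    \<comment> \<open>The joint representative \<open>u'\<close> agrees with \<open>u\<close> on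
      almost every time slice only, whereas the claim is about each \<open>t\<close>. Every slice
      therefore gets its own representative \<open>r s\<close>; measurability of \<open>U\<close> in
      time will come from continuity in L^1.\<close>
    have "\<exists>r. r \<in> borel_measurable borel \<and> (AE x in ?X. u x s = r x)" if "s \<in> {0..T}" for s
      using borel_measurable_lebesgue_on_ex_borel[OF Omega_borel borel_measurable_integrable[OF u_slice[OF that]]]
      by metis
    then obtain r where r: "\<And>s. s \<in> {0..T} \<Longrightarrow> r s \<in> borel_measurable borel"
      and ur: "\<And>s. s \<in> {0..T} \<Longrightarrow> AE x in ?X. u x s = r s x"
      by metis
    have r_int: "integrable ?X (r s)" if "s \<in> {0..T}" for s
      using integrable_lebesgue_on_AE_eq[OF Omega_borel r ur] u_slice that by blast
    have r_cont: "((\<lambda>s. \<integral>x. \<bar>r s x - r t x\<bar> \<partial>?X) \<longlongrightarrow> 0) (at t within {0..T})" if t: "t \<in> {0..T}" for t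
    proof -
      have "(\<integral>x. \<bar>u x s - u x t\<bar> \<partial>lebesgue_on Omega) = (\<integral>x. \<bar>r s x - r t x\<bar> \<partial>?X)" if s: "s \<in> {0..T}" for s
      proof (rule integral_lebesgue_on_AE_eq)
        show "AE x in ?X. \<bar>u x s - u x t\<bar> = \<bar>r s x - r t x\<bar>"
          using ur[OF s] ur[OF t] by eventually_elim simp
        show "(\<lambda>x. \<bar>r s x - r t x\<bar>) \<in> borel_measurable borel"
          using r[OF s] r[OF t] by simp
      qed simp
      then show ?thesis
        using u_cont[OF t] by (rule_tac Lim_transform_eventually) (auto simp: eventually_at_filter)
    qed
    have main: "(\<integral>x. indicator A x * r t x \<partial>?X) - (\<integral>x. indicator A x * r 0 x \<partial>?X)
        = (\<integral>x. indicator A x * (\<integral>s. indicator {..t} s * v (x, s) \<partial>?Y) \<partial>?X)"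
      if A[measurable]: "A \<in> sets borel" for A
    proof -
      define U where "U t = (\<integral>x. indicator A x * r (clamp t) x \<partial>?X)" for t
      define V where "V t = (\<integral>x. indicator A x * v (x, t) \<partial>?X)" for t
      have Av_int: "integrable (?X \<Otimes>\<^sub>M ?Y) (\<lambda>(x, t). indicator A x * v (x, t))"
        by (rule Bochner_Integration.integrable_bound[OF v_int]) (auto split: split_indicator)
      have V_int: "integrable ?Y V"
        unfolding V_def using XY.integrable_snd[OF Av_int] .
      have U_cont: "continuous_on {0..T} U"
        unfolding continuous_on_def
      proof
        fix t assume t: "t \<in> {0..T}"
        have "((\<lambda>s. U s - U t) \<longlongrightarrow> 0) (at t within {0..T})"
        proof (rule Lim_null_comparison[OF _ r_cont[OF t]])
          have "norm (U s - U t) \<le> (\<integral>x. \<bar>r s x - r t x\<bar> \<partial>?X)" if s: "s \<in> {0..T}" for s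
          proof -
            have "U s - U t = (\<integral>x. indicator A x * r s x - indicator A x * r t x \<partial>?X)"
              unfolding U_def clamp(2)[OF s] clamp(2)[OF t]
              using r_int[OF s] r_int[OF t] by (subst Bochner_Integration.integral_diff) auto
            also have "norm \<dots> \<le> (\<integral>x. norm (indicator A x * r s x - indicator A x * r t x) \<partial>?X)"
              by (rule integral_norm_bound)
            also have "\<dots> \<le> (\<integral>x. \<bar>r s x - r t x\<bar> \<partial>?X)"
              using r_int[OF s] r_int[OF t]
              by (intro integral_mono integrable_norm Bochner_Integration.integrable_diff integrable_abs)
                 (auto split: split_indicator)
            finally show ?thesis .
          qed
          then show "\<forall>\<^sub>F s in at t within {0..T}. norm (U s - U t) \<le> (\<integral>x. \<bar>r s x - r t x\<bar> \<partial>?X)"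
            by (auto simp: eventually_at_filter)
        qed
        then show "(U \<longlongrightarrow> U t) (at t within {0..T})"
          by (simp add: LIM_zero_iff)
      qed
      have "U = (\<lambda>t. U (clamp t))"
        using clamp by (auto simp: U_def)
      moreover have "continuous_on UNIV (\<lambda>t. U (clamp t))"
        using clamp(1) by (intro continuous_on_compose2[OF U_cont]) (auto simp: clamp_def intro!: continuous_intros)
      ultimately have U_meas[measurable]: "U \<in> borel_measurable borel"
        by (metis borel_measurable_continuous_onI)
      have U_eq: "AE t in ?Y. U t = (\<integral>x. indicator A x * u' (x, t) \<partial>?X)"
        using XY.AE_pair_snd[OF uu'] AE_lborel_ind_in[OF atLeastAtMost_borel]
      proof eventually_elim
        case (elim t)
        have "AE x in ?X. indicator A x * r t x = indicator A x * u' (x, t)"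
          using elim(1) ur[OF elim(2)] by eventually_elim simp
        moreover note [measurable] = r[OF elim(2)]
        ultimately show ?case
          unfolding U_def clamp(2)[OF elim(2)] by (intro integral_cong_AE) auto
      qed
      have weakU: "(\<integral>t. U t * deriv \<phi> t \<partial>?Y) = - (\<integral>t. V t * \<phi> t \<partial>?Y)" if test: "test_fun T \<phi>" for \<phi>
      proof -
        note [measurable] = test_fun_measurable_bounded(1,2)[OF test]
        obtain C where C: "\<And>t. t \<in> {0..T} \<Longrightarrow> \<bar>\<phi> t\<bar> \<le> C" "\<And>t. t \<in> {0..T} \<Longrightarrow> \<bar>deriv \<phi> t\<bar> \<le> C"
          using test_fun_measurable_bounded(3)[OF test] by blast
        have AE_in: "AE z in ?X \<Otimes>\<^sub>M ?Y. snd z \<in> {0..T}"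
        proof -
          have "AE z in lborel_ind ((Omega :: (real^'n) set) \<times> {0<..<T}). z \<in> Omega \<times> {0<..<T}"
            by (rule AE_lborel_ind_in[OF S])
          then show ?thesis unfolding Times by eventually_elim auto
        qed
        have int_prod: "integrable (?X \<Otimes>\<^sub>M ?Y) (\<lambda>(x, t). indicator A x * (h (x, t) * \<psi> t))"
          if h: "integrable (?X \<Otimes>\<^sub>M ?Y) h" and \<psi>: "\<And>t. t \<in> {0..T} \<Longrightarrow> \<bar>\<psi> t\<bar> \<le> C"
            and [measurable]: "\<psi> \<in> borel_measurable borel" "h \<in> borel_measurable (borel \<Otimes>\<^sub>M borel)" for h \<psi>
        proof (rule Bochner_Integration.integrable_bound[of _ "\<lambda>z. C * h z"])
          show "AE z in ?X \<Otimes>\<^sub>M ?Y. norm (case z of (x, t) \<Rightarrow> indicator A x * (h (x, t) * \<psi> t)) \<le> norm (C * h z)"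
            using AE_in
          proof eventually_elim
            case (elim z)
            then have "\<bar>\<psi> (snd z)\<bar> \<le> \<bar>C\<bar>" using \<psi>[of "snd z"] by linarith
            then have "\<bar>h z\<bar> * \<bar>\<psi> (snd z)\<bar> \<le> \<bar>C\<bar> * \<bar>h z\<bar>"
              by (subst mult.commute) (rule mult_right_mono, auto)
            then show ?case
              by (auto simp: case_prod_beta abs_mult split: split_indicator)
          qed
        qed (use h in auto)
        have Fub: "(\<integral>t. (\<integral>x. indicator A x * h (x, t) \<partial>?X) * \<psi> t \<partial>?Y)
            = (\<integral>x. indicator A x * (\<integral>t. h (x, t) * \<psi> t \<partial>?Y) \<partial>?X)"
          if "integrable (?X \<Otimes>\<^sub>M ?Y) (\<lambda>(x, t). indicator A x * (h (x, t) * \<psi> t))" for h :: "_ \<Rightarrow> real" and \<psi>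
        proof -
          have "(\<integral>t. (\<integral>x. indicator A x * h (x, t) \<partial>?X) * \<psi> t \<partial>?Y) = (\<integral>t. (\<integral>x. indicator A x * (h (x, t) * \<psi> t) \<partial>?X) \<partial>?Y)"
            by (simp flip: mult.assoc)
          also have "\<dots> = (\<integral>x. (\<integral>t. indicator A x * (h (x, t) * \<psi> t) \<partial>?Y) \<partial>?X)"
            by (rule XY.Fubini_integral[OF that])
          finally show ?thesis by simp
        qed
        \<comment> \<open>The exceptional null set depends on \<open>\<phi>\<close>. This is
          harmless: \<open>\<phi>\<close> is fixed here and the identity is integrated over
          \<open>A\<close> before \<open>\<phi>\<close> varies.\<close>
        have "AE x in ?X. (\<integral>t. u' (x, t) * deriv \<phi> t \<partial>?Y) = - (\<integral>t. v (x, t) * \<phi> t \<partial>?Y)"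
          using weak[OF test, unfolded AE_lebesgue_on_iff[OF Omega_borel]] XY.AE_pair[OF uu'] XY.AE_pair[OF v0v]
        proof eventually_elim
          case (elim x)
          have "(\<integral>t. u x t * deriv \<phi> t \<partial>lebesgue_on {0<..<T}) = (\<integral>t. u' (x, t) * deriv \<phi> t \<partial>lborel_ind {0<..<T})"
          proof (rule integral_lebesgue_on_AE_eq)
            show "AE t in lborel_ind {0<..<T}. u x t * deriv \<phi> t = u' (x, t) * deriv \<phi> t"
              unfolding lborel_ind_open_closed using elim(2) by eventually_elim simp
          qed measurable
          moreover have "(\<integral>t. v0 x t * \<phi> t \<partial>lebesgue_on {0<..<T}) = (\<integral>t. v (x, t) * \<phi> t \<partial>lborel_ind {0<..<T})"
          proof (rule integral_lebesgue_on_AE_eq)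
            show "AE t in lborel_ind {0<..<T}. v0 x t * \<phi> t = v (x, t) * \<phi> t"
              unfolding lborel_ind_open_closed using elim(3) by eventually_elim simp
          qed measurable
          ultimately show ?case using elim(1) by (simp add: lborel_ind_open_closed)
        qed
        note ae = this
        have "(\<integral>t. U t * deriv \<phi> t \<partial>?Y) = (\<integral>t. (\<integral>x. indicator A x * u' (x, t) \<partial>?X) * deriv \<phi> t \<partial>?Y)"
          using U_eq by (intro integral_cong_AE) (measurable, auto elim!: AE_mp)
        also have "\<dots> = (\<integral>x. indicator A x * (\<integral>t. u' (x, t) * deriv \<phi> t \<partial>?Y) \<partial>?X)"
          by (rule Fub[OF int_prod[OF u'_int C(2)]]) measurable
        also have "\<dots> = (\<integral>x. indicator A x * (- (\<integral>t. v (x, t) * \<phi> t \<partial>?Y)) \<partial>?X)"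
          using ae by (intro integral_cong_AE) (measurable, auto elim!: AE_mp)
        also have "\<dots> = - (\<integral>x. indicator A x * (\<integral>t. v (x, t) * \<phi> t \<partial>?Y) \<partial>?X)"
          by simp
        also have "\<dots> = - (\<integral>t. V t * \<phi> t \<partial>?Y)"
          unfolding V_def by (subst Fub[OF int_prod[OF v_int C(1)]]) auto
        finally show ?thesis .
      qed
      have "U t - U 0 = (\<integral>s. indicator {..t} s * V s \<partial>?Y)"
        by (rule weak_derivative_integral[OF U_cont U_meas V_int weakU T t])
      also have "\<dots> = (\<integral>s. (\<integral>x. indicator A x * (indicator {..t} s * v (x, s)) \<partial>?X) \<partial>?Y)"
        unfolding V_def by (simp add: mult.left_commute[of "indicator A _"])
      also have "\<dots> = (\<integral>x. (\<integral>s. indicator A x * (indicator {..t} s * v (x, s)) \<partial>?Y) \<partial>?X)"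
      proof (rule XY.Fubini_integral)
        show "integrable (?X \<Otimes>\<^sub>M ?Y) (\<lambda>(x, s). indicator A x * (indicator {..t} s * v (x, s)))"
          by (rule Bochner_Integration.integrable_bound[OF v_int]) (auto split: split_indicator)
      qed
      finally show ?thesis
        using T t by (simp add: U_def clamp(2))
    qed
    have J_int: "integrable ?X (\<lambda>x. \<integral>s. indicator {..t} s * v (x, s) \<partial>?Y)"
    proof (rule XY.integrable_fst)
      show "integrable (?X \<Otimes>\<^sub>M ?Y) (\<lambda>(x, s). indicator {..t} s * v (x, s))"
        by (rule Bochner_Integration.integrable_bound[OF v_int]) (auto split: split_indicator)
    qed
    have 0: "0 \<in> {0..T}" using T by simp
    \<comment> \<open>Two integrable functions with equal integrals over every Borel set agree
      almost everywhere; \<open>main\<close> provides the equality of the integrals.\<close>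
    have "AE x in ?X. r t x - r 0 x = (\<integral>s. indicator {..t} s * v (x, s) \<partial>?Y)"
    proof (rule density_unique_real)
      show "integrable ?X (\<lambda>x. r t x - r 0 x)" using r_int[OF t] r_int[OF 0] by simp
      show "(\<integral>x\<in>A. (r t x - r 0 x) \<partial>?X) = (\<integral>x\<in>A. (\<integral>s. indicator {..t} s * v (x, s) \<partial>?Y) \<partial>?X)"
        if "A \<in> sets ?X" for A
      proof -
        have "A \<in> sets borel" using that by simp
        from main[OF this] show ?thesis
          using r_int[OF t] r_int[OF 0] that
          by (simp add: set_lebesgue_integral_def right_diff_distrib integrable_indicator_mult
              Bochner_Integration.integral_diff)
      qed
    qed (rule J_int)
    then show ?thesis
      using ur[OF t] ur[OF 0] init' by eventually_elim simp
  qed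
  show thesis
    using that[OF v v_int 3 4] .
qed

section \<open>Energy estimate\<close>

lemma borel_measurable_indicator_atMost [measurable (raw)]:
  fixes f g :: "'a \<Rightarrow> real"
  assumes [measurable]: "f \<in> borel_measurable M" "g \<in> borel_measurable M"
  shows "(\<lambda>z. indicator {..f z} (g z) :: real) \<in> borel_measurable M"
proof -
  have "(\<lambda>z. indicator {..f z} (g z) :: real) = (\<lambda>z. if g z \<le> f z then 1 else 0)"
    by (auto simp: indicator_def)
  then show ?thesis by simp
qed

lemma ennreal_power2_le_imp_le:
  fixes x y :: ennreal
  assumes "x\<^sup>2 \<le> y\<^sup>2"
  shows "x \<le> y"
proof (cases y)
  case (real b)
  show ?thesis
  proof (cases x)
    case (real a)
    with \<open>y = ennreal b\<close> \<open>0 \<le> b\<close> assms show ?thesis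
      by (simp add: ennreal_power ennreal_le_iff)
  next
    case top
    with real assms show ?thesis by (simp add: ennreal_power top_unique)
  qed
qed simp

text \<open>The chain rule for the square of an absolutely continuous function, obtained without
  differentiation: F(t)^2 is a double integral over a square, and the two triangles on either side
  of the diagonal contribute equally by symmetry.\<close>

lemma square_indefinite_integral:
  fixes h :: "real \<Rightarrow> real"
  assumes S: "S \<in> sets borel" and h: "integrable (lborel_ind S) h"
  defines "F \<equiv> \<lambda>t. \<integral>s. indicator {..t} s * h s \<partial>lborel_ind S"
  shows "(c + F t)\<^sup>2 = c\<^sup>2 + 2 * (\<integral>s. indicator {..t} s * ((c + F s) * h s) \<partial>lborel_ind S)"
proof -
  let ?M = "lborel_ind S"
  interpret P: pair_sigma_finite ?M ?M using S by (intro pair_sigma_finite_lborel_ind)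
  have [measurable]: "h \<in> borel_measurable borel" using h by (auto dest: borel_measurable_integrable)
  define k where "k s = indicator {..t} s * h s" for s
  have k: "integrable ?M k" unfolding k_def using h by auto
  have [measurable]: "k \<in> borel_measurable borel" unfolding k_def by measurable
  have prod: "integrable (?M \<Otimes>\<^sub>M ?M) (\<lambda>(s, r). k s * k r)"
    by (rule P.Fubini_integrable) (use k in \<open>auto simp: abs_mult\<close>)
  have prod1: "integrable (?M \<Otimes>\<^sub>M ?M) (\<lambda>(s, r). indicator {..s} r * (k s * k r))"
    by (rule Bochner_Integration.integrable_bound[OF prod]) (auto split: split_indicator)
  have prod2: "integrable (?M \<Otimes>\<^sub>M ?M) (\<lambda>(s, r). (1 - indicator {..s} r) * (k s * k r))"
    by (rule Bochner_Integration.integrable_bound[OF prod]) (auto split: split_indicator)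
  have F_bound: "\<bar>F s\<bar> \<le> (\<integral>s. \<bar>h s\<bar> \<partial>?M)" for s
  proof -
    have "\<bar>F s\<bar> \<le> (\<integral>r. \<bar>indicator {..s} r * h r\<bar> \<partial>?M)"
      unfolding F_def by (rule integral_abs_bound)
    also have "\<dots> \<le> (\<integral>s. \<bar>h s\<bar> \<partial>?M)"
      using h by (intro integral_mono integrable_abs) (auto split: split_indicator)
    finally show ?thesis .
  qed
  have [measurable]: "F \<in> borel_measurable borel"
    unfolding F_def using h S by (intro borel_measurable_continuous_onI continuous_on_integral_atMost)
  have kF: "integrable ?M (\<lambda>s. k s * F s)"
  proof (rule Bochner_Integration.integrable_bound[of _ "\<lambda>s. (\<integral>s. \<bar>h s\<bar> \<partial>?M) * k s"])
    show "AE s in ?M. norm (k s * F s) \<le> norm ((\<integral>s. \<bar>h s\<bar> \<partial>?M) * k s)"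
    proof (rule AE_I2)
      fix s
      have "\<bar>F s\<bar> * \<bar>k s\<bar> \<le> (\<integral>s. \<bar>h s\<bar> \<partial>?M) * \<bar>k s\<bar>"
        using F_bound[of s] by (rule mult_right_mono) simp
      then show "norm (k s * F s) \<le> norm ((\<integral>s. \<bar>h s\<bar> \<partial>?M) * k s)"
        by (simp add: abs_mult mult.commute)
    qed
  qed (use k in auto)
  have inner: "k s * (\<integral>r. indicator {..s} r * k r \<partial>?M) = k s * F s" for s
    unfolding F_def k_def
    by (auto split: split_indicator intro!: disjI2 Bochner_Integration.integral_cong)
  have "(\<integral>s. (\<integral>r. (1 - indicator {..s} r) * (k s * k r) \<partial>?M) \<partial>?M)
      = (\<integral>r. (\<integral>s. (1 - indicator {..s} r) * (k s * k r) \<partial>?M) \<partial>?M)"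
    using P.Fubini_integral[OF prod2] by simp
  also have "\<dots> = (\<integral>r. k r * (\<integral>s. indicator {..r} s * k s \<partial>?M) \<partial>?M)"
  proof (rule Bochner_Integration.integral_cong[OF refl])
    fix r
    have "(\<integral>s. (1 - indicator {..s} r) * (k s * k r) \<partial>?M) = (\<integral>s. k r * (indicator {..r} s * k s) \<partial>?M)"
    proof (rule integral_cong_AE)
      \<comment> \<open>The strict condition s < r on the left and s <= r on the right differ only
        at s = r, a null set for each \<open>r\<close>.\<close>
      show "AE s in ?M. (1 - indicator {..s} r) * (k s * k r) = k r * (indicator {..r} s * k s)"
        using AE_lborel_ind_neq[OF S, of r] by eventually_elim (auto split: split_indicator)
    qed measurable
    then show "(\<integral>s. (1 - indicator {..s} r) * (k s * k r) \<partial>?M) = k r * (\<integral>s. indicator {..r} s * k s \<partial>?M)"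
      by simp
  qed
  finally have second: "(\<integral>s. (\<integral>r. (1 - indicator {..s} r) * (k s * k r) \<partial>?M) \<partial>?M) = (\<integral>s. k s * F s \<partial>?M)"
    by (simp add: inner)
  have first: "(\<integral>s. (\<integral>r. indicator {..s} r * (k s * k r) \<partial>?M) \<partial>?M) = (\<integral>s. k s * F s \<partial>?M)"
    by (simp add: mult.left_commute inner)
  have "(F t)\<^sup>2 = (\<integral>s. (\<integral>r. k s * k r \<partial>?M) \<partial>?M)"
    by (simp add: F_def k_def power2_eq_square)
  also have "\<dots> = (\<integral>z. (case z of (s, r) \<Rightarrow> k s * k r) \<partial>(?M \<Otimes>\<^sub>M ?M))"
    using P.integral_fst[OF prod] by simp
  also have "\<dots> = (\<integral>z. (case z of (s, r) \<Rightarrow> indicator {..s} r * (k s * k r)) +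
      (case z of (s, r) \<Rightarrow> (1 - indicator {..s} r) * (k s * k r)) \<partial>(?M \<Otimes>\<^sub>M ?M))"
    by (rule Bochner_Integration.integral_cong) (auto split: split_indicator)
  also have "\<dots> = 2 * (\<integral>s. k s * F s \<partial>?M)"
    using P.integral_fst[OF prod1] P.integral_fst[OF prod2] first second
    by (subst Bochner_Integration.integral_add[OF prod1 prod2]) simp
  finally have sq: "(F t)\<^sup>2 = 2 * (\<integral>s. k s * F s \<partial>?M)" .
  have "(\<integral>s. indicator {..t} s * ((c + F s) * h s) \<partial>?M) = (\<integral>s. c * k s + k s * F s \<partial>?M)"
    by (rule Bochner_Integration.integral_cong) (auto simp: k_def algebra_simps)
  also have "\<dots> = c * integral\<^sup>L ?M k + (\<integral>s. k s * F s \<partial>?M)"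
    using k kF by simp
  also have "integral\<^sup>L ?M k = F t"
    by (simp add: F_def k_def[abs_def])
  finally show ?thesis
    using sq by (simp add: power2_eq_square algebra_simps)
qed

section \<open>Gronwall inequalities for bounded measurable functions\<close>

text \<open>Cut \<open>{0..T}\<close> into steps on which \<open>a\<close> has mass at most c / 2.
  If \<open>e\<close> vanishes up to the start of a step, the inequality bounds its supremum over
  the step by half of itself. Only boundedness of \<open>e\<close> is available, so suprema take the
  place of maxima.\<close>

lemma linear_Gronwall_zero:
  fixes a e :: "real \<Rightarrow> real"
  assumes a: "integrable (lborel_ind {0..T}) a" "\<And>s. a s \<ge> 0"
    and e[measurable]: "e \<in> borel_measurable borel" and e0: "\<And>s. 0 \<le> e s"
    and eB: "\<And>s. s \<in> {0..T} \<Longrightarrow> e s \<le> B" and c: "c > 0"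
    and le: "\<And>t. t \<in> {0..T} \<Longrightarrow> c * e t \<le> (\<integral>s. indicator {..t} s * (e s * a s) \<partial>lborel_ind {0..T})"
    and t: "t \<in> {0..T}"
  shows "e t = 0"
proof -
  let ?Y = "lborel_ind {0..T}"
  have [measurable]: "a \<in> borel_measurable borel" using a by (auto dest: borel_measurable_integrable)
  define A where "A t = (\<integral>s. indicator {..t} s * a s \<partial>?Y)" for t
  have "uniformly_continuous_on {0..T} A"
    unfolding A_def using a by (intro compact_uniformly_continuous continuous_on_integral_atMost) auto
  then obtain \<delta> where \<delta>: "\<delta> > 0"
    "\<And>s t. s \<in> {0..T} \<Longrightarrow> t \<in> {0..T} \<Longrightarrow> \<bar>t - s\<bar> < \<delta> \<Longrightarrow> \<bar>A t - A s\<bar> < c / 2"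
    using c unfolding uniformly_continuous_on_def dist_real_def by (metis half_gt_zero)
  have A_diff: "A t - A s = (\<integral>r. indicator {s<..t} r * a r \<partial>?Y)" if "s \<le> t" for s t
  proof -
    have "A t - A s = (\<integral>r. indicator {..t} r * a r - indicator {..s} r * a r \<partial>?Y)"
      unfolding A_def using a by (subst Bochner_Integration.integral_diff) auto
    also have "\<dots> = (\<integral>r. indicator {s<..t} r * a r \<partial>?Y)"
      using that by (intro Bochner_Integration.integral_cong) (auto simp: indicator_def)
    finally show ?thesis .
  qed
  \<comment> \<open>Steps of length \<delta> / 2 keep every point of a closed step at distance
    strictly below \<delta> from its left end.\<close>
  have "\<forall>t\<in>{0..T}. t \<le> real k * (\<delta> / 2) \<longrightarrow> e t = 0" for k
  proof (induction k)
    case 0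
    show ?case
    proof safe
      fix t assume "t \<in> {0..T}" "t \<le> real 0 * (\<delta> / 2)"
      then have t: "t = 0" "0 \<in> {0..T}" by auto
      have "(\<integral>s. indicator {..0} s * (e s * a s) \<partial>?Y) = (\<integral>s. 0 \<partial>?Y)"
      proof (rule integral_cong_AE)
        have "AE s in ?Y. s \<noteq> 0" "AE s in ?Y. s \<in> {0..T}"
          by (rule AE_lborel_ind_neq AE_lborel_ind_in, simp)+
        then show "AE s in ?Y. indicator {..0} s * (e s * a s) = 0"
          by eventually_elim (auto split: split_indicator)
      qed measurable
      with le[OF t(2)] c e0[of 0] t show "e t = 0"
        by (simp add: mult_le_0_iff)
    qed
  next
    case (Suc k)
    define p where "p = real k * (\<delta> / 2)"
    define I where "I = {0..T} \<inter> {..p + \<delta> / 2}"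
    have p0: "p \<ge> 0" using \<delta> by (simp add: p_def)
    show ?case
    proof (cases "p \<le> T")
      case False
      then show ?thesis using Suc by (auto simp: p_def)
    next
      case True
      then have p: "p \<in> {0..T}" using p0 by simp
      \<comment> \<open>The bound \<open>B\<close> makes this supremum finite, without which m <= m
        / 2 would not yield m = 0.\<close>
      define m where "m = Sup (e ` I)"
      have "p \<in> I" using p \<delta> by (auto simp: I_def)
      have bdd: "bdd_above (e ` I)"
        using eB by (intro bdd_aboveI2[of _ _ B]) (auto simp: I_def)
      have em: "e s \<le> m" if "s \<in> I" for s
        unfolding m_def by (rule cSUP_upper[OF that bdd])
      have m0: "m \<ge> 0" using em[OF \<open>p \<in> I\<close>] e0[of p] by simp
      have half: "e t \<le> m / 2" if t: "t \<in> I" for t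
      proof (cases "t \<le> p")
        case True
        then show ?thesis using Suc t m0 by (auto simp: I_def p_def)
      next
        case False
        have tT: "t \<in> {0..T}" using t by (auto simp: I_def)
        have "c * e t \<le> (\<integral>s. indicator {..t} s * (e s * a s) \<partial>?Y)" by (rule le[OF tT])
        \<comment> \<open>By the induction hypothesis \<open>e\<close> vanishes up to
          \<open>p\<close>, so only the mass of \<open>a\<close> on the current step counts.\<close>
        also have "\<dots> \<le> (\<integral>s. m * (indicator {p<..t} s * a s) \<partial>?Y)"
        proof (rule integral_mono_AE)
          have ae: "AE s in ?Y. s \<in> {0..T}" by (rule AE_lborel_ind_in) simp
          show "integrable ?Y (\<lambda>s. m * (indicator {p<..t} s * a s))" using a by auto
          show "AE s in ?Y. indicator {..t} s * (e s * a s) \<le> m * (indicator {p<..t} s * a s)"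
            using ae
          proof eventually_elim
            case (elim s)
            show ?case
            proof (cases "s \<le> p")
              case True
              with elim Suc have "e s = 0" by (auto simp: p_def)
              with True show ?thesis by simp
            next
              case False
              show ?thesis
              proof (cases "s \<le> t")
                case True
                then have "s \<in> I" using elim t by (auto simp: I_def)
                with em a(2)[of s] False True show ?thesis by (auto intro: mult_right_mono)
              qed simp
            qed
          qed
          show "integrable ?Y (\<lambda>s. indicator {..t} s * (e s * a s))"
          proof (rule Bochner_Integration.integrable_bound[of _ "\<lambda>s. B * a s"])
            show "AE s in ?Y. norm (indicator {..t} s * (e s * a s)) \<le> norm (B * a s)"
              using ae
            proof eventually_elim
              case (elim s)
              then have "\<bar>e s\<bar> \<le> \<bar>B\<bar>" using eB[OF elim] e0[of s] by linarith
              then show ?case by (auto simp: abs_mult mult_right_mono split: split_indicator)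
            qed
          qed (use a in auto)
        qed
        also have "\<dots> = m * (A t - A p)"
          using False by (simp add: A_diff)
        also have "\<dots> \<le> m * (c / 2)"
        proof -
          have "\<bar>t - p\<bar> < \<delta>" using t False \<delta>(1) by (auto simp: I_def)
          from \<delta>(2)[OF p tT this] have "A t - A p \<le> c / 2" by linarith
          with m0 show ?thesis by (intro mult_left_mono)
        qed
        finally show ?thesis using c by (simp add: field_simps)
      qed
      have "m \<le> m / 2"
        unfolding m_def using \<open>p \<in> I\<close> half[unfolded m_def] by (intro cSUP_least) auto
      then have "m = 0" using m0 by simp
      then show ?thesis
        using em e0 by (auto simp: I_def p_def algebra_simps intro!: antisym)
    qed
  qed
  note zero = this
  obtain k where "T \<le> real k * (\<delta> / 2)"
    using \<delta>(1) reals_Archimedean3[of "\<delta> / 2" ] by (metis half_gt_zero less_imp_le)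
  then show ?thesis using t zero[of k] by force
qed

text \<open>The comparison function c + A is an exact solution of the integral equation with initial
  value c = z + \<epsilon>. The \<epsilon> makes \<open>c\<close> positive even if
  \<open>z = 0\<close>, which is what turns the quadratic inequality into a linear one; it is
  removed at the end.\<close>

lemma square_root_Gronwall:
  fixes a r :: "real \<Rightarrow> real"
  assumes a: "integrable (lborel_ind {0..T}) a" "\<And>s. a s \<ge> 0"
    and r[measurable]: "r \<in> borel_measurable borel" and r0: "\<And>s. 0 \<le> r s"
    and rB: "\<And>s. s \<in> {0..T} \<Longrightarrow> r s \<le> B" and z: "z \<ge> 0"
    and le: "\<And>t. t \<in> {0..T} \<Longrightarrow>
      (r t)\<^sup>2 \<le> z\<^sup>2 + 2 * (\<integral>s. indicator {..t} s * (r s * a s) \<partial>lborel_ind {0..T})"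
    and t: "t \<in> {0..T}"
  shows "r t \<le> z + (\<integral>s. indicator {..t} s * a s \<partial>lborel_ind {0..T})"
proof (rule field_le_epsilon)
  fix \<epsilon> :: real assume "\<epsilon> > 0"
  let ?Y = "lborel_ind {0..T}"
  have [measurable]: "a \<in> borel_measurable borel" using a by (auto dest: borel_measurable_integrable)
  define c where "c = z + \<epsilon>"
  have c: "c > 0" using z \<open>\<epsilon> > 0\<close> by (simp add: c_def)
  define A where "A t = (\<integral>s. indicator {..t} s * a s \<partial>?Y)" for t
  have A0: "A t \<ge> 0" for t unfolding A_def using a by (intro integral_nonneg_AE) auto
  have A_le: "A t \<le> (\<integral>s. a s \<partial>?Y)" for t
    unfolding A_def using a by (intro integral_mono) (auto split: split_indicator)
  have [measurable]: "A \<in> borel_measurable borel"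
    unfolding A_def using a by (intro borel_measurable_continuous_onI continuous_on_integral_atMost) auto
  have q2: "(c + A t)\<^sup>2 = c\<^sup>2 + 2 * (\<integral>s. indicator {..t} s * ((c + A s) * a s) \<partial>?Y)" for t
    unfolding A_def using a by (intro square_indefinite_integral) auto
  have ae: "AE s in ?Y. s \<in> {0..T}" by (rule AE_lborel_ind_in) simp
  have int: "integrable ?Y (\<lambda>s. indicator {..t} s * (h s * a s))"
    if [measurable]: "h \<in> borel_measurable borel" and h: "\<And>s. s \<in> {0..T} \<Longrightarrow> \<bar>h s\<bar> \<le> C" for h C t
  proof (rule Bochner_Integration.integrable_bound[of _ "\<lambda>s. C * a s"])
    show "AE s in ?Y. norm (indicator {..t} s * (h s * a s)) \<le> norm (C * a s)"
      using ae
    proof eventually_elim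
      case (elim s)
      then have "\<bar>h s\<bar> \<le> \<bar>C\<bar>" using h[OF elim] by linarith
      then show ?case by (auto simp: abs_mult mult_right_mono split: split_indicator)
    qed
  qed (use a in auto)
  \<comment> \<open>\<open>(c + A)\<^sup>2\<close> satisfies the hypothesis with equality, so the excess \<open>e\<close> of \<open>r\<close> satisfies a linear inequality.\<close>
  define e where "e s = max 0 (r s - (c + A s))" for s
  have [measurable]: "e \<in> borel_measurable borel" unfolding e_def by measurable
  have eB: "e s \<le> B" if "s \<in> {0..T}" for s
    using rB[OF that] r0[of s] A0[of s] c by (auto simp: e_def)
  have int_r: "integrable ?Y (\<lambda>s. indicator {..t} s * (r s * a s))" for t
    using rB r0 by (intro int[of r B]) auto
  have int_q: "integrable ?Y (\<lambda>s. indicator {..t} s * ((c + A s) * a s))" for t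
    using A_le A0 c by (intro int[of _ "c + (\<integral>s. a s \<partial>?Y)"]) auto
  have int_e: "integrable ?Y (\<lambda>s. indicator {..t} s * (e s * a s))" for t
    using eB by (intro int[of e B]) (auto simp: e_def)
  have "c * e t \<le> (\<integral>s. indicator {..t} s * (e s * a s) \<partial>?Y)" if t: "t \<in> {0..T}" for t
  proof (cases "r t > c + A t")
    case False
    then show ?thesis using a by (auto simp: e_def intro!: integral_nonneg_AE)
  next
    case True
    have "z\<^sup>2 \<le> c\<^sup>2" using z \<open>\<epsilon> > 0\<close> by (auto simp: c_def intro!: power_mono)
    \<comment> \<open>Where \<open>r\<close> exceeds c + A, the sum of the two is at least 2 c, so
      the difference of squares controls 2 c times the excess.\<close>
    have "2 * (c * e t) = (r t - (c + A t)) * (2 * c)"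
      using True by (simp add: e_def)
    also have "\<dots> \<le> (r t - (c + A t)) * (r t + (c + A t))"
      using True A0[of t] by (intro mult_left_mono) auto
    also have "\<dots> = (r t)\<^sup>2 - (c + A t)\<^sup>2"
      by (simp add: power2_eq_square algebra_simps)
    also have "\<dots> \<le> 2 * ((\<integral>s. indicator {..t} s * (r s * a s) \<partial>?Y) - (\<integral>s. indicator {..t} s * ((c + A s) * a s) \<partial>?Y))"
      using le[OF t] q2[of t] \<open>z\<^sup>2 \<le> c\<^sup>2\<close> by argo
    also have "\<dots> = 2 * (\<integral>s. indicator {..t} s * (r s * a s) - indicator {..t} s * ((c + A s) * a s) \<partial>?Y)"
      using int_r int_q by simp
    also have "\<dots> \<le> 2 * (\<integral>s. indicator {..t} s * (e s * a s) \<partial>?Y)"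
    proof -
      have "indicator {..t} s * (r s * a s) - indicator {..t} s * ((c + A s) * a s)
          \<le> indicator {..t} s * (e s * a s)" for s
      proof -
        have "(r s - (c + A s)) * a s \<le> e s * a s"
          using a(2)[of s] by (intro mult_right_mono) (auto simp: e_def)
        then show ?thesis by (auto simp: algebra_simps split: split_indicator)
      qed
      then show ?thesis
        using int_r int_q int_e by (intro mult_left_mono integral_mono) auto
    qed
    finally show ?thesis by simp
  qed
  then have "e t = 0"
    by (intro linear_Gronwall_zero[OF a _ _ eB c _ t]) (auto simp: e_def)
  then have "r t \<le> c + A t" by (simp add: e_def max_def split: if_splits)
  then show "r t \<le> z + (\<integral>s. indicator {..t} s * a s \<partial>lborel_ind {0..T}) + \<epsilon>"
    by (simp add: c_def A_def)
qed

section \<open>Cauchy-Schwarz and Minkowski inequalities, and the abstract energy estimate\<close>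

lemma Cauchy_Schwarz_integral:
  fixes f g :: "'a \<Rightarrow> real"
  assumes "f \<in> borel_measurable M" "g \<in> borel_measurable M"
    "integrable M (\<lambda>x. (f x)\<^sup>2)" "integrable M (\<lambda>x. (g x)\<^sup>2)"
  shows "integrable M (\<lambda>x. f x * g x)" "\<bar>\<integral>x. f x * g x \<partial>M\<bar> \<le> sqrt (\<integral>x. (f x)\<^sup>2 \<partial>M) * sqrt (\<integral>x. (g x)\<^sup>2 \<partial>M)"
proof -
  note [measurable] = assms(1,2)
  show int: "integrable M (\<lambda>x. f x * g x)"
  proof (rule Bochner_Integration.integrable_bound[of _ "\<lambda>x. (f x)\<^sup>2 + (g x)\<^sup>2"])
    show "AE x in M. norm (f x * g x) \<le> norm ((f x)\<^sup>2 + (g x)\<^sup>2)"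
    proof (rule AE_I2)
      fix x
      have "2 * \<bar>f x\<bar> * \<bar>g x\<bar> \<le> (f x)\<^sup>2 + (g x)\<^sup>2"
        using sum_squares_bound[of "\<bar>f x\<bar>" "\<bar>g x\<bar>"] by simp
      moreover have "0 \<le> \<bar>f x\<bar> * \<bar>g x\<bar>" by simp
      ultimately have "\<bar>f x\<bar> * \<bar>g x\<bar> \<le> (f x)\<^sup>2 + (g x)\<^sup>2" by linarith
      then show "norm (f x * g x) \<le> norm ((f x)\<^sup>2 + (g x)\<^sup>2)"
        by (simp add: abs_mult)
    qed
  qed (use assms in auto)
  have "ennreal ((\<integral>x. \<bar>f x * g x\<bar> \<partial>M)\<^sup>2) = (\<integral>\<^sup>+x. ennreal \<bar>f x\<bar> * ennreal \<bar>g x\<bar> \<partial>M)\<^sup>2"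
    using nn_integral_eq_integral[OF integrable_abs[OF int]]
    by (simp add: abs_mult flip: ennreal_mult ennreal_power)
  also have "\<dots> \<le> (\<integral>\<^sup>+x. (ennreal \<bar>f x\<bar>)\<^sup>2 \<partial>M) * (\<integral>\<^sup>+x. (ennreal \<bar>g x\<bar>)\<^sup>2 \<partial>M)"
    by (rule Cauchy_Schwarz_nn_integral) measurable
  also have "\<dots> = ennreal ((\<integral>x. (f x)\<^sup>2 \<partial>M) * (\<integral>x. (g x)\<^sup>2 \<partial>M))"
    using assms(3,4) by (simp add: ennreal_power nn_integral_eq_integral ennreal_mult)
  finally have "(\<integral>x. \<bar>f x * g x\<bar> \<partial>M)\<^sup>2 \<le> (\<integral>x. (f x)\<^sup>2 \<partial>M) * (\<integral>x. (g x)\<^sup>2 \<partial>M)"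
    by (subst (asm) ennreal_le_iff) auto
  then have "(\<integral>x. \<bar>f x * g x\<bar> \<partial>M) \<le> sqrt (\<integral>x. (f x)\<^sup>2 \<partial>M) * sqrt (\<integral>x. (g x)\<^sup>2 \<partial>M)"
    by (simp add: real_le_rsqrt flip: real_sqrt_mult)
  with integral_abs_bound[of M "\<lambda>x. f x * g x"]
  show "\<bar>\<integral>x. f x * g x \<partial>M\<bar> \<le> sqrt (\<integral>x. (f x)\<^sup>2 \<partial>M) * sqrt (\<integral>x. (g x)\<^sup>2 \<partial>M)"
    by linarith
qed

lemma integrable_square_diff:
  fixes f g :: "'a \<Rightarrow> real"
  assumes "f \<in> borel_measurable M" "g \<in> borel_measurable M"
    "integrable M (\<lambda>x. (f x)\<^sup>2)" "integrable M (\<lambda>x. (g x)\<^sup>2)"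
  shows "integrable M (\<lambda>x. (f x - g x)\<^sup>2)"
proof -
  have "integrable M (\<lambda>x. f x * g x)"
    using assms by (intro Cauchy_Schwarz_integral)
  then have "integrable M (\<lambda>x. (f x)\<^sup>2 - 2 * (f x * g x) + (g x)\<^sup>2)"
    using assms by auto
  then show ?thesis by (simp add: power2_diff algebra_simps)
qed

lemma nn_integral_mult_le_of_square_bounds:
  assumes [measurable]: "f \<in> borel_measurable M" "g \<in> borel_measurable M"
    and "(\<integral>\<^sup>+x. (f x)\<^sup>2 \<partial>M) \<le> a\<^sup>2" "(\<integral>\<^sup>+x. (g x)\<^sup>2 \<partial>M) \<le> b\<^sup>2"
  shows "(\<integral>\<^sup>+x. f x * g x \<partial>M) \<le> a * b"
proof (rule ennreal_power2_le_imp_le)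
  have "(\<integral>\<^sup>+x. f x * g x \<partial>M)\<^sup>2 \<le> (\<integral>\<^sup>+x. (f x)\<^sup>2 \<partial>M) * (\<integral>\<^sup>+x. (g x)\<^sup>2 \<partial>M)"
    by (rule Cauchy_Schwarz_nn_integral) measurable
  also have "\<dots> \<le> (a * b)\<^sup>2"
    using assms(3,4) by (simp add: power_mult_distrib mult_mono)
  finally show "(\<integral>\<^sup>+x. f x * g x \<partial>M)\<^sup>2 \<le> (a * b)\<^sup>2" .
qed

text \<open>The square of the inner integral is a double integral over (s, r). Exchanging the order
  and applying Cauchy-Schwarz in \<open>x\<close> for each pair bounds the integrand by
  \<open>N s * N r\<close>. Squares on both sides avoid roots of extended reals.\<close>

lemma (in pair_sigma_finite) Minkowski_nn_integral:
  fixes V :: "_ \<Rightarrow> ennreal"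
  assumes V[measurable]: "V \<in> borel_measurable (M1 \<Otimes>\<^sub>M M2)"
    and N[measurable]: "N \<in> borel_measurable M2"
    and VN: "AE s in M2. (\<integral>\<^sup>+x. (V (x, s))\<^sup>2 \<partial>M1) \<le> (N s)\<^sup>2"
  shows "(\<integral>\<^sup>+x. (\<integral>\<^sup>+s. V (x, s) \<partial>M2)\<^sup>2 \<partial>M1) \<le> (\<integral>\<^sup>+s. N s \<partial>M2)\<^sup>2"
proof -
  have "(\<integral>\<^sup>+x. (\<integral>\<^sup>+s. V (x, s) \<partial>M2)\<^sup>2 \<partial>M1) = (\<integral>\<^sup>+x. (\<integral>\<^sup>+s. V (x, s) * (\<integral>\<^sup>+r. V (x, r) \<partial>M2) \<partial>M2) \<partial>M1)"
    unfolding power2_eq_square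
    by (intro nn_integral_cong) (subst nn_integral_multc, auto)
  also have "\<dots> = (\<integral>\<^sup>+s. (\<integral>\<^sup>+x. V (x, s) * (\<integral>\<^sup>+r. V (x, r) \<partial>M2) \<partial>M1) \<partial>M2)"
    by (rule Fubini'[symmetric]) measurable
  also have "\<dots> = (\<integral>\<^sup>+s. (\<integral>\<^sup>+x. (\<integral>\<^sup>+r. V (x, s) * V (x, r) \<partial>M2) \<partial>M1) \<partial>M2)"
    by (intro nn_integral_cong) (subst nn_integral_cmult, auto)
  also have "\<dots> = (\<integral>\<^sup>+s. (\<integral>\<^sup>+r. (\<integral>\<^sup>+x. V (x, s) * V (x, r) \<partial>M1) \<partial>M2) \<partial>M2)"
    by (intro nn_integral_cong Fubini'[symmetric]) measurable
  also have "\<dots> \<le> (\<integral>\<^sup>+s. (\<integral>\<^sup>+r. N s * N r \<partial>M2) \<partial>M2)"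
  proof (rule nn_integral_mono_AE)
    show "AE s in M2. (\<integral>\<^sup>+r. (\<integral>\<^sup>+x. V (x, s) * V (x, r) \<partial>M1) \<partial>M2) \<le> (\<integral>\<^sup>+r. N s * N r \<partial>M2)"
      using VN AE_space
    proof eventually_elim
      case (elim s)
      show ?case
      proof (rule nn_integral_mono_AE)
        show "AE r in M2. (\<integral>\<^sup>+x. V (x, s) * V (x, r) \<partial>M1) \<le> N s * N r"
          using VN AE_space
        proof eventually_elim
          case (elim r)
          with \<open>s \<in> space M2\<close> \<open>(\<integral>\<^sup>+x. (V (x, s))\<^sup>2 \<partial>M1) \<le> (N s)\<^sup>2\<close> show ?case
            by (intro nn_integral_mult_le_of_square_bounds) measurable
        qed
      qed
    qed
  qed
  also have "\<dots> = (\<integral>\<^sup>+s. N s \<partial>M2)\<^sup>2"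
    by (simp add: nn_integral_cmult nn_integral_multc power2_eq_square)
  finally show ?thesis .
qed

text \<open>The two bounds have different roles: \<open>N\<close> controls the size of
  \<open>V\<close> and secures integrability, \<open>a\<close> is the rate that appears in the
  conclusion. The premise \<open>diss\<close> may presuppose square integrability of
  \<open>d\<close>, because that is established first, from \<open>N\<close> alone.\<close>

lemma energy_estimate:
  fixes X :: "'a measure" and T :: real and V :: "'a \<times> real \<Rightarrow> real" and D0 :: "'a \<Rightarrow> real"
  defines "Y \<equiv> lborel_ind {0..T}"
  assumes X: "sigma_finite_measure X" and V[measurable]: "V \<in> borel_measurable (X \<Otimes>\<^sub>M borel)"
    and D0[measurable]: "D0 \<in> borel_measurable X" and D0_L2: "integrable X (\<lambda>x. (D0 x)\<^sup>2)"
    and N: "integrable Y N" "\<And>s. 0 \<le> N s"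
    and VN: "AE s in Y. (\<integral>\<^sup>+x. ennreal ((V (x, s))\<^sup>2) \<partial>X) \<le> ennreal ((N s)\<^sup>2)"
    and a: "integrable Y a" "\<And>s. 0 \<le> a s"
  defines "d \<equiv> \<lambda>x t. D0 x + (\<integral>s. indicator {..t} s * V (x, s) \<partial>Y)"
  assumes diss: "AE s in Y. integrable X (\<lambda>x. (d x s)\<^sup>2) \<longrightarrow>
      (\<integral>x. d x s * V (x, s) \<partial>X) \<le> sqrt (\<integral>x. (d x s)\<^sup>2 \<partial>X) * a s"
    and t: "t \<in> {0..T}"
  shows "integrable X (\<lambda>x. (d x t)\<^sup>2)"
    and "sqrt (\<integral>x. (d x t)\<^sup>2 \<partial>X) \<le> sqrt (\<integral>x. (D0 x)\<^sup>2 \<partial>X) + (\<integral>s. indicator {..t} s * a s \<partial>Y)"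
proof -
  interpret XY: pair_sigma_finite X Y
    using X by (simp add: Y_def pair_sigma_finite_def sigma_finite_lborel_ind)
  have sY[measurable_cong]: "sets Y = sets borel"
    by (simp add: Y_def)
  have [measurable]: "N \<in> borel_measurable borel" "a \<in> borel_measurable borel"
    using borel_measurable_integrable[OF N(1)] borel_measurable_integrable[OF a(1)]
    by (simp_all add: measurable_cong_sets[OF sY])
  define I where "I x = (\<integral>\<^sup>+s. ennreal \<bar>V (x, s)\<bar> \<partial>Y)" for x
  have [measurable]: "I \<in> borel_measurable X" unfolding I_def by measurable
  have "(\<integral>\<^sup>+x. (I x)\<^sup>2 \<partial>X) \<le> (\<integral>\<^sup>+s. ennreal (N s) \<partial>Y)\<^sup>2"
    unfolding I_def
  proof (rule XY.Minkowski_nn_integral)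
    show "AE s in Y. (\<integral>\<^sup>+x. (ennreal \<bar>V (x, s)\<bar>)\<^sup>2 \<partial>X) \<le> (ennreal (N s))\<^sup>2"
      using VN N(2) by (simp add: ennreal_power)
  qed measurable
  also have "\<dots> < \<infinity>"
    using N by (simp add: nn_integral_eq_integral ennreal_power)
  finally have I2: "(\<integral>\<^sup>+x. (I x)\<^sup>2 \<partial>X) < \<infinity>" .
  then have "AE x in X. (I x)\<^sup>2 \<noteq> \<infinity>"
    by (intro nn_integral_noteq_infinite) auto
  then have I_fin: "AE x in X. I x < \<infinity>"
    by eventually_elim (auto simp: less_top[symmetric] power2_eq_square)
  \<comment> \<open>\<open>enn2real\<close> sends infinity to 0, but \<open>I\<close> is finite
    almost everywhere by Minkowski, so \<open>J\<close> has the same square integral.\<close>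
  define J where "J x = enn2real (I x)" for x
  have [measurable]: "J \<in> borel_measurable X" unfolding J_def by measurable
  have J2: "integrable X (\<lambda>x. (J x)\<^sup>2)"
  proof (rule integrableI_bounded)
    have "(\<integral>\<^sup>+x. ennreal (norm ((J x)\<^sup>2)) \<partial>X) = (\<integral>\<^sup>+x. (I x)\<^sup>2 \<partial>X)"
      using I_fin by (intro nn_integral_cong_AE) (auto elim!: AE_mp simp: J_def simp flip: ennreal_power)
    then show "(\<integral>\<^sup>+x. ennreal (norm ((J x)\<^sup>2)) \<partial>X) < \<infinity>" using I2 by simp
  qed measurable
  \<comment> \<open>One square-integrable function that dominates \<open>d x t\<close> for all
    \<open>t\<close> at once: it gives the L^2 claim and the bound on \<open>r\<close> that Gronwall
    requires.\<close>
  define m where "m x = \<bar>D0 x\<bar> + J x" for x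
  have [measurable]: "m \<in> borel_measurable X" unfolding m_def by measurable
  have J0: "0 \<le> J x" for x by (simp add: J_def)
  then have m0: "0 \<le> m x" for x by (simp add: m_def)
  have m2: "integrable X (\<lambda>x. (m x)\<^sup>2)"
  proof -
    have "integrable X (\<lambda>x. \<bar>D0 x\<bar> * J x)"
      using D0_L2 J2 by (intro Cauchy_Schwarz_integral) auto
    then have "integrable X (\<lambda>x. (D0 x)\<^sup>2 + 2 * (\<bar>D0 x\<bar> * J x) + (J x)\<^sup>2)"
      using D0_L2 J2 by auto
    then show ?thesis by (simp add: m_def power2_sum algebra_simps)
  qed
  have V_int: "AE x in X. integrable Y (\<lambda>s. V (x, s))"
    using I_fin AE_space
  proof eventually_elim
    case (elim x)
    have "(\<lambda>s. V (x, s)) \<in> borel_measurable Y" using elim(2) by measurable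
    with elim show ?case by (auto intro!: integrableI_bounded simp: I_def)
  qed
  have J_eq: "J x = (\<integral>s. \<bar>V (x, s)\<bar> \<partial>Y)" if "integrable Y (\<lambda>s. V (x, s))" for x
    unfolding J_def I_def using that by (subst integral_eq_nn_integral) auto
  have d_meas[measurable]: "(\<lambda>(x, t). d x t) \<in> borel_measurable (X \<Otimes>\<^sub>M borel)"
    unfolding d_def by measurable
  have d_meas_x[measurable]: "(\<lambda>x. d x t) \<in> borel_measurable X" for t
    unfolding d_def by measurable
  have d_le: "AE x in X. \<forall>t. \<bar>d x t\<bar> \<le> m x"
    using V_int
  proof eventually_elim
    case (elim x)
    have "\<bar>\<integral>s. indicator {..t} s * V (x, s) \<partial>Y\<bar> \<le> J x" for t
    proof -
      have "\<bar>\<integral>s. indicator {..t} s * V (x, s) \<partial>Y\<bar> \<le> (\<integral>s. \<bar>indicator {..t} s * V (x, s)\<bar> \<partial>Y)"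
        by (rule integral_abs_bound)
      also have "\<dots> \<le> J x"
        unfolding J_eq[OF elim] using elim sY by (intro integral_mono integrable_abs) (auto split: split_indicator)
      finally show ?thesis .
    qed
    then show ?case
      unfolding d_def m_def by (meson abs_triangle_ineq add_left_mono order_trans)
  qed
  have d2_int: "integrable X (\<lambda>x. (d x t)\<^sup>2)" for t
  proof (rule Bochner_Integration.integrable_bound[OF m2])
    show "AE x in X. norm ((d x t)\<^sup>2) \<le> norm ((m x)\<^sup>2)"
      using d_le by eventually_elim (simp add: abs_le_square_iff[symmetric] m0)
  qed measurable
  then show "integrable X (\<lambda>x. (d x t)\<^sup>2)" .
  define r where "r t = sqrt (\<integral>x. (d x t)\<^sup>2 \<partial>X)" for t
  have r_meas: "r \<in> borel_measurable borel"
    unfolding r_def by measurable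
  have rB: "r t \<le> sqrt (\<integral>x. (m x)\<^sup>2 \<partial>X)" for t
    unfolding r_def
  proof (intro real_sqrt_le_mono integral_mono_AE d2_int m2)
    show "AE x in X. (d x t)\<^sup>2 \<le> (m x)\<^sup>2"
      using d_le by eventually_elim (simp add: abs_le_square_iff[symmetric] m0)
  qed
  \<comment> \<open>Joint integrability of the majorant \<open>m x * V (x, s)\<close> is what
    permits exchanging space and time in the energy identity below.\<close>
  have mV_int: "integrable (X \<Otimes>\<^sub>M Y) (\<lambda>(x, s). m x * V (x, s))"
  proof (rule integrableI_bounded)
    have "(\<integral>\<^sup>+z. ennreal (norm (case z of (x, s) \<Rightarrow> m x * V (x, s))) \<partial>(X \<Otimes>\<^sub>M Y))
        = (\<integral>\<^sup>+s. (\<integral>\<^sup>+x. ennreal (m x) * ennreal \<bar>V (x, s)\<bar> \<partial>X) \<partial>Y)"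
      by (subst XY.nn_integral_snd[symmetric]) (auto simp: abs_mult m0 ennreal_mult)
    also have "\<dots> \<le> (\<integral>\<^sup>+s. ennreal (sqrt (\<integral>x. (m x)\<^sup>2 \<partial>X)) * ennreal (N s) \<partial>Y)"
    proof (rule nn_integral_mono_AE)
      show "AE s in Y. (\<integral>\<^sup>+x. ennreal (m x) * ennreal \<bar>V (x, s)\<bar> \<partial>X) \<le> ennreal (sqrt (\<integral>x. (m x)\<^sup>2 \<partial>X)) * ennreal (N s)"
        using VN
      proof eventually_elim
        case (elim s)
        then show ?case
          using m2 m0 N(2)
          by (intro nn_integral_mult_le_of_square_bounds)
             (auto simp: ennreal_power nn_integral_eq_integral)
      qed
    qed
    also have "\<dots> < \<infinity>"
      using N by (simp add: nn_integral_cmult nn_integral_eq_integral flip: ennreal_mult)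
    finally show "(\<integral>\<^sup>+z. ennreal (norm (case z of (x, s) \<Rightarrow> m x * V (x, s))) \<partial>(X \<Otimes>\<^sub>M Y)) < \<infinity>" .
  qed measurable
  have dV_int: "integrable (X \<Otimes>\<^sub>M Y) (\<lambda>(x, s). indicator {..t} s * (d x s * V (x, s)))" for t
  proof (rule Bochner_Integration.integrable_bound[OF mV_int])
    have "AE z in X \<Otimes>\<^sub>M Y. \<bar>d (fst z) (snd z)\<bar> \<le> m (fst z)"
    proof (rule XY.AE_pair_measure)
      show "AE x in X. AE s in Y. \<bar>d (fst (x, s)) (snd (x, s))\<bar> \<le> m (fst (x, s))"
        using d_le by eventually_elim auto
    qed measurable
    then show "AE z in X \<Otimes>\<^sub>M Y. norm (case z of (x, s) \<Rightarrow> indicator {..t} s * (d x s * V (x, s)))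
        \<le> norm (case z of (x, s) \<Rightarrow> m x * V (x, s))"
      by eventually_elim (auto simp: abs_mult m0 mult_right_mono split: split_indicator)
  qed measurable
  have energy: "(r t)\<^sup>2 \<le> (sqrt (\<integral>x. (D0 x)\<^sup>2 \<partial>X))\<^sup>2 + 2 * (\<integral>s. indicator {..t} s * (r s * a s) \<partial>Y)" for t
  proof -
    have r2: "(r t)\<^sup>2 = (\<integral>x. (d x t)\<^sup>2 \<partial>X)"
      unfolding r_def by (intro real_sqrt_pow2 integral_nonneg_AE) auto
    also have "\<dots> = (\<integral>x. (D0 x)\<^sup>2 + 2 * (\<integral>s. indicator {..t} s * (d x s * V (x, s)) \<partial>Y) \<partial>X)"
    proof (rule integral_cong_AE)
      show "AE x in X. (d x t)\<^sup>2 = (D0 x)\<^sup>2 + 2 * (\<integral>s. indicator {..t} s * (d x s * V (x, s)) \<partial>Y)"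
        using V_int
      proof eventually_elim
        case (elim x)
        then show ?case
          unfolding d_def Y_def by (intro square_indefinite_integral) auto
      qed
    qed measurable
    also have "\<dots> = (\<integral>x. (D0 x)\<^sup>2 \<partial>X) + 2 * (\<integral>x. (\<integral>s. indicator {..t} s * (d x s * V (x, s)) \<partial>Y) \<partial>X)"
      using D0_L2 XY.integrable_fst[OF dV_int] by simp
    also have "(\<integral>x. (\<integral>s. indicator {..t} s * (d x s * V (x, s)) \<partial>Y) \<partial>X)
       = (\<integral>s. (\<integral>x. indicator {..t} s * (d x s * V (x, s)) \<partial>X) \<partial>Y)"
      using XY.Fubini_integral[OF dV_int] by simp
    also have "\<dots> \<le> (\<integral>s. indicator {..t} s * (r s * a s) \<partial>Y)"
    proof (rule integral_mono_AE)
      show "integrable Y (\<lambda>s. \<integral>x. indicator {..t} s * (d x s * V (x, s)) \<partial>X)"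
        using XY.integrable_snd[OF dV_int] .
      show "integrable Y (\<lambda>s. indicator {..t} s * (r s * a s))"
      proof (rule Bochner_Integration.integrable_bound[of _ "\<lambda>s. sqrt (\<integral>x. (m x)\<^sup>2 \<partial>X) * a s"])
        show "AE s in Y. norm (indicator {..t} s * (r s * a s)) \<le> norm (sqrt (\<integral>x. (m x)\<^sup>2 \<partial>X) * a s)"
        proof (rule AE_I2)
          fix s
          have "\<bar>r s\<bar> \<le> \<bar>sqrt (\<integral>x. (m x)\<^sup>2 \<partial>X)\<bar>"
            using rB[of s] by (simp add: r_def)
          then show "norm (indicator {..t} s * (r s * a s)) \<le> norm (sqrt (\<integral>x. (m x)\<^sup>2 \<partial>X) * a s)"
            by (auto simp: abs_mult mult_right_mono split: split_indicator)
        qed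
      qed (use a r_meas in auto)
      show "AE s in Y. (\<integral>x. indicator {..t} s * (d x s * V (x, s)) \<partial>X) \<le> indicator {..t} s * (r s * a s)"
        using diss by eventually_elim (use d2_int in \<open>auto simp: r_def split: split_indicator\<close>)
    qed
    finally show ?thesis by simp
  qed
  have "r t \<le> sqrt (\<integral>x. (D0 x)\<^sup>2 \<partial>X) + (\<integral>s. indicator {..t} s * a s \<partial>lborel_ind {0..T})"
  proof (rule square_root_Gronwall[where B="sqrt (\<integral>x. (m x)\<^sup>2 \<partial>X)"])
    show "(r t)\<^sup>2 \<le> (sqrt (\<integral>x. (D0 x)\<^sup>2 \<partial>X))\<^sup>2 + 2 * (\<integral>s. indicator {..t} s * (r s * a s) \<partial>lborel_ind {0..T})" for t
      using energy[of t] by (simp add: Y_def)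
  qed (use a rB t r_meas in \<open>auto simp: r_def Y_def\<close>)
  then show "sqrt (\<integral>x. (d x t)\<^sup>2 \<partial>X) \<le> sqrt (\<integral>x. (D0 x)\<^sup>2 \<partial>X) + (\<integral>s. indicator {..t} s * a s \<partial>Y)"
    by (simp add: r_def Y_def)
qed

section \<open>Dissipativity of the 1-Laplacian\<close>

lemma (in pair_sigma_finite) AE_pair_fst:
  assumes "AE x in M1. Q x"
  shows "AE z in M1 \<Otimes>\<^sub>M M2. Q (fst z)"
proof -
  obtain N where N: "N \<in> null_sets M1" "{x \<in> space M1. \<not> Q x} \<subseteq> N"
    using assms by (auto simp: eventually_ae_filter)
  have "N \<times> space M2 \<in> null_sets (M1 \<Otimes>\<^sub>M M2)"
    using N(1) by (simp add: null_sets_def M2.emeasure_pair_measure_Times)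
  then show ?thesis
    by (rule AE_I') (use N(2) in \<open>auto simp: space_pair_measure\<close>)
qed

lemma (in sigma_finite_measure) AE_pair_swap:
  assumes "AE z in M \<Otimes>\<^sub>M M. Q z"
  shows "AE z in M \<Otimes>\<^sub>M M. Q (snd z, fst z)"
proof -
  interpret P: pair_sigma_finite M M ..
  have "AE z in distr (M \<Otimes>\<^sub>M M) (M \<Otimes>\<^sub>M M) (\<lambda>(x, y). (y, x)). Q z"
    using assms unfolding P.distr_pair_swap[symmetric] .
  from AE_distrD[OF measurable_pair_swap' this] show ?thesis
    by (simp add: case_prod_beta)
qed

lemma (in finite_measure) square_integral_le:
  fixes h :: "'a \<Rightarrow> real"
  assumes "measure M (space M) = 1" "h \<in> borel_measurable M" "integrable M (\<lambda>x. (h x)\<^sup>2)"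
  shows "(\<integral>x. h x \<partial>M)\<^sup>2 \<le> (\<integral>x. (h x)\<^sup>2 \<partial>M)"
proof -
  have "\<bar>\<integral>x. h x * 1 \<partial>M\<bar> \<le> sqrt (\<integral>x. (h x)\<^sup>2 \<partial>M) * sqrt (\<integral>x. 1\<^sup>2 \<partial>M)"
    using assms by (intro Cauchy_Schwarz_integral) auto
  then have "\<bar>\<integral>x. h x \<partial>M\<bar> \<le> sqrt (\<integral>x. (h x)\<^sup>2 \<partial>M)"
    using assms(1) by simp
  then have "\<bar>\<integral>x. h x \<partial>M\<bar>\<^sup>2 \<le> (sqrt (\<integral>x. (h x)\<^sup>2 \<partial>M))\<^sup>2"
    by (intro power_mono) auto
  then show ?thesis by simp
qed

lemma integrable_square_mult_bounded:
  fixes k w :: "'a \<Rightarrow> real"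
  assumes [measurable]: "k \<in> borel_measurable M" "w \<in> borel_measurable M"
    and k: "integrable M (\<lambda>z. (k z)\<^sup>2)" and w: "AE z in M. \<bar>w z\<bar> \<le> 1"
  shows "integrable M (\<lambda>z. (k z * w z)\<^sup>2)" "(\<integral>z. (k z * w z)\<^sup>2 \<partial>M) \<le> (\<integral>z. (k z)\<^sup>2 \<partial>M)"
proof -
  have ae: "AE z in M. (k z * w z)\<^sup>2 \<le> (k z)\<^sup>2"
    using w
  proof eventually_elim
    case (elim z)
    then have "(w z)\<^sup>2 \<le> 1" by (simp add: abs_square_le_1)
    then show ?case by (simp add: power_mult_distrib mult_left_le)
  qed
  show int: "integrable M (\<lambda>z. (k z * w z)\<^sup>2)"
    by (rule Bochner_Integration.integrable_bound[OF k]) (use ae in auto)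
  show "(\<integral>z. (k z * w z)\<^sup>2 \<partial>M) \<le> (\<integral>z. (k z)\<^sup>2 \<partial>M)"
    by (rule integral_mono_AE[OF int k ae])
qed

context
  fixes X :: "'a measure"
  assumes X: "finite_measure X" "measure X (space X) = 1"
begin

interpretation X: finite_measure X by (rule X(1))
interpretation XX: pair_sigma_finite X X ..

text \<open>Cauchy-Schwarz in \<open>y\<close> on a space of mass 1, then |w| <= 1. This places the
  1-Laplacian in L^2 with a bound that depends on the kernel only, hence is uniform in time.\<close>

lemma kernel_integral_L2:
  fixes k w :: "'a \<times> 'a \<Rightarrow> real"
  assumes [measurable]: "k \<in> borel_measurable (X \<Otimes>\<^sub>M X)" "w \<in> borel_measurable (X \<Otimes>\<^sub>M X)"
    and k: "integrable (X \<Otimes>\<^sub>M X) (\<lambda>z. (k z)\<^sup>2)" and w: "AE z in X \<Otimes>\<^sub>M X. \<bar>w z\<bar> \<le> 1"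
  shows "integrable X (\<lambda>x. (\<integral>y. k (x, y) * w (x, y) \<partial>X)\<^sup>2)"
    and "(\<integral>x. (\<integral>y. k (x, y) * w (x, y) \<partial>X)\<^sup>2 \<partial>X) \<le> (\<integral>z. (k z)\<^sup>2 \<partial>(X \<Otimes>\<^sub>M X))"
proof -
  have sq: "integrable (X \<Otimes>\<^sub>M X) (\<lambda>z. (k z * w z)\<^sup>2)"
    by (rule integrable_square_mult_bounded(1)[OF _ _ k w]) measurable
  have int: "integrable X (\<lambda>x. \<integral>y. (k (x, y) * w (x, y))\<^sup>2 \<partial>X)"
    using XX.integrable_fst'[OF sq] .
  have ae: "AE x in X. (\<integral>y. k (x, y) * w (x, y) \<partial>X)\<^sup>2 \<le> (\<integral>y. (k (x, y) * w (x, y))\<^sup>2 \<partial>X)"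
    using XX.AE_integrable_fst'[OF sq] AE_space
  proof eventually_elim
    case (elim x)
    have "(\<lambda>y. k (x, y) * w (x, y)) \<in> borel_measurable X" using elim(2) by measurable
    with elim X(2) show ?case by (intro X.square_integral_le) auto
  qed
  show int2: "integrable X (\<lambda>x. (\<integral>y. k (x, y) * w (x, y) \<partial>X)\<^sup>2)"
  proof (rule Bochner_Integration.integrable_bound[OF int])
    show "AE x in X. norm ((\<integral>y. k (x, y) * w (x, y) \<partial>X)\<^sup>2) \<le> norm (\<integral>y. (k (x, y) * w (x, y))\<^sup>2 \<partial>X)"
      using ae by eventually_elim auto
  qed measurable
  have "(\<integral>x. (\<integral>y. k (x, y) * w (x, y) \<partial>X)\<^sup>2 \<partial>X) \<le> (\<integral>x. (\<integral>y. (k (x, y) * w (x, y))\<^sup>2 \<partial>X) \<partial>X)"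
    by (rule integral_mono_AE[OF int2 int ae])
  also have "\<dots> = (\<integral>z. (k z * w z)\<^sup>2 \<partial>(X \<Otimes>\<^sub>M X))"
    using XX.integral_fst'[OF sq] by simp
  also have "\<dots> \<le> (\<integral>z. (k z)\<^sup>2 \<partial>(X \<Otimes>\<^sub>M X))"
    by (rule integrable_square_mult_bounded(2)[OF _ _ k w]) measurable
  finally show "(\<integral>x. (\<integral>y. k (x, y) * w (x, y) \<partial>X)\<^sup>2 \<partial>X) \<le> (\<integral>z. (k z)\<^sup>2 \<partial>(X \<Otimes>\<^sub>M X))" .
qed

text \<open>Monotonicity of the 1-Laplacian up to the kernel mismatch: the part carrying \<open>k1\<close> has a
  sign after antisymmetrisation, the part carrying \<open>k1 - k2\<close> is estimated by Cauchy-Schwarz.\<close>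

lemma kernel_dissipation:
  fixes k1 k2 w1 w2 :: "'a \<times> 'a \<Rightarrow> real" and d :: "'a \<Rightarrow> real"
  assumes [measurable]: "k1 \<in> borel_measurable (X \<Otimes>\<^sub>M X)" "w1 \<in> borel_measurable (X \<Otimes>\<^sub>M X)"
      "k2 \<in> borel_measurable (X \<Otimes>\<^sub>M X)" "w2 \<in> borel_measurable (X \<Otimes>\<^sub>M X)" "d \<in> borel_measurable X"
    and k1: "integrable (X \<Otimes>\<^sub>M X) (\<lambda>z. (k1 z)\<^sup>2)" and k2: "integrable (X \<Otimes>\<^sub>M X) (\<lambda>z. (k2 z)\<^sup>2)"
    and w1: "AE z in X \<Otimes>\<^sub>M X. \<bar>w1 z\<bar> \<le> 1" and w2: "AE z in X \<Otimes>\<^sub>M X. \<bar>w2 z\<bar> \<le> 1"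
    and anti: "AE z in X \<Otimes>\<^sub>M X. w1 z = - w1 (snd z, fst z)" "AE z in X \<Otimes>\<^sub>M X. w2 z = - w2 (snd z, fst z)"
    and symm: "AE z in X \<Otimes>\<^sub>M X. k1 z = k1 (snd z, fst z)" and nonneg: "AE z in X \<Otimes>\<^sub>M X. k1 z \<ge> 0"
    and d: "integrable X (\<lambda>x. (d x)\<^sup>2)"
    and mono: "AE z in X \<Otimes>\<^sub>M X. (d (snd z) - d (fst z)) * (w1 z - w2 z) \<ge> 0"
  shows "(\<integral>x. d x * ((\<integral>y. k1 (x, y) * w1 (x, y) \<partial>X) - (\<integral>y. k2 (x, y) * w2 (x, y) \<partial>X)) \<partial>X)
    \<le> sqrt (\<integral>x. (d x)\<^sup>2 \<partial>X) * sqrt (\<integral>z. (k1 z - k2 z)\<^sup>2 \<partial>(X \<Otimes>\<^sub>M X))"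
proof -
  let ?P = "X \<Otimes>\<^sub>M X"
  have d2: "integrable ?P (\<lambda>z. (d (fst z))\<^sup>2)"
    by (rule XX.Fubini_integrable) (use d X(2) in auto)
  \<comment> \<open>Integrating out the second variable contributes the total mass 1; this is the
    source of the constant 1 in front of the kernel norm.\<close>
  have d2_eq: "(\<integral>z. (d (fst z))\<^sup>2 \<partial>?P) = (\<integral>x. (d x)\<^sup>2 \<partial>X)"
    using XX.integral_fst'[OF d2] X(2) by simp
  have kw_L2: "integrable ?P (\<lambda>z. (k1 z * w1 z)\<^sup>2)" "integrable ?P (\<lambda>z. (k1 z * w2 z)\<^sup>2)"
      "integrable ?P (\<lambda>z. (k2 z * w2 z)\<^sup>2)"
    by (rule integrable_square_mult_bounded(1); (fact k1 k2 w1 w2 | measurable))+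
  have k12: "integrable ?P (\<lambda>z. (k1 z - k2 z)\<^sup>2)"
    using k1 k2 by (intro integrable_square_diff) auto
  note k12w2 = integrable_square_mult_bounded[OF _ _ k12 w2]
  have dkw: "integrable ?P (\<lambda>z. d (fst z) * (k1 z * w1 z))" "integrable ?P (\<lambda>z. d (fst z) * (k1 z * w2 z))"
     "integrable ?P (\<lambda>z. d (fst z) * (k2 z * w2 z))"
    by (rule Cauchy_Schwarz_integral(1); (fact d2 kw_L2 | measurable))+
  have split: "(\<integral>x. d x * ((\<integral>y. k1 (x, y) * w1 (x, y) \<partial>X) - (\<integral>y. k2 (x, y) * w2 (x, y) \<partial>X)) \<partial>X)
      = (\<integral>z. d (fst z) * (k1 z * w1 z) \<partial>?P) - (\<integral>z. d (fst z) * (k2 z * w2 z) \<partial>?P)"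
    using XX.integral_fst'[OF dkw(1)] XX.integral_fst'[OF dkw(3)]
      XX.integrable_fst'[OF dkw(1)] XX.integrable_fst'[OF dkw(3)]
    by (simp add: right_diff_distrib)
  \<comment> \<open>The splitting is k1 w1 - k2 w2 = k1 (w1 - w2) + (k1 - k2) w2, and
    \<open>q\<close> is its first part. It is antisymmetric because \<open>k1\<close> is symmetric
    and both multipliers are antisymmetric.\<close>
  define q where "q z = k1 z * (w1 z - w2 z)" for z
  have [measurable]: "q \<in> borel_measurable ?P" unfolding q_def by measurable
  have dq: "integrable ?P (\<lambda>z. d (fst z) * q z)"
    using Bochner_Integration.integrable_diff[OF dkw(1,2)] by (simp add: q_def algebra_simps)
  have q_anti: "AE z in ?P. q (snd z, fst z) = - q z"
    using anti symm by eventually_elim (simp add: q_def algebra_simps)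
  have swap_int: "integrable ?P (\<lambda>z. d (snd z) * q (snd z, fst z))"
    using XX.integrable_product_swap[OF dq] by (simp add: case_prod_beta')
  have swap: "(\<integral>z. d (snd z) * q (snd z, fst z) \<partial>?P) = (\<integral>z. d (fst z) * q z \<partial>?P)"
    using XX.integral_product_swap[OF borel_measurable_integrable[OF dq]] by (simp add: case_prod_beta')
  \<comment> \<open>Adding the integral with its variables exchanged replaces d(x) q by -k1 (d(y) -
    d(x)) (w1 - w2), which has a sign pointwise.\<close>
  have "2 * (\<integral>z. d (fst z) * q z \<partial>?P) = (\<integral>z. d (fst z) * q z + d (snd z) * q (snd z, fst z) \<partial>?P)"
    using swap dq swap_int by simp
  also have "\<dots> \<le> (\<integral>z. 0 \<partial>?P)"
  proof (rule integral_mono_AE)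
    show "AE z in ?P. d (fst z) * q z + d (snd z) * q (snd z, fst z) \<le> 0"
      using q_anti nonneg mono
    proof eventually_elim
      case (elim z)
      have "d (fst z) * q z + d (snd z) * q (snd z, fst z) = - (k1 z * ((d (snd z) - d (fst z)) * (w1 z - w2 z)))"
        unfolding elim(1) by (simp add: q_def algebra_simps)
      then show ?case using elim(2,3) by simp
    qed
  qed (use dq swap_int in auto)
  finally have neg: "(\<integral>z. d (fst z) * (k1 z * w1 z) \<partial>?P) \<le> (\<integral>z. d (fst z) * (k1 z * w2 z) \<partial>?P)"
    using dkw by (simp add: q_def right_diff_distrib)
  have "(\<integral>z. d (fst z) * (k1 z * w2 z) \<partial>?P) - (\<integral>z. d (fst z) * (k2 z * w2 z) \<partial>?P)
      = (\<integral>z. d (fst z) * ((k1 z - k2 z) * w2 z) \<partial>?P)"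
    using dkw by (simp add: algebra_simps)
  also have "\<dots> \<le> \<bar>\<integral>z. d (fst z) * ((k1 z - k2 z) * w2 z) \<partial>?P\<bar>" by simp
  also have "\<dots> \<le> sqrt (\<integral>z. (d (fst z))\<^sup>2 \<partial>?P) * sqrt (\<integral>z. ((k1 z - k2 z) * w2 z)\<^sup>2 \<partial>?P)"
    using d2 k12w2 by (intro Cauchy_Schwarz_integral(2)) auto
  also have "\<dots> \<le> sqrt (\<integral>x. (d x)\<^sup>2 \<partial>X) * sqrt (\<integral>z. (k1 z - k2 z)\<^sup>2 \<partial>?P)"
    unfolding d2_eq using k12w2(2) by (intro mult_left_mono) auto
  finally show ?thesis
    using split neg by linarith
qed

end

section \<open>Borel representatives of kernels, multipliers and data, and the stability
  estimate\<close>

lemma in_L2_lebesgue_on_iff: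
  fixes h h' :: "'a::euclidean_space \<Rightarrow> real"
  assumes S: "S \<in> sets borel" and h'[measurable]: "h' \<in> borel_measurable borel"
    and eq: "AE x in lborel_ind S. h x = h' x"
  shows "in_L2 (lebesgue_on S) h \<longleftrightarrow> integrable (lborel_ind S) (\<lambda>x. (h' x)\<^sup>2)"
proof -
  have "integrable (lebesgue_on S) (\<lambda>x. (h x)\<^sup>2) \<longleftrightarrow> integrable (lborel_ind S) (\<lambda>x. (h' x)\<^sup>2)"
    by (rule integrable_lebesgue_on_AE_eq[OF S]) (use eq in auto)
  then show ?thesis
    using borel_measurable_lebesgue_on_AE_eq[OF S h' eq] by (simp add: in_L2_def)
qed

lemma norm_L2_lebesgue_on:
  fixes h h' :: "'a::euclidean_space \<Rightarrow> real"
  assumes S: "S \<in> sets borel" and h'[measurable]: "h' \<in> borel_measurable borel"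
    and eq: "AE x in lborel_ind S. h x = h' x"
    and int: "integrable (lborel_ind S) (\<lambda>x. (h' x)\<^sup>2)"
  shows "norm_L2 (lebesgue_on S) h = ennreal (sqrt (\<integral>x. (h' x)\<^sup>2 \<partial>lborel_ind S))"
proof -
  have "(\<integral>x. (h x)\<^sup>2 \<partial>lebesgue_on S) = (\<integral>x. (h' x)\<^sup>2 \<partial>lborel_ind S)"
    by (rule integral_lebesgue_on_AE_eq[OF S]) (use eq in auto)
  then show ?thesis
    using in_L2_lebesgue_on_iff[OF S h' eq] int by (simp add: norm_L2_def)
qed

lemma finite_measure_Omega: "finite_measure (lborel_ind (Omega :: (real^'n) set))"
  by (rule finite_measure_lborel_ind) auto

lemma measure_Omega: "measure (lborel_ind (Omega :: (real^'n) set)) (space (lborel_ind (Omega :: (real^'n) set))) = 1"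
  by (simp add: measure_def emeasure_lborel_ind_UNIV)

text \<open>A uniform bound on the L^2 norms of the slices, integrated over a set of measure 1,
  gives square integrability in both variables jointly.\<close>

lemma in_Linf2_borel:
  fixes K :: "real^'n \<Rightarrow> real^'n \<Rightarrow> real"
  assumes "in_Linf2 K"
  obtains k where "k \<in> borel_measurable (borel \<Otimes>\<^sub>M borel)"
    "AE z in lborel_ind Omega \<Otimes>\<^sub>M lborel_ind Omega. K (fst z) (snd z) = k z"
    "integrable (lborel_ind Omega \<Otimes>\<^sub>M lborel_ind Omega) (\<lambda>z. (k z)\<^sup>2)"
proof -
  let ?X = "lborel_ind (Omega :: (real^'n) set)"
  interpret X: finite_measure ?X by (rule finite_measure_Omega)
  interpret XX: pair_sigma_finite ?X ?X ..
  obtain C where meas: "(\<lambda>z. K (fst z) (snd z)) \<in> borel_measurable (lebesgue_on (Omega \<times> Omega))"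
    and C: "AE x in lebesgue_on Omega. integrable (lebesgue_on Omega) (\<lambda>y. (K x y)\<^sup>2) \<and>
            (\<integral>y. (K x y)\<^sup>2 \<partial>lebesgue_on Omega) \<le> C"
    using assms unfolding in_Linf2_def by blast
  have S: "(Omega :: (real^'n) set) \<times> (Omega :: (real^'n) set) \<in> sets borel" by (simp add: borel_Times)
  obtain k where kb: "k \<in> borel_measurable borel"
    and Kk: "AE z in ?X \<Otimes>\<^sub>M ?X. K (fst z) (snd z) = k z"
    using borel_measurable_lebesgue_on_ex_borel[OF S meas]
    unfolding lborel_ind_Times[OF Omega_borel Omega_borel, symmetric] by blast
  have k[measurable]: "k \<in> borel_measurable (borel \<Otimes>\<^sub>M borel)" using kb by (simp add: borel_prod)
  have "integrable (?X \<Otimes>\<^sub>M ?X) (\<lambda>z. (k z)\<^sup>2)"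
  proof (rule integrableI_bounded)
    have "(\<integral>\<^sup>+z. ennreal (norm ((k z)\<^sup>2)) \<partial>(?X \<Otimes>\<^sub>M ?X)) = (\<integral>\<^sup>+x. (\<integral>\<^sup>+y. ennreal ((k (x, y))\<^sup>2) \<partial>?X) \<partial>?X)"
      by (subst X.nn_integral_fst[symmetric]) auto
    also have "\<dots> \<le> (\<integral>\<^sup>+x. ennreal C \<partial>?X)"
    proof (rule nn_integral_mono_AE)
      show "AE x in ?X. (\<integral>\<^sup>+y. ennreal ((k (x, y))\<^sup>2) \<partial>?X) \<le> ennreal C"
        using C[unfolded AE_lebesgue_on_iff[OF Omega_borel]] XX.AE_pair[OF Kk]
      proof eventually_elim
        case (elim x)
        have eq: "AE y in ?X. (K x y)\<^sup>2 = (k (x, y))\<^sup>2"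
          using elim(2) by eventually_elim simp
        have m: "(\<lambda>y. (k (x, y))\<^sup>2) \<in> borel_measurable borel" by measurable
        have "integrable ?X (\<lambda>y. (k (x, y))\<^sup>2)"
          using integrable_lebesgue_on_AE_eq[OF Omega_borel m eq] elim(1) by simp
        then show ?case
          using integral_lebesgue_on_AE_eq[OF Omega_borel m eq] elim(1)
          by (simp add: nn_integral_eq_integral ennreal_leI)
      qed
    qed
    also have "\<dots> < \<infinity>"
      by (simp add: emeasure_lborel_ind_UNIV)
    finally show "(\<integral>\<^sup>+z. ennreal (norm ((k z)\<^sup>2)) \<partial>(?X \<Otimes>\<^sub>M ?X)) < \<infinity>" .
  qed measurable
  with that[OF k Kk] show thesis .
qed

text \<open>Only kernel and multiplier are replaced by Borel versions; \<open>u\<close> and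
  \<open>\<eta>\<close> stay as given. For antisymmetry the exceptional set must also be null after
  exchanging the variables.\<close>

lemma one_laplacian_borel:
  fixes K :: "real^'n \<Rightarrow> real^'n \<Rightarrow> real"
  assumes lap: "one_laplacian K u \<eta>"
    and k[measurable]: "k \<in> borel_measurable (borel \<Otimes>\<^sub>M borel)"
    and Kk: "AE z in lborel_ind Omega \<Otimes>\<^sub>M lborel_ind Omega. K (fst z) (snd z) = k z"
  obtains w where "w \<in> borel_measurable (borel \<Otimes>\<^sub>M borel)"
    "AE z in lborel_ind Omega \<Otimes>\<^sub>M lborel_ind Omega. \<bar>w z\<bar> \<le> 1"
    "AE z in lborel_ind Omega \<Otimes>\<^sub>M lborel_ind Omega. w z = - w (snd z, fst z)"
    "AE z in lborel_ind Omega \<Otimes>\<^sub>M lborel_ind Omega. w z \<in> subdiff_abs (u (snd z) - u (fst z))"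
    "AE x in lborel_ind Omega. \<eta> x = - (\<integral>y. k (x, y) * w (x, y) \<partial>lborel_ind Omega)"
proof -
  let ?X = "lborel_ind (Omega :: (real^'n) set)"
  interpret X: finite_measure ?X by (rule finite_measure_Omega)
  interpret XX: pair_sigma_finite ?X ?X ..
  have S: "(Omega :: (real^'n) set) \<times> (Omega :: (real^'n) set) \<in> sets borel" by (simp add: borel_Times)
  note Times = lborel_ind_Times[OF Omega_borel Omega_borel, symmetric]
  obtain w0 where meas: "(\<lambda>z. w0 (fst z) (snd z)) \<in> borel_measurable (lebesgue_on (Omega \<times> Omega))"
    and w0: "AE z in ?X \<Otimes>\<^sub>M ?X. \<bar>w0 (fst z) (snd z)\<bar> \<le> 1"
      "AE z in ?X \<Otimes>\<^sub>M ?X. w0 (fst z) (snd z) = - w0 (snd z) (fst z)"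
      "AE z in ?X \<Otimes>\<^sub>M ?X. w0 (fst z) (snd z) \<in> subdiff_abs (u (snd z) - u (fst z))"
    and \<eta>: "AE x in ?X. \<eta> x = - (\<integral>y. K x y * w0 x y \<partial>lebesgue_on Omega)"
    using lap unfolding one_laplacian_def AE_lebesgue_on_iff[OF S] AE_lebesgue_on_iff[OF Omega_borel] Times
    by blast
  obtain w where wb: "w \<in> borel_measurable borel"
    and ww: "AE z in ?X \<Otimes>\<^sub>M ?X. w0 (fst z) (snd z) = w z"
    using borel_measurable_lebesgue_on_ex_borel[OF S meas] unfolding Times by blast
  have w[measurable]: "w \<in> borel_measurable (borel \<Otimes>\<^sub>M borel)" using wb by (simp add: borel_prod)
  show thesis
  proof (rule that[OF w])
    show "AE z in ?X \<Otimes>\<^sub>M ?X. \<bar>w z\<bar> \<le> 1"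
      using w0(1) ww by eventually_elim simp
    show "AE z in ?X \<Otimes>\<^sub>M ?X. w z = - w (snd z, fst z)"
      using w0(2) ww X.AE_pair_swap[OF ww] by eventually_elim simp
    show "AE z in ?X \<Otimes>\<^sub>M ?X. w z \<in> subdiff_abs (u (snd z) - u (fst z))"
      using w0(3) ww by eventually_elim simp
    show "AE x in ?X. \<eta> x = - (\<integral>y. k (x, y) * w (x, y) \<partial>?X)"
      using \<eta> XX.AE_pair[OF ww] XX.AE_pair[OF Kk]
    proof eventually_elim
      case (elim x)
      have "AE y in ?X. K x y * w0 x y = k (x, y) * w (x, y)"
        using elim(2,3) by eventually_elim simp
      then have "(\<integral>y. K x y * w0 x y \<partial>lebesgue_on Omega) = (\<integral>y. k (x, y) * w (x, y) \<partial>?X)"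
        by (intro integral_lebesgue_on_AE_eq) auto
      with elim(1) show ?case by simp
    qed
  qed
qed

lemma in_L1L2_borel:
  fixes f :: "real^'n \<Rightarrow> real \<Rightarrow> real"
  assumes "in_L1L2 T f"
  obtains f' where "f' \<in> borel_measurable (borel \<Otimes>\<^sub>M borel)"
    "AE z in lborel_ind Omega \<Otimes>\<^sub>M lborel_ind {0..T}. f (fst z) (snd z) = f' z"
    "AE s in lborel_ind {0..T}. integrable (lborel_ind Omega) (\<lambda>x. (f' (x, s))\<^sup>2)"
    "integrable (lborel_ind {0..T}) (\<lambda>s. sqrt (\<integral>x. (f' (x, s))\<^sup>2 \<partial>lborel_ind Omega))"
proof -
  let ?X = "lborel_ind (Omega :: (real^'n) set)" and ?Y = "lborel_ind {0..T}"
  interpret XY: pair_sigma_finite ?X ?Y by (rule pair_sigma_finite_lborel_ind) auto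
  have S: "(Omega :: (real^'n) set) \<times> {0..T} \<in> sets borel" by (simp add: borel_Times)
  have meas: "(\<lambda>z. f (fst z) (snd z)) \<in> borel_measurable (lebesgue_on (Omega \<times> {0..T}))"
    and L2: "AE t in ?Y. in_L2 (lebesgue_on Omega) (\<lambda>x. f x t)"
    and int: "integrable (lebesgue_on {0..T}) (\<lambda>t. sqrt (\<integral>x. (f x t)\<^sup>2 \<partial>lebesgue_on Omega))"
    using assms unfolding in_L1L2_def AE_lebesgue_on_iff[OF atLeastAtMost_borel] by auto
  obtain f' where fb: "f' \<in> borel_measurable borel"
    and ff: "AE z in ?X \<Otimes>\<^sub>M ?Y. f (fst z) (snd z) = f' z"
    using borel_measurable_lebesgue_on_ex_borel[OF S meas]
    unfolding lborel_ind_Times[OF Omega_borel atLeastAtMost_borel, symmetric] by blast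
  have f'[measurable]: "f' \<in> borel_measurable (borel \<Otimes>\<^sub>M borel)" using fb by (simp add: borel_prod)
  have f'_x: "(\<lambda>x. f' (x, s)) \<in> borel_measurable borel" for s by measurable
  have slice: "AE s in ?Y. AE x in ?X. f x s = f' (x, s)"
    using XY.AE_pair_snd[OF ff] by simp
  show thesis
  proof (rule that[OF f' ff])
    show "AE s in ?Y. integrable ?X (\<lambda>x. (f' (x, s))\<^sup>2)"
      using slice L2 by eventually_elim (simp add: in_L2_lebesgue_on_iff[OF Omega_borel f'_x])
    have eq: "AE s in ?Y. sqrt (\<integral>x. (f x s)\<^sup>2 \<partial>lebesgue_on Omega) = sqrt (\<integral>x. (f' (x, s))\<^sup>2 \<partial>?X)"
      using slice
    proof eventually_elim
      case (elim s)
      then have "AE x in ?X. (f x s)\<^sup>2 = (f' (x, s))\<^sup>2" by eventually_elim simp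
      then have "(\<integral>x. (f x s)\<^sup>2 \<partial>lebesgue_on Omega) = (\<integral>x. (f' (x, s))\<^sup>2 \<partial>?X)"
        by (intro integral_lebesgue_on_AE_eq) auto
      then show ?case by simp
    qed
    show "integrable ?Y (\<lambda>s. sqrt (\<integral>x. (f' (x, s))\<^sup>2 \<partial>?X))"
      using integrable_lebesgue_on_AE_eq[OF atLeastAtMost_borel _ eq] int by simp
  qed
qed

text \<open>\<open>norm_L2\<close> is infinite outside L^2, so a formula with the real root needs
  square integrability on almost every time slice.\<close>

lemma norm_L1L2_borel:
  fixes f :: "real^'n \<Rightarrow> real \<Rightarrow> real"
  assumes h[measurable]: "h \<in> borel_measurable (borel \<Otimes>\<^sub>M borel)"
    and fh: "AE z in lborel_ind Omega \<Otimes>\<^sub>M lborel_ind {0..T}. f (fst z) (snd z) = h z"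
    and L2: "AE s in lborel_ind {0..T}. integrable (lborel_ind Omega) (\<lambda>x. (h (x, s))\<^sup>2)"
  shows "norm_L1L2 T f = (\<integral>\<^sup>+s. ennreal (sqrt (\<integral>x. (h (x, s))\<^sup>2 \<partial>lborel_ind Omega)) \<partial>lborel_ind {0..T})"
proof -
  let ?X = "lborel_ind (Omega :: (real^'n) set)" and ?Y = "lborel_ind {0..T}"
  interpret XY: pair_sigma_finite ?X ?Y by (rule pair_sigma_finite_lborel_ind) auto
  define \<phi> where "\<phi> s = sqrt (\<integral>x. (h (x, s))\<^sup>2 \<partial>?X)" for s
  have [measurable]: "\<phi> \<in> borel_measurable borel" unfolding \<phi>_def by measurable
  have ae: "AE s in ?Y. norm_L2 (lebesgue_on Omega) (\<lambda>x. f x s) = ennreal (\<phi> s)"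
    using XY.AE_pair_snd[OF fh] L2
  proof eventually_elim
    case (elim s)
    then show ?case
      unfolding \<phi>_def by (intro norm_L2_lebesgue_on) auto
  qed
  have "norm_L1L2 T f = (\<integral>\<^sup>+s. ennreal (\<phi> s) \<partial>lebesgue_on {0..T})"
    unfolding norm_L1L2_def
    by (rule nn_integral_cong_AE) (use ae in \<open>simp only: AE_lebesgue_on_iff[OF atLeastAtMost_borel]\<close>)
  also have "\<dots> = (\<integral>\<^sup>+s. ennreal (\<phi> s) \<partial>?Y)"
    by (rule nn_integral_lebesgue_on_AE_eq[where f=\<phi> and f'=\<phi> and h="\<lambda>_. ennreal"]) auto
  finally show ?thesis by (simp add: \<phi>_def)
qed

lemma subdiff_abs_monotone:
  assumes "w1 \<in> subdiff_abs a" "w2 \<in> subdiff_abs b"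
  shows "(a - b) * (w1 - w2) \<ge> 0"
proof (cases "a = b")
  case False
  have "-1 \<le> w1" "w1 \<le> 1" "-1 \<le> w2" "w2 \<le> 1"
    using assms by (auto simp: subdiff_abs_def split: if_splits)
  moreover have "w1 \<ge> w2" if "a > b"
    using that assms calculation by (auto simp: subdiff_abs_def split: if_splits)
  moreover have "w1 \<le> w2" if "a < b"
    using that assms calculation by (auto simp: subdiff_abs_def split: if_splits)
  ultimately show ?thesis
    using False by (cases "a < b") (auto intro: mult_nonneg_nonneg mult_nonpos_nonpos)
qed simp

text \<open>The kernels enter asymmetrically because \<open>K1\<close> is the one that multiplies w1
  - w2 in the dissipation argument; its sign and symmetry make that term favourable.\<close>

lemma solution_P1_stability:
  fixes K1 K2 :: "real^'n \<Rightarrow> real^'n \<Rightarrow> real"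
  assumes T: "T > 0"
    and sol1: "solution_P1 K1 f1 g1 T u1" and sol2: "solution_P1 K2 f2 g2 T u2"
    and nonneg: "\<And>x y. x \<in> Omega \<Longrightarrow> y \<in> Omega \<Longrightarrow> K1 x y \<ge> 0"
    and symm: "\<And>x y. x \<in> Omega \<Longrightarrow> y \<in> Omega \<Longrightarrow> K1 x y = K1 y x"
    and K: "in_Linf2 K1" "in_Linf2 K2"
    and g: "in_L2 (lebesgue_on Omega) g1" "in_L2 (lebesgue_on Omega) g2"
    and f: "in_L1L2 T f1" "in_L1L2 T f2"
    and t: "t \<in> {0..T}"
  shows "norm_L2 (lebesgue_on Omega) (\<lambda>x. u1 x t - u2 x t)
    \<le> norm_L2 (lebesgue_on Omega) (\<lambda>x. g1 x - g2 x)
      + norm_L1L2 T (\<lambda>x t. f1 x t - f2 x t)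
      + ennreal T * norm_L2 (lebesgue_on (Omega \<times> Omega)) (\<lambda>z. K1 (fst z) (snd z) - K2 (fst z) (snd z))"
proof -
  let ?X = "lborel_ind (Omega :: (real^'n) set)" and ?Y = "lborel_ind {0..T}"
  let ?P = "?X \<Otimes>\<^sub>M ?X"
  interpret X: finite_measure ?X by (rule finite_measure_Omega)
  interpret XX: pair_sigma_finite ?X ?X ..
  interpret XY: pair_sigma_finite ?X ?Y by (rule pair_sigma_finite_lborel_ind) auto
  note X = finite_measure_Omega measure_Omega
  have emY: "emeasure ?Y UNIV = ennreal T"
    using T by (simp add: emeasure_lborel_ind_UNIV)
  interpret Y: finite_measure ?Y by (rule finite_measure_lborel_ind) (use T in auto)
  have mY: "measure ?Y UNIV = T" using emY T by (simp add: measure_def)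
  obtain v1 where v1[measurable]: "v1 \<in> borel_measurable (borel \<Otimes>\<^sub>M borel)"
    and v1_int: "integrable (?X \<Otimes>\<^sub>M ?Y) v1"
    and rep1: "\<And>t. t \<in> {0..T} \<Longrightarrow> AE x in ?X. u1 x t = g1 x + (\<integral>s. indicator {..t} s * v1 (x, s) \<partial>?Y)"
    and eqn1: "AE t in ?Y. \<exists>\<eta>. one_laplacian K1 (\<lambda>x. u1 x t) \<eta> \<and> (AE x in ?X. v1 (x, t) = - \<eta> x + f1 x t)"
    by (rule solution_P1_repr[OF T sol1]) (rule that)
  obtain v2 where v2[measurable]: "v2 \<in> borel_measurable (borel \<Otimes>\<^sub>M borel)"
    and v2_int: "integrable (?X \<Otimes>\<^sub>M ?Y) v2"
    and rep2: "\<And>t. t \<in> {0..T} \<Longrightarrow> AE x in ?X. u2 x t = g2 x + (\<integral>s. indicator {..t} s * v2 (x, s) \<partial>?Y)"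
    and eqn2: "AE t in ?Y. \<exists>\<eta>. one_laplacian K2 (\<lambda>x. u2 x t) \<eta> \<and> (AE x in ?X. v2 (x, t) = - \<eta> x + f2 x t)"
    by (rule solution_P1_repr[OF T sol2]) (rule that)
  obtain k1 where k1[measurable]: "k1 \<in> borel_measurable (borel \<Otimes>\<^sub>M borel)"
    and Kk1: "AE z in ?P. K1 (fst z) (snd z) = k1 z" and k1_L2: "integrable ?P (\<lambda>z. (k1 z)\<^sup>2)"
    by (rule in_Linf2_borel[OF K(1)]) (rule that)
  obtain k2 where k2[measurable]: "k2 \<in> borel_measurable (borel \<Otimes>\<^sub>M borel)"
    and Kk2: "AE z in ?P. K2 (fst z) (snd z) = k2 z" and k2_L2: "integrable ?P (\<lambda>z. (k2 z)\<^sup>2)"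
    by (rule in_Linf2_borel[OF K(2)]) (rule that)
  obtain h1 where h1[measurable]: "h1 \<in> borel_measurable (borel \<Otimes>\<^sub>M borel)"
    and fh1: "AE z in ?X \<Otimes>\<^sub>M ?Y. f1 (fst z) (snd z) = h1 z"
    and h1_L2: "AE s in ?Y. integrable ?X (\<lambda>x. (h1 (x, s))\<^sup>2)"
    and h1_int: "integrable ?Y (\<lambda>s. sqrt (\<integral>x. (h1 (x, s))\<^sup>2 \<partial>?X))"
    by (rule in_L1L2_borel[OF f(1)]) (rule that)
  obtain h2 where h2[measurable]: "h2 \<in> borel_measurable (borel \<Otimes>\<^sub>M borel)"
    and fh2: "AE z in ?X \<Otimes>\<^sub>M ?Y. f2 (fst z) (snd z) = h2 z"
    and h2_L2: "AE s in ?Y. integrable ?X (\<lambda>x. (h2 (x, s))\<^sup>2)"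
    and h2_int: "integrable ?Y (\<lambda>s. sqrt (\<integral>x. (h2 (x, s))\<^sup>2 \<partial>?X))"
    by (rule in_L1L2_borel[OF f(2)]) (rule that)
  obtain p1 where p1[measurable]: "p1 \<in> borel_measurable borel" and gp1: "AE x in ?X. g1 x = p1 x"
    by (rule borel_measurable_lebesgue_on_ex_borel[OF Omega_borel conjunct1[OF g(1)[unfolded in_L2_def]]]) (rule that)
  obtain p2 where p2[measurable]: "p2 \<in> borel_measurable borel" and gp2: "AE x in ?X. g2 x = p2 x"
    by (rule borel_measurable_lebesgue_on_ex_borel[OF Omega_borel conjunct1[OF g(2)[unfolded in_L2_def]]]) (rule that)
  have p_L2: "integrable ?X (\<lambda>x. (p1 x)\<^sup>2)" "integrable ?X (\<lambda>x. (p2 x)\<^sup>2)"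
    using g in_L2_lebesgue_on_iff[OF Omega_borel p1 gp1] in_L2_lebesgue_on_iff[OF Omega_borel p2 gp2] by auto

  define D0 where "D0 x = p1 x - p2 x" for x
  define V where "V z = v1 z - v2 z" for z
  define \<kappa> where "\<kappa> = sqrt (\<integral>z. (k1 z - k2 z)\<^sup>2 \<partial>?P)"
  define \<phi> where "\<phi> s = sqrt (\<integral>x. (h1 (x, s) - h2 (x, s))\<^sup>2 \<partial>?X)" for s
  \<comment> \<open>\<open>a\<close> collects the differences of the data and drives the estimate.
    \<open>N\<close> below is built from the data themselves and only certifies that the time
    derivative of the difference is integrable with values in L^2.\<close>
  define a where "a s = \<kappa> + \<phi> s" for s
  define \<phi>1 where "\<phi>1 s = sqrt (\<integral>x. (h1 (x, s))\<^sup>2 \<partial>?X)" for s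
  define \<phi>2 where "\<phi>2 s = sqrt (\<integral>x. (h2 (x, s))\<^sup>2 \<partial>?X)" for s
  define \<kappa>1 where "\<kappa>1 = sqrt (\<integral>z. (k1 z)\<^sup>2 \<partial>?P)"
  define \<kappa>2 where "\<kappa>2 = sqrt (\<integral>z. (k2 z)\<^sup>2 \<partial>?P)"
  define N where "N s = 2 * (\<kappa>1 + \<kappa>2 + \<phi>1 s + \<phi>2 s)" for s
  define d where "d x t = D0 x + (\<integral>s. indicator {..t} s * V (x, s) \<partial>?Y)" for x t
  have nn: "\<kappa> \<ge> 0" "\<kappa>1 \<ge> 0" "\<kappa>2 \<ge> 0" "\<phi> s \<ge> 0" "\<phi>1 s \<ge> 0" "\<phi>2 s \<ge> 0" for s
    by (simp_all add: \<kappa>_def \<kappa>1_def \<kappa>2_def \<phi>_def \<phi>1_def \<phi>2_def)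
  have sq: "\<kappa>1\<^sup>2 = (\<integral>z. (k1 z)\<^sup>2 \<partial>?P)" "\<kappa>2\<^sup>2 = (\<integral>z. (k2 z)\<^sup>2 \<partial>?P)"
    "(\<phi>1 s)\<^sup>2 = (\<integral>x. (h1 (x, s))\<^sup>2 \<partial>?X)" "(\<phi>2 s)\<^sup>2 = (\<integral>x. (h2 (x, s))\<^sup>2 \<partial>?X)" for s
    by (simp_all add: \<kappa>1_def \<kappa>2_def \<phi>1_def \<phi>2_def)
  have [measurable]: "V \<in> borel_measurable (borel \<Otimes>\<^sub>M borel)" "D0 \<in> borel_measurable borel"
    unfolding V_def[abs_def] D0_def[abs_def] by measurable
  have d_meas[measurable]: "(\<lambda>x. d x t) \<in> borel_measurable borel" for t
    unfolding d_def by measurable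
  have \<phi>_meas[measurable]: "\<phi> \<in> borel_measurable borel"
    unfolding \<phi>_def by measurable
  have D0_L2: "integrable ?X (\<lambda>x. (D0 x)\<^sup>2)"
    unfolding D0_def using p_L2 by (intro integrable_square_diff) auto
  have h12_L2: "AE s in ?Y. integrable ?X (\<lambda>x. (h1 (x, s) - h2 (x, s))\<^sup>2)"
    using h1_L2 h2_L2 by eventually_elim (intro integrable_square_diff, auto)
  have \<phi>_int: "integrable ?Y \<phi>"
  proof (rule Bochner_Integration.integrable_bound[of _ "\<lambda>s. 2 * (\<phi>1 s + \<phi>2 s)"])
    show "integrable ?Y (\<lambda>s. 2 * (\<phi>1 s + \<phi>2 s))"
      unfolding \<phi>1_def \<phi>2_def using h1_int h2_int by auto
    show "AE s in ?Y. norm (\<phi> s) \<le> norm (2 * (\<phi>1 s + \<phi>2 s))"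
      using h1_L2 h2_L2 h12_L2
    proof eventually_elim
      case (elim s)
      have "(\<phi> s)\<^sup>2 = (\<integral>x. (h1 (x, s) - h2 (x, s))\<^sup>2 \<partial>?X)" by (simp add: \<phi>_def)
      also have "\<dots> \<le> (\<integral>x. 2 * (h1 (x, s))\<^sup>2 + 2 * (h2 (x, s))\<^sup>2 \<partial>?X)"
      proof (intro integral_mono elim)
        show "(h1 (x, s) - h2 (x, s))\<^sup>2 \<le> 2 * (h1 (x, s))\<^sup>2 + 2 * (h2 (x, s))\<^sup>2" for x
          using zero_le_power2[of "h1 (x, s) + h2 (x, s)"] by (simp add: power2_sum power2_diff)
      qed (use elim in auto)
      also have "\<dots> = 2 * (\<phi>1 s)\<^sup>2 + 2 * (\<phi>2 s)\<^sup>2"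
        using elim by (simp add: sq)
      also have "\<dots> \<le> (2 * (\<phi>1 s + \<phi>2 s))\<^sup>2"
        using nn by (simp add: power2_sum power_mult_distrib algebra_simps)
      finally have "\<phi> s \<le> 2 * (\<phi>1 s + \<phi>2 s)"
        by (rule power2_le_imp_le) (use nn in simp)
      then show ?case using nn by simp
    qed
  qed measurable
  have rep: "AE x in ?X. u1 x t - u2 x t = d x t" if t: "t \<in> {0..T}" for t
    using rep1[OF t] rep2[OF t] XY.AE_integrable_fst'[OF v1_int] XY.AE_integrable_fst'[OF v2_int] gp1 gp2
  proof eventually_elim
    case (elim x)
    have "(\<integral>s. indicator {..t} s * V (x, s) \<partial>?Y) =
        (\<integral>s. indicator {..t} s * v1 (x, s) \<partial>?Y) - (\<integral>s. indicator {..t} s * v2 (x, s) \<partial>?Y)"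
      unfolding V_def right_diff_distrib using elim
      by (intro Bochner_Integration.integral_diff integrable_indicator_mult) auto
    with elim show ?case by (simp add: d_def D0_def)
  qed
  \<comment> \<open>The multipliers are quantified inside the statement for each \<open>s\<close>:
    nothing is claimed on their dependence on time, and they are eliminated again in the
    inequalities \<open>VN\<close> and \<open>diss\<close>.\<close>
  have decomp: "AE s in ?Y. \<exists>w1 w2. w1 \<in> borel_measurable (borel \<Otimes>\<^sub>M borel) \<and> w2 \<in> borel_measurable (borel \<Otimes>\<^sub>M borel) \<and>
     (AE z in ?P. \<bar>w1 z\<bar> \<le> 1) \<and> (AE z in ?P. \<bar>w2 z\<bar> \<le> 1) \<and>
     (AE z in ?P. w1 z = - w1 (snd z, fst z)) \<and> (AE z in ?P. w2 z = - w2 (snd z, fst z)) \<and>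
     (AE z in ?P. (d (snd z) s - d (fst z) s) * (w1 z - w2 z) \<ge> 0) \<and>
     (AE x in ?X. V (x, s) = ((\<integral>y. k1 (x, y) * w1 (x, y) \<partial>?X) - (\<integral>y. k2 (x, y) * w2 (x, y) \<partial>?X))
        + (h1 (x, s) - h2 (x, s)))"
    using eqn1 eqn2 XY.AE_pair_snd[OF fh1] XY.AE_pair_snd[OF fh2] AE_lborel_ind_in[OF atLeastAtMost_borel]
  proof eventually_elim
    case (elim s)
    obtain \<eta>1 \<eta>2 where lap: "one_laplacian K1 (\<lambda>x. u1 x s) \<eta>1" "one_laplacian K2 (\<lambda>x. u2 x s) \<eta>2"
      and ve: "AE x in ?X. v1 (x, s) = - \<eta>1 x + f1 x s" "AE x in ?X. v2 (x, s) = - \<eta>2 x + f2 x s"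
      using elim(1,2) by blast
    obtain w1 where w1: "w1 \<in> borel_measurable (borel \<Otimes>\<^sub>M borel)" "AE z in ?P. \<bar>w1 z\<bar> \<le> 1"
      "AE z in ?P. w1 z = - w1 (snd z, fst z)" "AE z in ?P. w1 z \<in> subdiff_abs (u1 (snd z) s - u1 (fst z) s)"
      "AE x in ?X. \<eta>1 x = - (\<integral>y. k1 (x, y) * w1 (x, y) \<partial>?X)"
      by (rule one_laplacian_borel[OF lap(1) k1 Kk1]) (rule that)
    obtain w2 where w2: "w2 \<in> borel_measurable (borel \<Otimes>\<^sub>M borel)" "AE z in ?P. \<bar>w2 z\<bar> \<le> 1"
      "AE z in ?P. w2 z = - w2 (snd z, fst z)" "AE z in ?P. w2 z \<in> subdiff_abs (u2 (snd z) s - u2 (fst z) s)"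
      "AE x in ?X. \<eta>2 x = - (\<integral>y. k2 (x, y) * w2 (x, y) \<partial>?X)"
      by (rule one_laplacian_borel[OF lap(2) k2 Kk2]) (rule that)
    have d_fst: "AE z in ?P. u1 (fst z) s - u2 (fst z) s = d (fst z) s"
      by (rule XX.AE_pair_fst[OF rep[OF elim(5)]])
    have d_snd: "AE z in ?P. u1 (snd z) s - u2 (snd z) s = d (snd z) s"
      using X.AE_pair_swap[OF d_fst] by simp
    have mono: "AE z in ?P. (d (snd z) s - d (fst z) s) * (w1 z - w2 z) \<ge> 0"
      using d_fst d_snd w1(4) w2(4)
    proof eventually_elim
      case (elim z)
      have "d (snd z) s - d (fst z) s = (u1 (snd z) s - u1 (fst z) s) - (u2 (snd z) s - u2 (fst z) s)"
        using elim(1,2) by linarith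
      then show ?case using subdiff_abs_monotone[OF elim(3,4)] by simp
    qed
    have "AE x in ?X. V (x, s) = ((\<integral>y. k1 (x, y) * w1 (x, y) \<partial>?X) - (\<integral>y. k2 (x, y) * w2 (x, y) \<partial>?X))
        + (h1 (x, s) - h2 (x, s))"
      using ve w1(5) w2(5) elim(3,4) by eventually_elim (simp add: V_def)
    with w1 w2 mono show ?case by blast
  qed
  have k1_symm: "AE z in ?P. k1 z = k1 (snd z, fst z)" and k1_nonneg: "AE z in ?P. k1 z \<ge> 0"
  proof -
    have in_fst: "AE z in ?P. fst z \<in> Omega"
      by (rule XX.AE_pair_fst[OF AE_lborel_ind_in[OF Omega_borel]])
    have in_snd: "AE z in ?P. snd z \<in> Omega"
      using X.AE_pair_swap[OF in_fst] by simp
    show "AE z in ?P. k1 z = k1 (snd z, fst z)"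
      using Kk1 X.AE_pair_swap[OF Kk1] in_fst in_snd
    proof eventually_elim
      case (elim z)
      then show ?case using symm[of "fst z" "snd z"] by simp
    qed
    show "AE z in ?P. k1 z \<ge> 0"
      using Kk1 in_fst in_snd
    proof eventually_elim
      case (elim z)
      then show ?case using nonneg[of "fst z" "snd z"] by simp
    qed
  qed
  have VN: "AE s in ?Y. (\<integral>\<^sup>+x. ennreal ((V (x, s))\<^sup>2) \<partial>?X) \<le> ennreal ((N s)\<^sup>2)"
    using decomp h1_L2 h2_L2
  proof eventually_elim
    case (elim s)
    then obtain w1 w2 where [measurable]: "w1 \<in> borel_measurable (borel \<Otimes>\<^sub>M borel)" "w2 \<in> borel_measurable (borel \<Otimes>\<^sub>M borel)"
      and w: "AE z in ?P. \<bar>w1 z\<bar> \<le> 1" "AE z in ?P. \<bar>w2 z\<bar> \<le> 1"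
      and Veq: "AE x in ?X. V (x, s) = ((\<integral>y. k1 (x, y) * w1 (x, y) \<partial>?X) - (\<integral>y. k2 (x, y) * w2 (x, y) \<partial>?X))
        + (h1 (x, s) - h2 (x, s))"
      by blast
    define A1 where "A1 x = (\<integral>y. k1 (x, y) * w1 (x, y) \<partial>?X)" for x
    define A2 where "A2 x = (\<integral>y. k2 (x, y) * w2 (x, y) \<partial>?X)" for x
    have A1: "integrable ?X (\<lambda>x. (A1 x)\<^sup>2)" "(\<integral>x. (A1 x)\<^sup>2 \<partial>?X) \<le> \<kappa>1\<^sup>2"
      unfolding A1_def sq using kernel_integral_L2[OF X _ _ k1_L2 w(1)] by auto
    have A2: "integrable ?X (\<lambda>x. (A2 x)\<^sup>2)" "(\<integral>x. (A2 x)\<^sup>2 \<partial>?X) \<le> \<kappa>2\<^sup>2"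
      unfolding A2_def sq using kernel_integral_L2[OF X _ _ k2_L2 w(2)] by auto
    have "(\<integral>\<^sup>+x. ennreal ((V (x, s))\<^sup>2) \<partial>?X)
        \<le> (\<integral>\<^sup>+x. ennreal (4 * ((A1 x)\<^sup>2 + (A2 x)\<^sup>2 + (h1 (x, s))\<^sup>2 + (h2 (x, s))\<^sup>2)) \<partial>?X)"
    proof (rule nn_integral_mono_AE)
      show "AE x in ?X. ennreal ((V (x, s))\<^sup>2) \<le> ennreal (4 * ((A1 x)\<^sup>2 + (A2 x)\<^sup>2 + (h1 (x, s))\<^sup>2 + (h2 (x, s))\<^sup>2))"
        using Veq
      proof eventually_elim
        case (elim x)
        have four: "(p - q + (r - c))\<^sup>2 \<le> 4 * (p\<^sup>2 + q\<^sup>2 + r\<^sup>2 + c\<^sup>2)" for p q r c :: real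
        \<comment> \<open>Four times the sum of the squares minus the square of the signed sum
          equals the sum of the six squares below. The factor 4 is the square of the 2 in
          \<open>N\<close>.\<close>
        proof -
          have "0 \<le> (p + q)\<^sup>2 + (p - r)\<^sup>2 + (p + c)\<^sup>2 + (q + r)\<^sup>2 + (q - c)\<^sup>2 + (r + c)\<^sup>2" by simp
          then show ?thesis by (simp add: power2_eq_square algebra_simps)
        qed
        show ?case
          unfolding elim A1_def[symmetric] A2_def[symmetric] by (intro ennreal_leI four)
      qed
    qed
    also have "\<dots> = ennreal (\<integral>x. 4 * ((A1 x)\<^sup>2 + (A2 x)\<^sup>2 + (h1 (x, s))\<^sup>2 + (h2 (x, s))\<^sup>2) \<partial>?X)"
      using A1(1) A2(1) elim(2,3) by (intro nn_integral_eq_integral) auto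
    also have "\<dots> = ennreal (4 * ((\<integral>x. (A1 x)\<^sup>2 \<partial>?X) + (\<integral>x. (A2 x)\<^sup>2 \<partial>?X) + (\<phi>1 s)\<^sup>2 + (\<phi>2 s)\<^sup>2))"
      using A1(1) A2(1) elim(2,3) by (simp add: sq)
    also have "\<dots> \<le> ennreal ((N s)\<^sup>2)"
    proof (rule ennreal_leI)
      have "\<kappa>1\<^sup>2 + \<kappa>2\<^sup>2 + (\<phi>1 s)\<^sup>2 + (\<phi>2 s)\<^sup>2 \<le> (\<kappa>1 + \<kappa>2 + \<phi>1 s + \<phi>2 s)\<^sup>2"
        using nn by (simp add: power2_eq_square algebra_simps)
      then show "4 * ((\<integral>x. (A1 x)\<^sup>2 \<partial>?X) + (\<integral>x. (A2 x)\<^sup>2 \<partial>?X) + (\<phi>1 s)\<^sup>2 + (\<phi>2 s)\<^sup>2) \<le> (N s)\<^sup>2"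
        unfolding N_def power_mult_distrib using A1(2) A2(2) by simp
    qed
    finally show ?case .
  qed
  have diss: "AE s in ?Y. integrable ?X (\<lambda>x. (d x s)\<^sup>2) \<longrightarrow>
      (\<integral>x. d x s * V (x, s) \<partial>?X) \<le> sqrt (\<integral>x. (d x s)\<^sup>2 \<partial>?X) * a s"
    using decomp h12_L2
  proof eventually_elim
    case (elim s)
    then obtain w1 w2 where [measurable]: "w1 \<in> borel_measurable (borel \<Otimes>\<^sub>M borel)" "w2 \<in> borel_measurable (borel \<Otimes>\<^sub>M borel)"
      and w: "AE z in ?P. \<bar>w1 z\<bar> \<le> 1" "AE z in ?P. \<bar>w2 z\<bar> \<le> 1"
        "AE z in ?P. w1 z = - w1 (snd z, fst z)" "AE z in ?P. w2 z = - w2 (snd z, fst z)"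
        "AE z in ?P. (d (snd z) s - d (fst z) s) * (w1 z - w2 z) \<ge> 0"
      and Veq: "AE x in ?X. V (x, s) = ((\<integral>y. k1 (x, y) * w1 (x, y) \<partial>?X) - (\<integral>y. k2 (x, y) * w2 (x, y) \<partial>?X))
        + (h1 (x, s) - h2 (x, s))"
      by blast
    show ?case
    proof
      assume d2: "integrable ?X (\<lambda>x. (d x s)\<^sup>2)"
      define A where "A x = (\<integral>y. k1 (x, y) * w1 (x, y) \<partial>?X) - (\<integral>y. k2 (x, y) * w2 (x, y) \<partial>?X)" for x
      have [measurable]: "A \<in> borel_measurable borel" unfolding A_def by measurable
      have "integrable ?X (\<lambda>x. (A x)\<^sup>2)"
        unfolding A_def
        using kernel_integral_L2(1)[OF X _ _ k1_L2 w(1)] kernel_integral_L2(1)[OF X _ _ k2_L2 w(2)]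
        by (intro integrable_square_diff) auto
      then have dA: "integrable ?X (\<lambda>x. d x s * A x)"
        using d2 by (intro Cauchy_Schwarz_integral) auto
      have dh: "integrable ?X (\<lambda>x. d x s * (h1 (x, s) - h2 (x, s)))"
        using d2 elim(2) by (intro Cauchy_Schwarz_integral) auto
      have "(\<integral>x. d x s * V (x, s) \<partial>?X) = (\<integral>x. d x s * A x + d x s * (h1 (x, s) - h2 (x, s)) \<partial>?X)"
      proof (rule integral_cong_AE)
        show "AE x in ?X. d x s * V (x, s) = d x s * A x + d x s * (h1 (x, s) - h2 (x, s))"
          using Veq by eventually_elim (simp add: A_def distrib_left)
      qed measurable
      also have "\<dots> = (\<integral>x. d x s * A x \<partial>?X) + (\<integral>x. d x s * (h1 (x, s) - h2 (x, s)) \<partial>?X)"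
        using dA dh by simp
      also have "(\<integral>x. d x s * A x \<partial>?X) \<le> sqrt (\<integral>x. (d x s)\<^sup>2 \<partial>?X) * \<kappa>"
        unfolding A_def \<kappa>_def
        using k1_L2 k2_L2 w k1_symm k1_nonneg d2 by (intro kernel_dissipation[OF X]) auto
      also have "(\<integral>x. d x s * (h1 (x, s) - h2 (x, s)) \<partial>?X) \<le> sqrt (\<integral>x. (d x s)\<^sup>2 \<partial>?X) * \<phi> s"
        using Cauchy_Schwarz_integral(2)[of "\<lambda>x. d x s" ?X "\<lambda>x. h1 (x, s) - h2 (x, s)"] d2 elim(2)
        by (simp add: \<phi>_def)
      finally show "(\<integral>x. d x s * V (x, s) \<partial>?X) \<le> sqrt (\<integral>x. (d x s)\<^sup>2 \<partial>?X) * a s"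
        by (simp add: a_def distrib_left)
    qed
  qed
  have a_int: "integrable ?Y a" unfolding a_def using \<phi>_int by simp
  have N_int: "integrable ?Y N" unfolding N_def \<phi>1_def \<phi>2_def using h1_int h2_int by simp
  note est = energy_estimate[of ?X V D0 T N a t, folded d_def, OF X.sigma_finite_measure_axioms _ _ D0_L2 N_int _ VN a_int _ diss t]
  have d2: "integrable ?X (\<lambda>x. (d x t)\<^sup>2)"
    using nn by (intro est(1)) (auto simp: N_def a_def)
  have "sqrt (\<integral>x. (d x t)\<^sup>2 \<partial>?X) \<le> sqrt (\<integral>x. (D0 x)\<^sup>2 \<partial>?X) + (\<integral>s. indicator {..t} s * a s \<partial>?Y)"
    using nn by (intro est(2)) (auto simp: N_def a_def)
  also have "(\<integral>s. indicator {..t} s * a s \<partial>?Y) \<le> (\<integral>s. a s \<partial>?Y)"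
  proof (intro integral_mono a_int integrable_indicator_mult)
    show "indicator {..t} s * a s \<le> a s" for s
      using nn by (auto simp: a_def split: split_indicator)
  qed simp
  \<comment> \<open>The kernel rate \<open>\<kappa>\<close> is constant in time, hence the factor
    \<open>T\<close>.\<close>
  also have "(\<integral>s. a s \<partial>?Y) = (\<integral>s. \<phi> s \<partial>?Y) + T * \<kappa>"
    unfolding a_def using \<phi>_int mY by simp
  finally have final: "sqrt (\<integral>x. (d x t)\<^sup>2 \<partial>?X) \<le> sqrt (\<integral>x. (D0 x)\<^sup>2 \<partial>?X) + (\<integral>s. \<phi> s \<partial>?Y) + T * \<kappa>"
    by simp
  have nu: "norm_L2 (lebesgue_on Omega) (\<lambda>x. u1 x t - u2 x t) = ennreal (sqrt (\<integral>x. (d x t)\<^sup>2 \<partial>?X))"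
    by (rule norm_L2_lebesgue_on[OF Omega_borel _ rep[OF t] d2]) measurable
  have ng: "norm_L2 (lebesgue_on Omega) (\<lambda>x. g1 x - g2 x) = ennreal (sqrt (\<integral>x. (D0 x)\<^sup>2 \<partial>?X))"
  proof (rule norm_L2_lebesgue_on[OF Omega_borel _ _ D0_L2])
    show "AE x in ?X. g1 x - g2 x = D0 x" using gp1 gp2 by eventually_elim (simp add: D0_def)
  qed measurable
  have nK: "norm_L2 (lebesgue_on (Omega \<times> Omega)) (\<lambda>z. K1 (fst z) (snd z) - K2 (fst z) (snd z)) = ennreal \<kappa>"
  proof -
    have "norm_L2 (lebesgue_on (Omega \<times> Omega)) (\<lambda>z. K1 (fst z) (snd z) - K2 (fst z) (snd z))
       = ennreal (sqrt (\<integral>z. (k1 z - k2 z)\<^sup>2 \<partial>lborel_ind (Omega \<times> Omega)))"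
    proof (rule norm_L2_lebesgue_on)
      show "(Omega :: (real^'n) set) \<times> (Omega :: (real^'n) set) \<in> sets borel" by (simp add: borel_Times)
      show "(\<lambda>z. k1 z - k2 z) \<in> borel_measurable borel"
        using k1 k2 by (simp add: borel_prod)
      show "AE z in lborel_ind (Omega \<times> Omega). K1 (fst z) (snd z) - K2 (fst z) (snd z) = k1 z - k2 z"
        unfolding lborel_ind_Times[OF Omega_borel Omega_borel, symmetric]
        using Kk1 Kk2 by eventually_elim simp
      show "integrable (lborel_ind (Omega \<times> Omega)) (\<lambda>z. (k1 z - k2 z)\<^sup>2)"
        unfolding lborel_ind_Times[OF Omega_borel Omega_borel, symmetric]
        using k1_L2 k2_L2 by (intro integrable_square_diff) auto
    qed
    then show ?thesis by (simp add: \<kappa>_def lborel_ind_Times)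
  qed
  have nf: "norm_L1L2 T (\<lambda>x t. f1 x t - f2 x t) = ennreal (\<integral>s. \<phi> s \<partial>?Y)"
  proof -
    have "norm_L1L2 T (\<lambda>x t. f1 x t - f2 x t) = (\<integral>\<^sup>+s. ennreal (\<phi> s) \<partial>?Y)"
      unfolding \<phi>_def
    proof (rule norm_L1L2_borel[where h="\<lambda>z. h1 z - h2 z"])
      show "AE z in ?X \<Otimes>\<^sub>M ?Y. f1 (fst z) (snd z) - f2 (fst z) (snd z) = h1 z - h2 z"
        using fh1 fh2 by eventually_elim simp
    qed (use h12_L2 in auto)
    also have "\<dots> = ennreal (\<integral>s. \<phi> s \<partial>?Y)"
      using \<phi>_int nn by (intro nn_integral_eq_integral) auto
    finally show ?thesis .
  qed
  have "0 \<le> (\<integral>s. \<phi> s \<partial>?Y)" using nn by (intro integral_nonneg_AE) auto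
  then show ?thesis
    unfolding nu ng nK nf using final T nn
    by (simp add: ennreal_leI flip: ennreal_mult ennreal_plus)
qed

section \<open>Convergence\<close>

lemma clip_square_le:
  fixes x c :: real
  assumes "c \<ge> 0"
  shows "(x - max (- c) (min c x))\<^sup>2 \<le> (if c\<^sup>2 < x\<^sup>2 then x\<^sup>2 else 0)"
proof (cases "\<bar>x\<bar> \<le> c")
  case True
  then have "max (- c) (min c x) = x" by auto
  then show ?thesis by simp
next
  case False
  then have "c\<^sup>2 < \<bar>x\<bar>\<^sup>2" using assms by (intro power_strict_mono) auto
  moreover have "\<bar>x - max (- c) (min c x)\<bar> \<le> \<bar>x\<bar>" using False assms by auto
  then have "\<bar>x - max (- c) (min c x)\<bar>\<^sup>2 \<le> \<bar>x\<bar>\<^sup>2" by (intro power_mono) auto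
  ultimately show ?thesis by simp
qed

text \<open>Vitali's theorem in \<open>L\<^sup>2\<close>. The functions are clipped at a level \<open>c\<close>: the clipped parts
  converge by dominated convergence, and the tails are uniformly small, for the limit by Fatou.\<close>

lemma Vitali_L2:
  fixes h :: "nat \<Rightarrow> 'a \<Rightarrow> real"
  assumes fin: "finite_measure M" and h: "\<And>n. h n \<in> borel_measurable M" and l: "l \<in> borel_measurable M"
    and conv: "AE x in M. (\<lambda>n. h n x) \<longlonglongrightarrow> l x"
    and ui: "unif_integrable M (\<lambda>n x. \<bar>h n x\<bar>\<^sup>2)"
  shows "(\<lambda>n. \<integral>\<^sup>+x. ennreal ((h n x - l x)\<^sup>2) \<partial>M) \<longlonglongrightarrow> 0"
proof -
  interpret finite_measure M by fact
  note [measurable] = h l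
  define tail where "tail f c = (\<integral>\<^sup>+x. ennreal (if c\<^sup>2 < (f x)\<^sup>2 then (f x)\<^sup>2 else 0) \<partial>M)" for f :: "'a \<Rightarrow> real" and c :: real
  have small: "\<exists>c>0. (\<forall>n. tail (h n) c \<le> \<epsilon>) \<and> tail l c \<le> \<epsilon>" if "\<epsilon> > 0" for \<epsilon> :: ennreal
  proof -
    have "\<forall>\<^sub>F c :: real in at_top. (SUP n. \<integral>\<^sup>+x\<in>{x \<in> space M. c < \<bar>\<bar>h n x\<bar>\<^sup>2\<bar>}. ennreal \<bar>\<bar>h n x\<bar>\<^sup>2\<bar> \<partial>M) < \<epsilon>"
      using ui that unfolding unif_integrable_def by (auto dest: order_tendstoD)
    then obtain c0 :: real where c0: "\<And>c. c \<ge> c0 \<Longrightarrow> (SUP n. \<integral>\<^sup>+x\<in>{x \<in> space M. c < \<bar>\<bar>h n x\<bar>\<^sup>2\<bar>}. ennreal \<bar>\<bar>h n x\<bar>\<^sup>2\<bar> \<partial>M) < \<epsilon>"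
      unfolding eventually_at_top_linorder by blast
    \<comment> \<open>The tails are cut where the square exceeds c^2, so c^2 has to reach the
      threshold \<open>c0\<close>; c >= 1 ensures c^2 >= c >= c0.\<close>
    define c where "c = max 1 c0"
    have c: "c > 0" "c\<^sup>2 \<ge> c0"
    proof -
      show "c > 0" by (simp add: c_def)
      have "c * 1 \<le> c * c" by (intro mult_left_mono) (auto simp: c_def)
      then show "c\<^sup>2 \<ge> c0" by (simp add: power2_eq_square c_def)
    qed
    have tail_h: "tail (h n) c \<le> \<epsilon>" for n
    proof -
      have "tail (h n) c = (\<integral>\<^sup>+x\<in>{x \<in> space M. c\<^sup>2 < \<bar>\<bar>h n x\<bar>\<^sup>2\<bar>}. ennreal \<bar>\<bar>h n x\<bar>\<^sup>2\<bar> \<partial>M)"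
        unfolding tail_def by (intro nn_integral_cong) (auto split: split_indicator)
      also have "\<dots> \<le> (SUP n. \<integral>\<^sup>+x\<in>{x \<in> space M. c\<^sup>2 < \<bar>\<bar>h n x\<bar>\<^sup>2\<bar>}. ennreal \<bar>\<bar>h n x\<bar>\<^sup>2\<bar> \<partial>M)"
        by (intro SUP_upper) simp
      finally show ?thesis using c0[OF c(2)] by (meson less_imp_le order_trans)
    qed
    \<comment> \<open>The strict inequality in \<open>tail\<close> matters: if c^2 < l(x)^2, then
      c^2 < h_n(x)^2 for all large n, so the truncated squares are lower semicontinuous along the
      sequence and Fatou applies.\<close>
    have "tail l c \<le> (\<integral>\<^sup>+x. liminf (\<lambda>n. ennreal (if c\<^sup>2 < (h n x)\<^sup>2 then (h n x)\<^sup>2 else 0)) \<partial>M)"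
      unfolding tail_def
    proof (rule nn_integral_mono_AE)
      show "AE x in M. ennreal (if c\<^sup>2 < (l x)\<^sup>2 then (l x)\<^sup>2 else 0)
          \<le> liminf (\<lambda>n. ennreal (if c\<^sup>2 < (h n x)\<^sup>2 then (h n x)\<^sup>2 else 0))"
        using conv
      proof eventually_elim
        case (elim x)
        have lim: "(\<lambda>n. (h n x)\<^sup>2) \<longlonglongrightarrow> (l x)\<^sup>2" using elim by (intro tendsto_intros)
        show ?case
        proof (cases "c\<^sup>2 < (l x)\<^sup>2")
          case True
          have "\<forall>\<^sub>F n in sequentially. ennreal ((h n x)\<^sup>2) = ennreal (if c\<^sup>2 < (h n x)\<^sup>2 then (h n x)\<^sup>2 else 0)"
            using order_tendstoD(1)[OF lim True] by eventually_elim simp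
          moreover have "(\<lambda>n. ennreal ((h n x)\<^sup>2)) \<longlonglongrightarrow> ennreal ((l x)\<^sup>2)"
            using lim by (rule tendsto_ennrealI)
          ultimately have "(\<lambda>n. ennreal (if c\<^sup>2 < (h n x)\<^sup>2 then (h n x)\<^sup>2 else 0)) \<longlonglongrightarrow> ennreal ((l x)\<^sup>2)"
            by (rule Lim_transform_eventually[rotated])
          then show ?thesis
            using True lim_imp_Liminf[OF sequentially_bot] by fastforce
        qed simp
      qed
    qed
    also have "\<dots> \<le> liminf (\<lambda>n. tail (h n) c)"
      unfolding tail_def by (rule nn_integral_liminf) measurable
    also have "\<dots> \<le> liminf (\<lambda>n. \<epsilon>)"
      using tail_h by (intro Liminf_mono) auto
    also have "\<dots> = \<epsilon>" by (simp add: Liminf_const)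
    finally show ?thesis using c(1) tail_h by blast
  qed
  define clip :: "real \<Rightarrow> real \<Rightarrow> real" where "clip c x = max (- c) (min c x)" for c x
  have [measurable]: "clip c \<in> borel_measurable borel" for c unfolding clip_def by measurable
  have clip_conv: "(\<lambda>n. \<integral>\<^sup>+x. ennreal ((clip c (h n x) - clip c (l x))\<^sup>2) \<partial>M) \<longlonglongrightarrow> 0" if "c > 0" for c
  proof -
    have "(\<lambda>n. \<integral>\<^sup>+x. ennreal ((clip c (h n x) - clip c (l x))\<^sup>2) \<partial>M) \<longlonglongrightarrow> (\<integral>\<^sup>+x. 0 \<partial>M)"
    proof (rule nn_integral_dominated_convergence[where w="\<lambda>_. ennreal ((2 * c)\<^sup>2)"])
      show "AE x in M. ennreal ((clip c (h n x) - clip c (l x))\<^sup>2) \<le> ennreal ((2 * c)\<^sup>2)" for n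
      proof (intro AE_I2 ennreal_leI)
        fix x
        have "\<bar>clip c (h n x) - clip c (l x)\<bar> \<le> 2 * c" using that by (auto simp: clip_def)
        then have "\<bar>clip c (h n x) - clip c (l x)\<bar>\<^sup>2 \<le> (2 * c)\<^sup>2" by (intro power_mono) auto
        then show "(clip c (h n x) - clip c (l x))\<^sup>2 \<le> (2 * c)\<^sup>2" by simp
      qed
      show "(\<integral>\<^sup>+x. ennreal ((2 * c)\<^sup>2) \<partial>M) < \<infinity>"
        by (simp add: ennreal_mult_less_top emeasure_eq_measure)
      show "AE x in M. (\<lambda>n. ennreal ((clip c (h n x) - clip c (l x))\<^sup>2)) \<longlonglongrightarrow> 0"
        using conv
      proof eventually_elim
        case (elim x)
        have "(\<lambda>n. (clip c (h n x) - clip c (l x))\<^sup>2) \<longlonglongrightarrow> (clip c (l x) - clip c (l x))\<^sup>2"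
          unfolding clip_def using elim by (intro tendsto_intros)
        from tendsto_ennrealI[OF this] show ?case by simp
      qed
    qed measurable
    then show ?thesis by simp
  qed
  have bound: "(\<integral>\<^sup>+x. ennreal ((h n x - l x)\<^sup>2) \<partial>M)
      \<le> 3 * (tail (h n) c + (\<integral>\<^sup>+x. ennreal ((clip c (h n x) - clip c (l x))\<^sup>2) \<partial>M) + tail l c)" if "c > 0" for n c
  proof -
    have "(\<integral>\<^sup>+x. ennreal ((h n x - l x)\<^sup>2) \<partial>M) \<le> (\<integral>\<^sup>+x. 3 * (ennreal (if c\<^sup>2 < (h n x)\<^sup>2 then (h n x)\<^sup>2 else 0)
        + ennreal ((clip c (h n x) - clip c (l x))\<^sup>2) + ennreal (if c\<^sup>2 < (l x)\<^sup>2 then (l x)\<^sup>2 else 0)) \<partial>M)"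
    proof (rule nn_integral_mono)
      fix x
      have three: "(p + q + r)\<^sup>2 \<le> 3 * (p\<^sup>2 + q\<^sup>2 + r\<^sup>2)" for p q r :: real
      proof -
        have "0 \<le> (p - q)\<^sup>2 + (p - r)\<^sup>2 + (q - r)\<^sup>2" by simp
        then show ?thesis by (simp add: power2_eq_square algebra_simps)
      qed
      have to_ennreal: "ennreal y \<le> 3 * (ennreal p + ennreal q + ennreal r)"
        if "y \<le> 3 * (p + q + r)" "0 \<le> p" "0 \<le> q" "0 \<le> r" for y p q r :: real
      proof -
        have "3 * (ennreal p + ennreal q + ennreal r) = ennreal (3 * (p + q + r))"
          using that by (simp add: ennreal_mult)
        then show ?thesis using that(1) by (simp only: ennreal_leI)
      qed
      have "(h n x - l x)\<^sup>2 = ((h n x - clip c (h n x)) + (clip c (h n x) - clip c (l x)) + (clip c (l x) - l x))\<^sup>2"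
        by simp
      also have "\<dots> \<le> 3 * ((h n x - clip c (h n x))\<^sup>2 + (clip c (h n x) - clip c (l x))\<^sup>2 + (clip c (l x) - l x)\<^sup>2)"
        by (rule three)
      also have "\<dots> \<le> 3 * ((if c\<^sup>2 < (h n x)\<^sup>2 then (h n x)\<^sup>2 else 0) + (clip c (h n x) - clip c (l x))\<^sup>2
          + (if c\<^sup>2 < (l x)\<^sup>2 then (l x)\<^sup>2 else 0))"
        using clip_square_le[of c "h n x"] clip_square_le[of c "l x"] that
        by (simp add: clip_def power2_commute[of _ "l x"])
      finally show "ennreal ((h n x - l x)\<^sup>2) \<le> 3 * (ennreal (if c\<^sup>2 < (h n x)\<^sup>2 then (h n x)\<^sup>2 else 0)
        + ennreal ((clip c (h n x) - clip c (l x))\<^sup>2) + ennreal (if c\<^sup>2 < (l x)\<^sup>2 then (l x)\<^sup>2 else 0))"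
        by (intro to_ennreal) auto
    qed
    also have "\<dots> = 3 * (tail (h n) c + (\<integral>\<^sup>+x. ennreal ((clip c (h n x) - clip c (l x))\<^sup>2) \<partial>M) + tail l c)"
      unfolding tail_def by (subst nn_integral_cmult, measurable, subst nn_integral_add, measurable,
        subst nn_integral_add, measurable)
    finally show ?thesis .
  qed
  show ?thesis
  proof (rule order_tendstoI)
    fix e :: ennreal assume "0 < e"
    \<comment> \<open>Three terms of size \<epsilon> and the factor 3 of \<open>bound\<close> add up
      to half of \<open>min e 1\<close>. The minimum with 1 keeps the value finite when
      \<open>e\<close> is infinite, so that halving is strict.\<close>
    define \<epsilon> where "\<epsilon> = min e 1 / 18"
    have "\<epsilon> > 0" using \<open>0 < e\<close> by (auto simp: \<epsilon>_def ennreal_zero_less_divide)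
    then obtain c where c: "c > 0" "\<And>n. tail (h n) c \<le> \<epsilon>" "tail l c \<le> \<epsilon>" using small by blast
    have "\<forall>\<^sub>F n in sequentially. (\<integral>\<^sup>+x. ennreal ((clip c (h n x) - clip c (l x))\<^sup>2) \<partial>M) < \<epsilon>"
      using order_tendstoD(2)[OF clip_conv[OF c(1)] \<open>\<epsilon> > 0\<close>] .
    then show "\<forall>\<^sub>F n in sequentially. (\<integral>\<^sup>+x. ennreal ((h n x - l x)\<^sup>2) \<partial>M) < e"
    proof eventually_elim
      case (elim n)
      have "(\<integral>\<^sup>+x. ennreal ((h n x - l x)\<^sup>2) \<partial>M) \<le> 3 * (\<epsilon> + \<epsilon> + \<epsilon>)"
        using bound[OF c(1), of n] c(2)[of n] c(3) elim
        by (meson add_mono less_imp_le mult_left_mono order_trans zero_le)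
      also have "\<dots> < e"
      proof -
        obtain m where m: "min e 1 = ennreal m" "m > 0"
          using \<open>0 < e\<close> by (cases "min e 1") (auto simp: min_def top_unique split: if_splits)
        have "3 * (\<epsilon> + \<epsilon> + \<epsilon>) = ennreal (m / 2)"
        proof -
          have "\<epsilon> = ennreal (m / 18)" unfolding \<epsilon>_def m using m(2) by (simp flip: ennreal_numeral add: divide_ennreal)
          then have "\<epsilon> + \<epsilon> + \<epsilon> = ennreal (m / 6)" using m(2) by (simp flip: ennreal_plus)
          then show ?thesis using m(2) by (simp flip: ennreal_numeral ennreal_mult)
        qed
        also have "\<dots> < ennreal m" using m(2) by (simp add: ennreal_less_iff)
        also have "\<dots> \<le> e" using m(1) by (metis min.cobounded1)
        finally show ?thesis .
      qed
      finally show ?case .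
    qed
  qed simp
qed

lemma ennreal_tendsto_0_if_square:
  fixes x :: "'a \<Rightarrow> ennreal"
  assumes "((\<lambda>n. (x n)\<^sup>2) \<longlongrightarrow> 0) F"
  shows "(x \<longlongrightarrow> 0) F"
proof (rule order_tendstoI)
  fix e :: ennreal assume "0 < e"
  then have "0 < e\<^sup>2" by (simp add: power2_eq_square ennreal_zero_less_mult_iff)
  from order_tendstoD(2)[OF assms this] show "\<forall>\<^sub>F n in F. x n < e"
    by eventually_elim (meson not_less power_mono zero_le)
qed simp

lemma ennreal_tendsto_0_le:
  fixes x y :: "'a \<Rightarrow> ennreal"
  assumes "(y \<longlongrightarrow> 0) F" "\<And>n. x n \<le> y n"
  shows "(x \<longlongrightarrow> 0) F"
  by (rule tendsto_sandwich[of "\<lambda>_. 0" x F y]) (use assms in auto)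

text \<open>\<open>norm_L2\<close> is infinite outside L^2; convergence of the integrals makes them
  finite for all large \<open>n\<close>, and from then on the norm is the genuine root.\<close>

lemma norm_L2_tendsto_0:
  assumes meas: "\<And>n. h n \<in> borel_measurable M"
    and lim: "(\<lambda>n. \<integral>\<^sup>+x. ennreal ((h n x)\<^sup>2) \<partial>M) \<longlonglongrightarrow> 0"
  shows "(\<lambda>n. norm_L2 M (h n)) \<longlonglongrightarrow> 0"
proof (rule ennreal_tendsto_0_if_square, rule Lim_transform_eventually[OF lim])
  note [measurable] = meas
  have "\<forall>\<^sub>F n in sequentially. (\<integral>\<^sup>+x. ennreal ((h n x)\<^sup>2) \<partial>M) < \<infinity>"
    using order_tendstoD(2)[OF lim, of \<infinity>] by simp
  then show "\<forall>\<^sub>F n in sequentially. (\<integral>\<^sup>+x. ennreal ((h n x)\<^sup>2) \<partial>M) = (norm_L2 M (h n))\<^sup>2"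
  proof eventually_elim
    case (elim n)
    then have "integrable M (\<lambda>x. (h n x)\<^sup>2)"
      by (intro integrableI_bounded) auto
    then show ?case
      using meas by (simp add: norm_L2_def in_L2_def nn_integral_eq_integral ennreal_power)
  qed
qed

lemma norm_L2_eq_0_iff: "norm_L2 M h = 0 \<longleftrightarrow> h \<in> borel_measurable M \<and> (AE x in M. h x = 0)"
proof
  assume 0: "norm_L2 M h = 0"
  then have L2: "in_L2 M h" by (auto simp: norm_L2_def split: if_splits)
  with 0 have "sqrt (\<integral>x. (h x)\<^sup>2 \<partial>M) \<le> 0"
    by (simp add: norm_L2_def ennreal_eq_0_iff)
  moreover have "0 \<le> (\<integral>x. (h x)\<^sup>2 \<partial>M)" by (intro integral_nonneg_AE) auto
  ultimately have "(\<integral>x. (h x)\<^sup>2 \<partial>M) = 0" by simp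
  with L2 have "AE x in M. (h x)\<^sup>2 = 0"
    by (subst (asm) integral_nonneg_eq_0_iff_AE) (auto simp: in_L2_def)
  then show "h \<in> borel_measurable M \<and> (AE x in M. h x = 0)"
    using L2 by (simp add: in_L2_def)
next
  assume h: "h \<in> borel_measurable M \<and> (AE x in M. h x = 0)"
  then have ae: "AE x in M. (h x)\<^sup>2 = 0" by auto
  have "integrable M (\<lambda>x. (h x)\<^sup>2)"
    by (rule integrable_cong_AE_imp[of M "\<lambda>_. 0"]) (use h in auto)
  moreover have "(\<integral>x. (h x)\<^sup>2 \<partial>M) = 0"
    using h by (subst integral_cong_AE[OF _ _ ae]) auto
  ultimately show "norm_L2 M h = 0"
    using h by (simp add: norm_L2_def in_L2_def)
qed

lemma solution_P1_unique:
  fixes K :: "real^'n \<Rightarrow> real^'n \<Rightarrow> real"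
  assumes T: "T > 0" and sol: "solution_P1 K f g T v" "solution_P1 K f g T u"
    and K: "\<And>x y. x \<in> Omega \<Longrightarrow> y \<in> Omega \<Longrightarrow> K x y \<ge> 0"
      "\<And>x y. x \<in> Omega \<Longrightarrow> y \<in> Omega \<Longrightarrow> K x y = K y x" "in_Linf2 K"
    and g: "in_L2 (lebesgue_on Omega) g" and f: "in_L1L2 T f" and t: "t \<in> {0..T}"
  shows "AE x in lebesgue_on Omega. v x t = u x t"
proof -
  have zero: "norm_L2 M (\<lambda>x. 0) = 0" for M :: "'b measure"
    by (simp add: norm_L2_eq_0_iff)
  have "norm_L2 (lebesgue_on Omega) (\<lambda>x. v x t - u x t) \<le> 0"
    using solution_P1_stability[OF T sol K(1,2,3,3) g g f f t]
    by (simp add: zero norm_L1L2_def)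
  then have "AE x in lebesgue_on Omega. v x t - u x t = 0"
    by (simp add: norm_L2_eq_0_iff)
  then show ?thesis by eventually_elim simp
qed

text \<open>Cauchy-Schwarz in time. It links the L^1-in-time norm of the stability estimate to the
  L^2 norm on the space-time cylinder, where Vitali's theorem works; the right side may be
  infinite.\<close>

lemma norm_L1L2_square_le:
  fixes f1 f2 :: "real^'n \<Rightarrow> real \<Rightarrow> real"
  assumes T: "T > 0" and f: "in_L1L2 T f1" "in_L1L2 T f2"
  shows "(norm_L1L2 T (\<lambda>x t. f1 x t - f2 x t))\<^sup>2
    \<le> ennreal T * (\<integral>\<^sup>+z. ennreal ((f1 (fst z) (snd z) - f2 (fst z) (snd z))\<^sup>2) \<partial>lebesgue_on (Omega \<times> {0..T}))"
proof -
  let ?X = "lborel_ind (Omega :: (real^'n) set)" and ?Y = "lborel_ind {0..T}"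
  interpret XY: pair_sigma_finite ?X ?Y by (rule pair_sigma_finite_lborel_ind) auto
  obtain h1 where h1[measurable]: "h1 \<in> borel_measurable (borel \<Otimes>\<^sub>M borel)"
    and fh1: "AE z in ?X \<Otimes>\<^sub>M ?Y. f1 (fst z) (snd z) = h1 z"
    and h1_L2: "AE s in ?Y. integrable ?X (\<lambda>x. (h1 (x, s))\<^sup>2)"
    by (rule in_L1L2_borel[OF f(1)]) (rule that)
  obtain h2 where h2[measurable]: "h2 \<in> borel_measurable (borel \<Otimes>\<^sub>M borel)"
    and fh2: "AE z in ?X \<Otimes>\<^sub>M ?Y. f2 (fst z) (snd z) = h2 z"
    and h2_L2: "AE s in ?Y. integrable ?X (\<lambda>x. (h2 (x, s))\<^sup>2)"
    by (rule in_L1L2_borel[OF f(2)]) (rule that)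
  define h where "h z = h1 z - h2 z" for z
  have h[measurable]: "h \<in> borel_measurable (borel \<Otimes>\<^sub>M borel)" unfolding h_def[abs_def] by measurable
  have fh: "AE z in ?X \<Otimes>\<^sub>M ?Y. f1 (fst z) (snd z) - f2 (fst z) (snd z) = h z"
    using fh1 fh2 by eventually_elim (simp add: h_def)
  have L2: "AE s in ?Y. integrable ?X (\<lambda>x. (h (x, s))\<^sup>2)"
    using h1_L2 h2_L2 unfolding h_def by eventually_elim (intro integrable_square_diff, auto)
  define \<phi> where "\<phi> s = sqrt (\<integral>x. (h (x, s))\<^sup>2 \<partial>?X)" for s
  have [measurable]: "\<phi> \<in> borel_measurable borel" unfolding \<phi>_def by measurable
  have "norm_L1L2 T (\<lambda>x t. f1 x t - f2 x t) = (\<integral>\<^sup>+s. ennreal (\<phi> s) * 1 \<partial>?Y)"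
    using norm_L1L2_borel[OF h _ L2, of "\<lambda>x t. f1 x t - f2 x t"] fh by (simp add: \<phi>_def)
  also have "(\<dots>)\<^sup>2 \<le> (\<integral>\<^sup>+s. (ennreal (\<phi> s))\<^sup>2 \<partial>?Y) * (\<integral>\<^sup>+s. 1\<^sup>2 \<partial>?Y)"
    by (rule Cauchy_Schwarz_nn_integral) measurable
  also have "(\<integral>\<^sup>+s. 1\<^sup>2 \<partial>?Y) = ennreal T"
    using T by (simp add: emeasure_lborel_ind_UNIV)
  also have "(\<integral>\<^sup>+s. (ennreal (\<phi> s))\<^sup>2 \<partial>?Y) = (\<integral>\<^sup>+s. (\<integral>\<^sup>+x. ennreal ((h (x, s))\<^sup>2) \<partial>?X) \<partial>?Y)"
  proof (rule nn_integral_cong_AE)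
    show "AE s in ?Y. (ennreal (\<phi> s))\<^sup>2 = (\<integral>\<^sup>+x. ennreal ((h (x, s))\<^sup>2) \<partial>?X)"
      using L2 by eventually_elim (simp add: \<phi>_def ennreal_power nn_integral_eq_integral)
  qed
  also have "\<dots> = (\<integral>\<^sup>+z. ennreal ((h z)\<^sup>2) \<partial>(?X \<Otimes>\<^sub>M ?Y))"
    by (rule XY.nn_integral_snd) measurable
  also have "\<dots> = (\<integral>\<^sup>+z. ennreal ((h z)\<^sup>2) \<partial>lborel_ind (Omega \<times> {0..T}))"
    by (simp add: lborel_ind_Times)
  also have "\<dots> = (\<integral>\<^sup>+z. ennreal ((f1 (fst z) (snd z) - f2 (fst z) (snd z))\<^sup>2) \<partial>lebesgue_on (Omega \<times> {0..T}))"
  proof (rule nn_integral_lebesgue_on_AE_eq[where h="\<lambda>_ y. ennreal (y\<^sup>2)", symmetric])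
    show hb: "h \<in> borel_measurable borel" using h by (simp add: borel_prod)
    then show "(\<lambda>z. ennreal ((h z)\<^sup>2)) \<in> borel_measurable borel" by measurable
    show "AE z in lborel_ind (Omega \<times> {0..T}). f1 (fst z) (snd z) - f2 (fst z) (snd z) = h z"
      using fh unfolding lborel_ind_Times[OF Omega_borel atLeastAtMost_borel] .
  qed (simp add: borel_Times)
  finally show ?thesis by (simp add: mult.commute)
qed

theorem theorem5p5:
  fixes T :: real
    and K :: "real^'n \<Rightarrow> real^'n \<Rightarrow> real" and f :: "real^'n \<Rightarrow> real \<Rightarrow> real"
    and g :: "real^'n \<Rightarrow> real" and u :: "real^'n \<Rightarrow> real \<Rightarrow> real"
    and Ks :: "nat \<Rightarrow> real^'n \<Rightarrow> real^'n \<Rightarrow> real" and fs :: "nat \<Rightarrow> real^'n \<Rightarrow> real \<Rightarrow> real"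
    and gs :: "nat \<Rightarrow> real^'n \<Rightarrow> real" and us :: "nat \<Rightarrow> real^'n \<Rightarrow> real \<Rightarrow> real"
  assumes T: "T > 0"
    and u_sol: "solution_P1 K f g T u"
    and us_sol: "\<And>n. solution_P1 (Ks n) (fs n) (gs n) T (us n)"
    and K_nonneg: "\<And>x y. x \<in> Omega \<Longrightarrow> y \<in> Omega \<Longrightarrow> K x y \<ge> 0"
    and K_symm: "\<And>x y. x \<in> Omega \<Longrightarrow> y \<in> Omega \<Longrightarrow> K x y = K y x"
    and K_Linf2: "in_Linf2 K"
    and Ks_nonneg: "\<And>n x y. x \<in> Omega \<Longrightarrow> y \<in> Omega \<Longrightarrow> Ks n x y \<ge> 0"
    and Ks_symm: "\<And>n x y. x \<in> Omega \<Longrightarrow> y \<in> Omega \<Longrightarrow> Ks n x y = Ks n y x"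
    and Ks_Linf2: "\<And>n. in_Linf2 (Ks n)"
    and g_L2: "in_L2 (lebesgue_on Omega) g"
    and gs_L2: "\<And>n. in_L2 (lebesgue_on Omega) (gs n)"
    and f_L1L2: "in_L1L2 T f"
    and fs_L1L2: "\<And>n. in_L1L2 T (fs n)"
  shows
    \<comment> \<open>(i) uniqueness\<close>
    "(\<forall>v. solution_P1 K f g T v \<longrightarrow>
          (\<forall>t\<in>{0..T}. AE x in lebesgue_on Omega. v x t = u x t)) \<and>
     (\<forall>n v. solution_P1 (Ks n) (fs n) (gs n) T v \<longrightarrow>
          (\<forall>t\<in>{0..T}. AE x in lebesgue_on Omega. v x t = us n x t)) \<and>
     \<comment> \<open>(ii) stability estimate\<close>
     (\<forall>n. norm_CL2 T (\<lambda>x t. us n x t - u x t)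
            \<le> norm_L2 (lebesgue_on Omega) (\<lambda>x. gs n x - g x)
              + norm_L1L2 T (\<lambda>x t. fs n x t - f x t)
              + ennreal T * norm_L2 (lebesgue_on (Omega \<times> Omega))
                               (\<lambda>z. Ks n (fst z) (snd z) - K (fst z) (snd z))) \<and>
     \<comment> \<open>(iii) convergence\<close>
     ((AE z in lebesgue_on (Omega \<times> Omega).
          (\<lambda>n. Ks n (fst z) (snd z)) \<longlonglongrightarrow> K (fst z) (snd z)) \<and>
      (AE x in lebesgue_on Omega. (\<lambda>n. gs n x) \<longlonglongrightarrow> g x) \<and>
      (AE z in lebesgue_on (Omega \<times> {0..T}).
          (\<lambda>n. fs n (fst z) (snd z)) \<longlonglongrightarrow> f (fst z) (snd z)) \<and>
      unif_integrable (lebesgue_on (Omega \<times> Omega))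
          (\<lambda>n z. \<bar>Ks n (fst z) (snd z)\<bar>\<^sup>2) \<and>
      unif_integrable (lebesgue_on Omega) (\<lambda>n x. \<bar>gs n x\<bar>\<^sup>2) \<and>
      unif_integrable (lebesgue_on (Omega \<times> {0..T}))
          (\<lambda>n z. \<bar>fs n (fst z) (snd z)\<bar>\<^sup>2)
      \<longrightarrow> (\<lambda>n. norm_CL2 T (\<lambda>x t. us n x t - u x t)) \<longlonglongrightarrow> 0)"
proof -
  let ?B = "\<lambda>n. norm_L2 (lebesgue_on Omega) (\<lambda>x. gs n x - g x)
              + norm_L1L2 T (\<lambda>x t. fs n x t - f x t)
              + ennreal T * norm_L2 (lebesgue_on (Omega \<times> Omega))
                               (\<lambda>z. Ks n (fst z) (snd z) - K (fst z) (snd z))"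
  have stab: "norm_CL2 T (\<lambda>x t. us n x t - u x t) \<le> ?B n" for n
    unfolding norm_CL2_def
    by (intro SUP_least solution_P1_stability[OF T us_sol u_sol Ks_nonneg Ks_symm Ks_Linf2 K_Linf2
          gs_L2 g_L2 fs_L1L2 f_L1L2])
  have conv: "(\<lambda>n. norm_CL2 T (\<lambda>x t. us n x t - u x t)) \<longlonglongrightarrow> 0"
    if K_lim: "AE z in lebesgue_on (Omega \<times> Omega). (\<lambda>n. Ks n (fst z) (snd z)) \<longlonglongrightarrow> K (fst z) (snd z)"
      and g_lim: "AE x in lebesgue_on Omega. (\<lambda>n. gs n x) \<longlonglongrightarrow> g x"
      and f_lim: "AE z in lebesgue_on (Omega \<times> {0..T}). (\<lambda>n. fs n (fst z) (snd z)) \<longlonglongrightarrow> f (fst z) (snd z)"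
      and K_ui: "unif_integrable (lebesgue_on (Omega \<times> Omega)) (\<lambda>n z. \<bar>Ks n (fst z) (snd z)\<bar>\<^sup>2)"
      and g_ui: "unif_integrable (lebesgue_on Omega) (\<lambda>n x. \<bar>gs n x\<bar>\<^sup>2)"
      and f_ui: "unif_integrable (lebesgue_on (Omega \<times> {0..T})) (\<lambda>n z. \<bar>fs n (fst z) (snd z)\<bar>\<^sup>2)"
  proof -
    have fin: "finite_measure (lebesgue_on ((Omega :: (real^'n) set)))"
        "finite_measure (lebesgue_on ((Omega :: (real^'n) set) \<times> (Omega :: (real^'n) set)))"
        "finite_measure (lebesgue_on ((Omega :: (real^'n) set) \<times> {0..T}))"
      unfolding Omega_def box_real(2)[symmetric] cbox_Pair_eq[symmetric]
      by (intro finite_measure_lebesgue_on lmeasurable_cbox)+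
    have g_meas: "g \<in> borel_measurable (lebesgue_on Omega)" "\<And>n. gs n \<in> borel_measurable (lebesgue_on Omega)"
      using g_L2 gs_L2 by (auto simp: in_L2_def)
    have K_meas: "(\<lambda>z. K (fst z) (snd z)) \<in> borel_measurable (lebesgue_on (Omega \<times> Omega))"
       "\<And>n. (\<lambda>z. Ks n (fst z) (snd z)) \<in> borel_measurable (lebesgue_on (Omega \<times> Omega))"
      using K_Linf2 Ks_Linf2 by (auto simp: in_Linf2_def)
    have f_meas: "(\<lambda>z. f (fst z) (snd z)) \<in> borel_measurable (lebesgue_on (Omega \<times> {0..T}))"
       "\<And>n. (\<lambda>z. fs n (fst z) (snd z)) \<in> borel_measurable (lebesgue_on (Omega \<times> {0..T}))"
      using f_L1L2 fs_L1L2 by (auto simp: in_L1L2_def)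
    have G: "(\<lambda>n. norm_L2 (lebesgue_on Omega) (\<lambda>x. gs n x - g x)) \<longlonglongrightarrow> 0"
      using g_meas Vitali_L2[OF fin(1) g_meas(2,1) g_lim g_ui] by (intro norm_L2_tendsto_0) auto
    have KK: "(\<lambda>n. norm_L2 (lebesgue_on (Omega \<times> Omega)) (\<lambda>z. Ks n (fst z) (snd z) - K (fst z) (snd z))) \<longlonglongrightarrow> 0"
      using K_meas Vitali_L2[OF fin(2) K_meas(2,1) K_lim K_ui]
      by (intro norm_L2_tendsto_0 borel_measurable_diff) auto
    \<comment> \<open>The limit \<open>f\<close> is given in L^1 of time with values in L^2, not as
      square integrable on the cylinder. \<open>Vitali_L2\<close> asks only for measurability of the
      limit, since Fatou bounds its tail.\<close>
    have "(\<lambda>n. ennreal T * (\<integral>\<^sup>+z. ennreal ((fs n (fst z) (snd z) - f (fst z) (snd z))\<^sup>2)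
        \<partial>lebesgue_on (Omega \<times> {0..T}))) \<longlonglongrightarrow> ennreal T * 0"
      by (intro ennreal_tendsto_cmult Vitali_L2[OF fin(3) f_meas(2,1) f_lim f_ui]) simp
    then have "(\<lambda>n. (norm_L1L2 T (\<lambda>x t. fs n x t - f x t))\<^sup>2) \<longlonglongrightarrow> 0"
      unfolding mult_zero_right
      by (rule ennreal_tendsto_0_le) (rule norm_L1L2_square_le[OF T fs_L1L2 f_L1L2])
    then have F: "(\<lambda>n. norm_L1L2 T (\<lambda>x t. fs n x t - f x t)) \<longlonglongrightarrow> 0"
      by (rule ennreal_tendsto_0_if_square)
    have "?B \<longlonglongrightarrow> 0 + 0 + ennreal T * 0"
      by (intro tendsto_add G F ennreal_tendsto_cmult KK) simp
    then have "?B \<longlonglongrightarrow> 0" by simp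
    then show ?thesis using stab by (rule ennreal_tendsto_0_le)
  qed
  show ?thesis
    using solution_P1_unique[OF T _ u_sol K_nonneg K_symm K_Linf2 g_L2 f_L1L2]
      solution_P1_unique[OF T _ us_sol Ks_nonneg Ks_symm Ks_Linf2 gs_L2 fs_L1L2] stab conv
    by blast
qed

end
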